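(* Let $k$ be an algebraically closed field of characteristic different from $2$, let $G$ be a group and let $\sigma$ be an irreducible $4$-dimensional representation of $G$ on a $k$-vector space $V$. Then the following are equivalent: (1) $\wedge^2\sigma$ is reducible; (2) $\sigma$ satisfies at least one of: (a) $\sigma$ is essentially self-dual of symplectic type; (b) $\sigma$ has a nontrivial quadratic self-twist; (c) $\sigma$ is essentially self-dual of proper orthogonal type.
   Context: $\sigma$ is essentially self-dual if $\sigma^\vee\cong\chi\otimes\sigma$ for some character $\chi$ of $G$; then $\chi^{-1}$ is a subrepresentation of $\sigma\otimes\sigma$, and $\sigma$ is of symplectic type if $\chi^{-1}$ occurs in $\wedge^2\sigma$ and of orthogonal type if $\chi^{-1}$ occurs in $\mathrm{Sym}^2\sigma$. If $\sigma$ is essentially self-dual of orthogonal type there is a nondegenerate symmetric bilinear form $C$ on $V$ with $\sigma(G)\subset\mathrm{GO}(C)$ (the group of similitudes of $C$); $\sigma$ is of proper orthogonal type if $\sigma(G)\subset\mathrm{GSO}(C)$, the identity component of $\mathrm{GO}(C)$ (proper similitudes). $\sigma$ has a nontrivial quadratic self-twist if $\sigma\cong\chi\otimes\sigma$ for a nontrivial $\{\pm1\}$-valued character $\chi$ of $G$. *)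

theory Defs
  imports
    "HOL-Algebra.Group"
    "HOL-Analysis.Abstract_Topology_2"
    "HOL-Computational_Algebra.Polynomial"
    "HOL-Library.Function_Algebras"
begin

section \<open>Representations\<close>

text \<open>
  A representation of \<open>G\<close> is given by a scalar multiplication \<open>s\<close> on an ambient type, the
  underlying space \<open>V\<close> (a subspace of the ambient vector space) and the action \<open>\<rho>\<close>. The carrier
  \<open>V\<close> is needed for duals and tensor squares, which are subspaces of function types. The maps
  \<open>\<rho> g\<close> are linear on the ambient space; for \<open>V = UNIV\<close> this is the textbook notion.
\<close>

definition group_rep ::
  "('g, 'm) monoid_scheme \<Rightarrow> ('k::field \<Rightarrow> 'v::ab_group_add \<Rightarrow> 'v) \<Rightarrow> 'v set \<Rightarrow> ('g \<Rightarrow> 'v \<Rightarrow> 'v) \<Rightarrow> bool"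
  where "group_rep G s V \<rho> \<longleftrightarrow>
    group G \<and> vector_space s \<and> module.subspace s V \<and>
    (\<forall>g\<in>carrier G. Vector_Spaces.linear s s (\<rho> g) \<and> \<rho> g ` V \<subseteq> V) \<and>
    (\<forall>v\<in>V. \<rho> \<one>\<^bsub>G\<^esub> v = v) \<and>
    (\<forall>g\<in>carrier G. \<forall>h\<in>carrier G. \<forall>v\<in>V. \<rho> (g \<otimes>\<^bsub>G\<^esub> h) v = \<rho> g (\<rho> h v))"

definition subrep ::
  "('g, 'm) monoid_scheme \<Rightarrow> ('k::field \<Rightarrow> 'v::ab_group_add \<Rightarrow> 'v) \<Rightarrow> 'v set \<Rightarrow> ('g \<Rightarrow> 'v \<Rightarrow> 'v) \<Rightarrow> 'v set \<Rightarrow> bool"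
  where "subrep G s V \<rho> U \<longleftrightarrow>
    module.subspace s U \<and> U \<subseteq> V \<and> (\<forall>g\<in>carrier G. \<rho> g ` U \<subseteq> U)"

definition irreducible_rep ::
  "('g, 'm) monoid_scheme \<Rightarrow> ('k::field \<Rightarrow> 'v::ab_group_add \<Rightarrow> 'v) \<Rightarrow> 'v set \<Rightarrow> ('g \<Rightarrow> 'v \<Rightarrow> 'v) \<Rightarrow> bool"
  where "irreducible_rep G s V \<rho> \<longleftrightarrow>
    V \<noteq> {0} \<and> (\<forall>U. subrep G s V \<rho> U \<longrightarrow> U = {0} \<or> U = V)"

definition reducible_rep ::
  "('g, 'm) monoid_scheme \<Rightarrow> ('k::field \<Rightarrow> 'v::ab_group_add \<Rightarrow> 'v) \<Rightarrow> 'v set \<Rightarrow> ('g \<Rightarrow> 'v \<Rightarrow> 'v) \<Rightarrow> bool"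
  where "reducible_rep G s V \<rho> \<longleftrightarrow>
    (\<exists>U. subrep G s V \<rho> U \<and> U \<noteq> {0} \<and> U \<noteq> V)"

definition iso_rep ::
  "('g, 'm) monoid_scheme \<Rightarrow>
   ('k::field \<Rightarrow> 'v::ab_group_add \<Rightarrow> 'v) \<Rightarrow> 'v set \<Rightarrow> ('g \<Rightarrow> 'v \<Rightarrow> 'v) \<Rightarrow>
   ('k \<Rightarrow> 'w::ab_group_add \<Rightarrow> 'w) \<Rightarrow> 'w set \<Rightarrow> ('g \<Rightarrow> 'w \<Rightarrow> 'w) \<Rightarrow> bool"
  where "iso_rep G s V \<rho> s' V' \<rho>' \<longleftrightarrow>
    (\<exists>T. Vector_Spaces.linear s s' T \<and> bij_betw T V V' \<and>
      (\<forall>g\<in>carrier G. \<forall>v\<in>V. T (\<rho> g v) = \<rho>' g (T v)))"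

definition group_character :: "('g, 'm) monoid_scheme \<Rightarrow> ('g \<Rightarrow> 'k::field) \<Rightarrow> bool"
  where "group_character G \<chi> \<longleftrightarrow>
    (\<forall>g\<in>carrier G. \<chi> g \<noteq> 0) \<and>
    (\<forall>g\<in>carrier G. \<forall>h\<in>carrier G. \<chi> (g \<otimes>\<^bsub>G\<^esub> h) = \<chi> g * \<chi> h)"

definition twist_rep ::
  "('k \<Rightarrow> 'v \<Rightarrow> 'v) \<Rightarrow> ('g \<Rightarrow> 'k) \<Rightarrow> ('g \<Rightarrow> 'v \<Rightarrow> 'v) \<Rightarrow> 'g \<Rightarrow> 'v \<Rightarrow> 'v"
  where "twist_rep s \<chi> \<rho> = (\<lambda>g v. s (\<chi> g) (\<rho> g v))"

text \<open>The character \<open>\<chi>\<close> is isomorphic to a (one-dimensional) subrepresentation of \<open>\<rho>\<close>.\<close>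

definition character_occurs ::
  "('g, 'm) monoid_scheme \<Rightarrow> ('k::field \<Rightarrow> 'v::ab_group_add \<Rightarrow> 'v) \<Rightarrow> 'v set \<Rightarrow> ('g \<Rightarrow> 'v \<Rightarrow> 'v) \<Rightarrow> ('g \<Rightarrow> 'k) \<Rightarrow> bool"
  where "character_occurs G s V \<rho> \<chi> \<longleftrightarrow>
    (\<exists>v\<in>V. v \<noteq> 0 \<and> (\<forall>g\<in>carrier G. \<rho> g v = s (\<chi> g) v))"

section \<open>Dual, tensor square, exterior and symmetric square\<close>

definition fun_scale :: "'k::field \<Rightarrow> ('a \<Rightarrow> 'k) \<Rightarrow> 'a \<Rightarrow> 'k"
  where "fun_scale c f = (\<lambda>x. c * f x)"

definition dual_space :: "('k::field \<Rightarrow> 'v::ab_group_add \<Rightarrow> 'v) \<Rightarrow> ('v \<Rightarrow> 'k) set"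
  where "dual_space s = {f. Vector_Spaces.linear s (*) f}"

definition dual_rep :: "('g, 'm) monoid_scheme \<Rightarrow> ('g \<Rightarrow> 'v \<Rightarrow> 'v) \<Rightarrow> 'g \<Rightarrow> ('v \<Rightarrow> 'k) \<Rightarrow> 'v \<Rightarrow> 'k"
  where "dual_rep G \<sigma> g f = (\<lambda>v. f (\<sigma> (inv\<^bsub>G\<^esub> g) v))"

definition bilinear_form :: "('k::field \<Rightarrow> 'v::ab_group_add \<Rightarrow> 'v) \<Rightarrow> ('v \<Rightarrow> 'v \<Rightarrow> 'k) \<Rightarrow> bool"
  where "bilinear_form s B \<longleftrightarrow>
    (\<forall>v. Vector_Spaces.linear s (*) (\<lambda>w. B v w)) \<and>
    (\<forall>w. Vector_Spaces.linear s (*) (\<lambda>v. B v w))"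

text \<open>
  The tensor product is realised inside the dual of the space of bilinear forms: \<open>v \<otimes> w\<close> is
  evaluation \<open>B \<mapsto> B v w\<close> (extended by \<open>0\<close> to arguments that are not bilinear forms), and
  \<open>V \<otimes> V\<close> is the span of these pure tensors. Over a field this is the usual tensor product.
\<close>

type_synonym ('k, 'v) tensor2 = "('v \<Rightarrow> 'v \<Rightarrow> 'k) \<Rightarrow> 'k"

definition pure_tensor :: "('k::field \<Rightarrow> 'v::ab_group_add \<Rightarrow> 'v) \<Rightarrow> 'v \<Rightarrow> 'v \<Rightarrow> ('k, 'v) tensor2"
  where "pure_tensor s v w = (\<lambda>B. if bilinear_form s B then B v w else 0)"

definition tensor_square :: "('k::field \<Rightarrow> 'v::ab_group_add \<Rightarrow> 'v) \<Rightarrow> ('k, 'v) tensor2 set"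
  where "tensor_square s = module.span fun_scale {pure_tensor s v w | v w. True}"

text \<open>The action of \<open>\<sigma> \<otimes> \<sigma>\<close>; see \<open>tensor_square_rep_pure\<close> below.\<close>

definition tensor_square_rep :: "('g \<Rightarrow> 'v \<Rightarrow> 'v) \<Rightarrow> 'g \<Rightarrow> ('k, 'v) tensor2 \<Rightarrow> ('k, 'v) tensor2"
  where "tensor_square_rep \<sigma> g t = (\<lambda>B. t (\<lambda>v w. B (\<sigma> g v) (\<sigma> g w)))"

text \<open>
  The exterior and symmetric squares, as the subrepresentations of \<open>\<sigma> \<otimes> \<sigma>\<close> of antisymmetric and
  symmetric tensors; \<open>\<sigma> \<otimes> \<sigma>\<close> is their direct sum, and they agree with the usual quotients of
  \<open>\<sigma> \<otimes> \<sigma>\<close>, when the characteristic is not 2. They are only meant to be used in that case.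
\<close>

definition exterior_square :: "('k::field \<Rightarrow> 'v::ab_group_add \<Rightarrow> 'v) \<Rightarrow> ('k, 'v) tensor2 set"
  where "exterior_square s =
    module.span fun_scale {pure_tensor s v w - pure_tensor s w v | v w. True}"

definition symmetric_square :: "('k::field \<Rightarrow> 'v::ab_group_add \<Rightarrow> 'v) \<Rightarrow> ('k, 'v) tensor2 set"
  where "symmetric_square s =
    module.span fun_scale {pure_tensor s v w + pure_tensor s w v | v w. True}"

lemma linear_char:
  "Vector_Spaces.linear s1 s2 f \<longleftrightarrow> vector_space s1 \<and> vector_space s2 \<and>
    (\<forall>x y. f (x + y) = f x + f y) \<and> (\<forall>c x. f (s1 c x) = s2 c (f x))"
  by (auto simp: linear_iff_module_hom module_hom_iff module_iff_vector_space)

lemma vector_space_fun_scale: "vector_space (fun_scale :: 'k::field \<Rightarrow> ('a \<Rightarrow> 'k) \<Rightarrow> 'a \<Rightarrow> 'k)"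
  by unfold_locales (auto simp: fun_scale_def fun_eq_iff algebra_simps)

lemma vector_space_times: "vector_space ((*) :: 'k::field \<Rightarrow> 'k \<Rightarrow> 'k)"
  by unfold_locales (auto simp: algebra_simps)

lemma pure_tensor_bilinear:
  "pure_tensor s (u + v) w = pure_tensor s u w + pure_tensor s v w"
  "pure_tensor s u (v + w) = pure_tensor s u v + pure_tensor s u w"
  "pure_tensor s (s c u) v = fun_scale c (pure_tensor s u v)"
  "pure_tensor s u (s c v) = fun_scale c (pure_tensor s u v)"
  by (auto simp: pure_tensor_def fun_scale_def fun_eq_iff bilinear_form_def linear_char)

lemma group_rep_inv:
  assumes "group_rep G s UNIV \<sigma>" "g \<in> carrier G"
  shows "\<sigma> g (\<sigma> (inv\<^bsub>G\<^esub> g) v) = v" "\<sigma> (inv\<^bsub>G\<^esub> g) (\<sigma> g v) = v"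
proof -
  have "group G" using assms by (simp add: group_rep_def)
  then have "inv\<^bsub>G\<^esub> g \<in> carrier G" "g \<otimes>\<^bsub>G\<^esub> inv\<^bsub>G\<^esub> g = \<one>\<^bsub>G\<^esub>" "inv\<^bsub>G\<^esub> g \<otimes>\<^bsub>G\<^esub> g = \<one>\<^bsub>G\<^esub>"
    using assms(2) by (simp_all add: group.r_inv group.l_inv)
  then show "\<sigma> g (\<sigma> (inv\<^bsub>G\<^esub> g) v) = v" "\<sigma> (inv\<^bsub>G\<^esub> g) (\<sigma> g v) = v"
    using assms unfolding group_rep_def by (metis UNIV_I)+
qed

lemma group_rep_dual:
  assumes "group_rep G s UNIV \<sigma>"
  shows "group_rep G fun_scale (dual_space s) (dual_rep G \<sigma>)"
proof -
  interpret G: group G using assms by (simp add: group_rep_def)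
  have lin: "Vector_Spaces.linear s s (\<sigma> g)" if "g \<in> carrier G" for g
    using assms that by (simp add: group_rep_def)
  have "vector_space s" using assms by (simp add: group_rep_def)
  then have "module.subspace fun_scale (dual_space s)"
    unfolding module.subspace_def[OF vector_space_fun_scale[folded module_iff_vector_space]]
    by (auto simp: dual_space_def linear_char vector_space_times fun_scale_def algebra_simps)
  moreover have "Vector_Spaces.linear fun_scale fun_scale (dual_rep G \<sigma> g)" for g
    by (auto simp: linear_char vector_space_fun_scale dual_rep_def fun_scale_def fun_eq_iff)
  moreover have "dual_rep G \<sigma> g ` dual_space s \<subseteq> dual_space s" if "g \<in> carrier G" for g
    using lin[OF G.inv_closed[OF that]] by (auto simp: dual_space_def dual_rep_def linear_char)
  ultimately show ?thesis
    using assms by (auto simp: group_rep_def vector_space_fun_scale dual_rep_def G.inv_mult_group)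
qed

lemma bilinear_form_compose:
  assumes "Vector_Spaces.linear s s f" "bilinear_form s B"
  shows "bilinear_form s (\<lambda>v w. B (f v) (f w))"
  using assms by (auto simp: bilinear_form_def linear_char)

lemma tensor_square_rep_pure:
  assumes "group_rep G s UNIV \<sigma>" "g \<in> carrier G"
  shows "tensor_square_rep \<sigma> g (pure_tensor s v w) = pure_tensor s (\<sigma> g v) (\<sigma> g w)"
proof -
  have lin: "Vector_Spaces.linear s s (\<sigma> h)" if "h \<in> carrier G" for h
    using assms(1) that by (simp add: group_rep_def)
  have "inv\<^bsub>G\<^esub> g \<in> carrier G"
    using assms by (simp add: group_rep_def)
  have "bilinear_form s (\<lambda>v w. B (\<sigma> g v) (\<sigma> g w)) \<longleftrightarrow> bilinear_form s B" for B
  proof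
    assume "bilinear_form s (\<lambda>v w. B (\<sigma> g v) (\<sigma> g w))"
    from bilinear_form_compose[OF lin[OF \<open>inv\<^bsub>G\<^esub> g \<in> carrier G\<close>] this]
    show "bilinear_form s B"
      by (simp add: group_rep_inv[OF assms])
  qed (rule bilinear_form_compose[OF lin[OF assms(2)]])
  then show ?thesis
    by (auto simp: tensor_square_rep_def pure_tensor_def fun_eq_iff)
qed

lemma linear_tensor_square_rep:
  "Vector_Spaces.linear fun_scale fun_scale (tensor_square_rep \<sigma> g)"
  by (auto simp: linear_char vector_space_fun_scale tensor_square_rep_def fun_scale_def fun_eq_iff)

lemma group_rep_span:
  fixes s :: "'k::field \<Rightarrow> 'v::ab_group_add \<Rightarrow> 'v"
  assumes \<sigma>: "group_rep G s UNIV \<sigma>"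
    and S: "S \<subseteq> tensor_square s" "\<And>g t. g \<in> carrier G \<Longrightarrow> t \<in> S \<Longrightarrow> tensor_square_rep \<sigma> g t \<in> S"
  shows "group_rep G fun_scale (module.span fun_scale S) (tensor_square_rep \<sigma>)"
proof -
  interpret T: vector_space "fun_scale :: 'k \<Rightarrow> ('k, 'v) tensor2 \<Rightarrow> ('k, 'v) tensor2"
    by (rule vector_space_fun_scale)
  interpret G: group G using \<sigma> by (simp add: group_rep_def)
  have eq: "f t = h t"
    if f: "Vector_Spaces.linear fun_scale fun_scale f" and h: "Vector_Spaces.linear fun_scale fun_scale h"
      and p: "\<And>v w. f (pure_tensor s v w) = h (pure_tensor s v w)" and t: "t \<in> tensor_square s"
    for f h :: "('k, 'v) tensor2 \<Rightarrow> ('k, 'v) tensor2" and t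
  proof -
    interpret P: vector_space_pair "fun_scale :: 'k \<Rightarrow> ('k, 'v) tensor2 \<Rightarrow> ('k, 'v) tensor2" fun_scale
      by (rule vector_space_pair.intro; rule vector_space_fun_scale)
    show ?thesis
      by (rule P.linear_eq_on[OF f h t[unfolded tensor_square_def]]) (auto simp: p)
  qed
  have sub: "T.span S \<subseteq> tensor_square s"
    using S(1) unfolding tensor_square_def by (rule T.span_minimal[OF _ T.subspace_span])
  note pure = tensor_square_rep_pure[OF \<sigma>]
  have "tensor_square_rep \<sigma> g ` T.span S \<subseteq> T.span S" if "g \<in> carrier G" for g
  proof -
    interpret L: Vector_Spaces.linear fun_scale fun_scale "tensor_square_rep \<sigma> g"
      by (rule linear_tensor_square_rep)
    show ?thesis
      unfolding L.span_image[symmetric] using S(2)[OF that] by (intro T.span_mono) auto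
  qed
  moreover have "tensor_square_rep \<sigma> \<one>\<^bsub>G\<^esub> t = t" if "t \<in> T.span S" for t
    by (rule eq[OF linear_tensor_square_rep T.linear_ident])
      (use \<sigma> that sub in \<open>auto simp: pure group_rep_def[of G s]\<close>)
  moreover have "tensor_square_rep \<sigma> (g \<otimes>\<^bsub>G\<^esub> h) t = tensor_square_rep \<sigma> g (tensor_square_rep \<sigma> h t)"
    if "g \<in> carrier G" "h \<in> carrier G" "t \<in> T.span S" for g h t
  proof (rule eq[OF linear_tensor_square_rep])
    show "Vector_Spaces.linear fun_scale fun_scale (\<lambda>t. tensor_square_rep \<sigma> g (tensor_square_rep \<sigma> h t))"
      by (auto simp: linear_char vector_space_fun_scale tensor_square_rep_def fun_scale_def fun_eq_iff)
  qed (use \<sigma> that sub in \<open>auto simp: pure group_rep_def[of G s]\<close>)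
  ultimately show ?thesis
    by (auto simp: group_rep_def[of G fun_scale] G.is_group T.vector_space_axioms
        T.subspace_span linear_tensor_square_rep)
qed

lemma group_rep_squares:
  fixes s :: "'k::field \<Rightarrow> 'v::ab_group_add \<Rightarrow> 'v"
  assumes "group_rep G s UNIV \<sigma>"
  shows "group_rep G fun_scale (tensor_square s) (tensor_square_rep \<sigma>)"
    and "group_rep G fun_scale (exterior_square s) (tensor_square_rep \<sigma>)"
    and "group_rep G fun_scale (symmetric_square s) (tensor_square_rep \<sigma>)"
proof -
  interpret T: vector_space "fun_scale :: 'k \<Rightarrow> ('k, 'v) tensor2 \<Rightarrow> ('k, 'v) tensor2"
    by (rule vector_space_fun_scale)
  note pure = tensor_square_rep_pure[OF assms]
  have base: "pure_tensor s v w \<in> tensor_square s" for v w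
    unfolding tensor_square_def by (rule T.span_base) auto
  have mem: "pure_tensor s v w - pure_tensor s w v \<in> tensor_square s"
    "pure_tensor s v w + pure_tensor s w v \<in> tensor_square s" for v w
    using base T.span_diff T.span_add unfolding tensor_square_def by blast+
  have lin: "tensor_square_rep \<sigma> g (x - y) = tensor_square_rep \<sigma> g x - tensor_square_rep \<sigma> g y"
    "tensor_square_rep \<sigma> g (x + y) = tensor_square_rep \<sigma> g x + tensor_square_rep \<sigma> g y" for g x y
    by (auto simp: tensor_square_rep_def fun_eq_iff)
  show "group_rep G fun_scale (tensor_square s) (tensor_square_rep \<sigma>)"
    unfolding tensor_square_def
    by (rule group_rep_span[OF assms]) (use base in blast, clarify, simp only: pure, blast)
  show "group_rep G fun_scale (exterior_square s) (tensor_square_rep \<sigma>)"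
    unfolding exterior_square_def
    by (rule group_rep_span[OF assms]) (use mem in blast, clarify, simp only: pure lin, blast)
  show "group_rep G fun_scale (symmetric_square s) (tensor_square_rep \<sigma>)"
    unfolding symmetric_square_def
    by (rule group_rep_span[OF assms]) (use mem in blast, clarify, simp only: pure lin, blast)
qed

section \<open>Similitudes\<close>

definition symmetric_form :: "('v \<Rightarrow> 'v \<Rightarrow> 'k) \<Rightarrow> bool"
  where "symmetric_form C \<longleftrightarrow> (\<forall>v w. C v w = C w v)"

definition nondegenerate_form :: "('v::zero \<Rightarrow> 'v \<Rightarrow> 'k::zero) \<Rightarrow> bool"
  where "nondegenerate_form C \<longleftrightarrow> (\<forall>v. (\<forall>w. C v w = 0) \<longrightarrow> v = 0)"

definition GO :: "('k::field \<Rightarrow> 'v::ab_group_add \<Rightarrow> 'v) \<Rightarrow> ('v \<Rightarrow> 'v \<Rightarrow> 'k) \<Rightarrow> ('v \<Rightarrow> 'v) set"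
  where "GO s C = {f. Vector_Spaces.linear s s f \<and> bij f \<and>
    (\<exists>\<mu>. \<mu> \<noteq> 0 \<and> (\<forall>v w. C (f v) (f w) = \<mu> * C v w))}"

text \<open>
  The algebra of polynomial functions on \<open>End(V)\<close> is generated by the constants and the matrix
  coefficients \<open>f \<mapsto> l (f v)\<close>. A subset of \<open>End(V)\<close> carries the Zariski topology, with basis the
  non-vanishing loci of polynomial functions.
\<close>

inductive_set poly_functions ::
  "('k::field \<Rightarrow> 'v::ab_group_add \<Rightarrow> 'v) \<Rightarrow> (('v \<Rightarrow> 'v) \<Rightarrow> 'k) set"
  for s :: "'k \<Rightarrow> 'v \<Rightarrow> 'v"
  where
    const: "(\<lambda>f. c) \<in> poly_functions s"
  | coeff: "l \<in> dual_space s \<Longrightarrow> (\<lambda>f. l (f v)) \<in> poly_functions s"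
  | add: "p \<in> poly_functions s \<Longrightarrow> q \<in> poly_functions s \<Longrightarrow> (\<lambda>f. p f + q f) \<in> poly_functions s"
  | mult: "p \<in> poly_functions s \<Longrightarrow> q \<in> poly_functions s \<Longrightarrow> (\<lambda>f. p f * q f) \<in> poly_functions s"

definition zariski_topology ::
  "('k::field \<Rightarrow> 'v::ab_group_add \<Rightarrow> 'v) \<Rightarrow> ('v \<Rightarrow> 'v) set \<Rightarrow> ('v \<Rightarrow> 'v) topology"
  where "zariski_topology s X =
    topology_generated_by {{f \<in> X. p f \<noteq> 0} | p. p \<in> poly_functions s}"

text \<open>The group of proper similitudes: the identity component of the algebraic group \<open>GO(C)\<close>.\<close>

definition GSO :: "('k::field \<Rightarrow> 'v::ab_group_add \<Rightarrow> 'v) \<Rightarrow> ('v \<Rightarrow> 'v \<Rightarrow> 'k) \<Rightarrow> ('v \<Rightarrow> 'v) set"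
  where "GSO s C = {f. connected_component_of (zariski_topology s (GO s C)) id f}"

section \<open>Essentially self-dual representations and self-twists\<close>

text \<open>In this section the underlying space of \<open>\<sigma>\<close> is \<open>UNIV\<close>.\<close>

definition ess_self_dual_via ::
  "('g, 'm) monoid_scheme \<Rightarrow> ('k::field \<Rightarrow> 'v::ab_group_add \<Rightarrow> 'v) \<Rightarrow> ('g \<Rightarrow> 'v \<Rightarrow> 'v) \<Rightarrow> ('g \<Rightarrow> 'k) \<Rightarrow> bool"
  where "ess_self_dual_via G s \<sigma> \<chi> \<longleftrightarrow>
    group_character G \<chi> \<and>
    iso_rep G fun_scale (dual_space s) (dual_rep G \<sigma>) s UNIV (twist_rep s \<chi> \<sigma>)"

definition symplectic_type ::
  "('g, 'm) monoid_scheme \<Rightarrow> ('k::field \<Rightarrow> 'v::ab_group_add \<Rightarrow> 'v) \<Rightarrow> ('g \<Rightarrow> 'v \<Rightarrow> 'v) \<Rightarrow> bool"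
  where "symplectic_type G s \<sigma> \<longleftrightarrow>
    (\<exists>\<chi>. ess_self_dual_via G s \<sigma> \<chi> \<and>
      character_occurs G fun_scale (exterior_square s) (tensor_square_rep \<sigma>) (\<lambda>g. inverse (\<chi> g)))"

definition orthogonal_type ::
  "('g, 'm) monoid_scheme \<Rightarrow> ('k::field \<Rightarrow> 'v::ab_group_add \<Rightarrow> 'v) \<Rightarrow> ('g \<Rightarrow> 'v \<Rightarrow> 'v) \<Rightarrow> bool"
  where "orthogonal_type G s \<sigma> \<longleftrightarrow>
    (\<exists>\<chi>. ess_self_dual_via G s \<sigma> \<chi> \<and>
      character_occurs G fun_scale (symmetric_square s) (tensor_square_rep \<sigma>) (\<lambda>g. inverse (\<chi> g)))"

definition proper_orthogonal_type ::
  "('g, 'm) monoid_scheme \<Rightarrow> ('k::field \<Rightarrow> 'v::ab_group_add \<Rightarrow> 'v) \<Rightarrow> ('g \<Rightarrow> 'v \<Rightarrow> 'v) \<Rightarrow> bool"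
  where "proper_orthogonal_type G s \<sigma> \<longleftrightarrow>
    orthogonal_type G s \<sigma> \<and>
    (\<exists>C. bilinear_form s C \<and> symmetric_form C \<and> nondegenerate_form C \<and>
      \<sigma> ` carrier G \<subseteq> GSO s C)"

definition quadratic_self_twist ::
  "('g, 'm) monoid_scheme \<Rightarrow> ('k::field \<Rightarrow> 'v::ab_group_add \<Rightarrow> 'v) \<Rightarrow> ('g \<Rightarrow> 'v \<Rightarrow> 'v) \<Rightarrow> bool"
  where "quadratic_self_twist G s \<sigma> \<longleftrightarrow>
    (\<exists>\<chi>. group_character G \<chi> \<and>
      (\<forall>g\<in>carrier G. \<chi> g = 1 \<or> \<chi> g = - 1) \<and> (\<exists>g\<in>carrier G. \<chi> g \<noteq> 1) \<and>
      iso_rep G s UNIV \<sigma> s UNIV (twist_rep s \<chi> \<sigma>))"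

end

theory Submission
  imports Defs "HOL-Analysis.Determinants"
begin

text \<open>
  In coordinates, \<open>\<Lambda>\<^sup>2V\<close> is the space of skew \<open>4 \<times> 4\<close> matrices with action \<open>A \<mapsto> M A M\<^sup>T\<close> and with
  the Pfaffian as invariant quadratic form (up to \<open>det M\<close>). With the Pfaffian adjoint \<open>A\<^sup>*\<close>, the maps
  \<open>A\<close> and \<open>A\<^sup>*\<close> make \<open>V\<close> plus its dual a Clifford module. A stable isotropic space of skew matrices has
  a common null vector, hence vanishes by irreducibility; so a stable space \<open>U\<close> is nondegenerate, and after
  passing to the orthogonal complement it has an orthonormal basis \<open>u\<^sub>1, \<dots>, u\<^sub>d\<close> with \<open>d \<le> 3\<close>. Its volume
  element is \<open>u\<^sub>1\<close>, an invariant symplectic form, if \<open>d = 1\<close>; it is \<open>J = u\<^sub>1 u\<^sub>2\<^sup>*\<close> with \<open>J\<^sup>2 = -1\<close>, commuting with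
  the group up to sign but not scalar, if \<open>d = 2\<close>; and it is \<open>C = u\<^sub>1 u\<^sub>2\<^sup>* u\<^sub>3\<close>, a symmetric form with
  multiplier \<open>c\<close> satisfying \<open>det M = c\<^sup>2\<close>, if \<open>d = 3\<close>. The condition \<open>det M = c\<^sup>2\<close> describes the identity
  component of the similitude group: it is open and closed, and reflections generate and can be moved into
  each other along polynomial curves. Conversely, an invariant line, an eigenspace of \<open>\<Lambda>\<^sup>2J\<close>, and the self-dual
  matrices \<open>A\<^sup>* = A\<close> (in orthonormal coordinates) are proper stable subspaces in the three cases.
\<close>

section \<open>Skew matrices and the Clifford relation\<close>

text \<open>Products of skew matrices alternate \<open>u\<close> and \<open>star u\<close>. An odd
  product maps the dual of V to V and is thus a bilinear form on the dual, while an even product is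
  an endomorphism of V; hence the three dimensions give objects of such different kinds. Transposing
  a product of d mutually orthogonal factors reverses it and changes d signs, in total the sign
  (-1)^(d(d+1)/2), so the form is skew for d = 1 and symmetric for d = 3. An orthogonal change of
  basis multiplies the volume element by a sign, so the group moves it only by scalars; but
  congruence by \<open>M\<close> is a similitude of the Pfaffian form with factor
  \<open>det M\<close>, and these scalars have to be determined. For d = 2 the square of
  \<open>J\<close> forces a sign. For d = 3 the identity \<open>C ** star x ** C = - x\<close> on
  the space yields the multiplier condition. The last obstacle is that proper similitudes are
  defined topologically, while the construction produces a condition on determinants; both
  inclusions between the two descriptions are required, one for each direction of the
  theorem.\<close>

definition smat :: "'k::comm_ring_1 \<Rightarrow> 'k^'n^'m \<Rightarrow> 'k^'n^'m"
  where "smat c A = (\<chi> i j. c * A$i$j)"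

lemma smat_nth [simp]: "smat c A $ i $ j = c * A$i$j"
  by (simp add: smat_def)

lemma matrix_mult_nth: "(A ** B) $ i $ j = (\<Sum>k\<in>UNIV. A$i$k * B$k$j)"
  by (simp add: matrix_matrix_mult_def)

lemma smat_simps [simp]:
  "smat c A ** B = smat c (A ** B)" "A ** smat c B = smat c (A ** B)"
  "smat c (smat d A) = smat (c * d) A" "smat 1 A = A" "smat 0 A = 0" "smat c 0 = 0"
  "transpose (smat c A) = smat c (transpose A)" "smat c A *v x = c *s (A *v x)"
  by (auto simp: vec_eq_iff matrix_mult_nth transpose_def matrix_vector_mult_def sum_distrib_left
      algebra_simps)

lemma smat_add: "smat c (A + B) = smat c A + smat c B" "smat (c + d) A = smat c A + smat d A"
  and smat_diff: "smat c (A - B) = smat c A - smat c B" "smat (c - d) A = smat c A - smat d A"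
  and smat_minus: "smat c (- A) = - smat c A" "smat (- c) A = - smat c A"
  by (auto simp: vec_eq_iff algebra_simps)

lemma mat_eq_smat: "mat c = smat c (mat 1)"
  by (auto simp: vec_eq_iff mat_def)

lemma matrix_mult_simps [simp]:
  fixes A :: "'k::comm_ring_1^'n^'m"
  shows "mat c ** A = smat c A" "A ** mat c = smat c A"
  "A ** (- B) = - (A ** B)" "(- A) ** D = - (A ** D)" "A ** 0 = 0" "0 ** D = 0"
proof -
  show "mat c ** A = smat c A" by (subst mat_eq_smat) simp
  show "A ** mat c = smat c A" by (subst mat_eq_smat) simp
qed (auto simp: vec_eq_iff matrix_mult_nth sum_negf)

lemma matrix_mult_distrib:
  fixes A :: "'k::comm_ring_1^'n^'m"
  shows "A ** (B + C) = A ** B + A ** C" "(A + A') ** B = A ** B + A' ** B"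
    "A ** (B - C) = A ** B - A ** C" "(A - A') ** B = A ** B - A' ** B"
  by (auto simp: vec_eq_iff matrix_mult_nth algebra_simps sum.distrib sum_subtractf)

lemma transpose_simps [simp]:
  "transpose (A + B) = transpose A + transpose (B :: 'k::comm_ring_1^'n^'m)"
  "transpose (A - B) = transpose A - transpose (B :: 'k::comm_ring_1^'n^'m)"
  "transpose (- A) = - transpose (A :: 'k::comm_ring_1^'n^'m)"
  "transpose (0 :: 'k::comm_ring_1^'n^'m) = 0"
  by (auto simp: vec_eq_iff transpose_def)

lemma vector_4 [simp]:
  "(vector [x, y, z, w] :: 'a::zero^4) $ 1 = x" "(vector [x, y, z, w] :: 'a^4) $ 2 = y"
  "(vector [x, y, z, w] :: 'a^4) $ 3 = z" "(vector [x, y, z, w] :: 'a^4) $ 4 = w"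
  unfolding vector_def by simp_all

text \<open>Expansion along the first two rows by complementary 2 x 2 minors, the shape that matches
  the Pfaffian form on the minors of \<open>M\<close> in \<open>laplace\<close>.\<close>

lemma det_4:
  fixes A :: "'a::comm_ring_1^4^4"
  shows "det A =
    (A$1$1 * A$2$2 - A$1$2 * A$2$1) * (A$3$3 * A$4$4 - A$3$4 * A$4$3) -
    (A$1$1 * A$2$3 - A$1$3 * A$2$1) * (A$3$2 * A$4$4 - A$3$4 * A$4$2) +
    (A$1$1 * A$2$4 - A$1$4 * A$2$1) * (A$3$2 * A$4$3 - A$3$3 * A$4$2) +
    (A$1$2 * A$2$3 - A$1$3 * A$2$2) * (A$3$1 * A$4$4 - A$3$4 * A$4$1) -
    (A$1$2 * A$2$4 - A$1$4 * A$2$2) * (A$3$1 * A$4$3 - A$3$3 * A$4$1) +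
    (A$1$3 * A$2$4 - A$1$4 * A$2$3) * (A$3$1 * A$4$2 - A$3$2 * A$4$1)"
proof -
  have f1: "finite {2::4, 3, 4}" "1 \<notin> {2::4, 3, 4}" by auto
  have f2: "finite {3::4, 4}" "2 \<notin> {3::4, 4}" by auto
  have f3: "finite {4::4}" "3 \<notin> {4::4}" by auto
  show ?thesis
    unfolding det_def UNIV_4
    unfolding sum_over_permutations_insert[OF f1]
    unfolding sum_over_permutations_insert[OF f2]
    unfolding sum_over_permutations_insert[OF f3]
    unfolding permutes_sing
    by (simp add: sign_swap_id permutation_swap_id permutation_compose sign_compose sign_id
        swap_id_eq algebra_simps)
qed

section \<open>Skew 4 x 4 matrices, the Pfaffian and its adjoint\<close>

definition skew :: "'k::comm_ring_1^'n^'n \<Rightarrow> bool"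
  where "skew A \<longleftrightarrow> transpose A = - A \<and> (\<forall>i. A$i$i = 0)"

lemma skew_nth: "skew A \<Longrightarrow> A$j$i = - A$i$j"
proof -
  assume "skew A"
  then have "transpose A $ i $ j = (- A) $ i $ j" by (simp only: skew_def)
  then show ?thesis by (simp only: transpose_def vec_lambda_beta vector_uminus_component)
qed

lemma skew_diff: "skew A \<Longrightarrow> skew B \<Longrightarrow> skew (A - B)"
  and skew_add: "skew A \<Longrightarrow> skew B \<Longrightarrow> skew (A + B)"
  and skew_smat: "skew A \<Longrightarrow> skew (smat c A)"
  and skew_0: "skew 0"
  by (simp_all add: skew_def smat_minus del: minus_diff_eq)

lemma skew_4:
  assumes "skew (A :: 'k::comm_ring_1^4^4)"
  shows "A$1$1 = 0" "A$2$2 = 0" "A$3$3 = 0" "A$4$4 = 0" "A$2$1 = - A$1$2" "A$3$1 = - A$1$3"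
    "A$4$1 = - A$1$4" "A$3$2 = - A$2$3" "A$4$2 = - A$2$4" "A$4$3 = - A$3$4"
proof -
  show "A$1$1 = 0" "A$2$2 = 0" "A$3$3 = 0" "A$4$4 = 0"
    using assms by (simp_all add: skew_def)
qed (rule skew_nth[OF assms])+

text \<open>The Pfaffian adjoint, which satisfies \<open>A ** star A = Pf A\<close> for skew \<open>A\<close>; it identifies
  \<open>\<Lambda>\<^sup>2k\<^sup>4\<close> with its dual. The form \<open>pfaff2\<close> is the polarization of \<open>Pf\<close>, so \<open>pfaff2 A A = 2 Pf A\<close>.\<close>

definition star :: "'k::comm_ring_1^4^4 \<Rightarrow> 'k^4^4"
  where "star A = vector [
    vector [0, - A$3$4, A$2$4, - A$2$3],
    vector [A$3$4, 0, - A$1$4, A$1$3],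
    vector [- A$2$4, A$1$4, 0, - A$1$2],
    vector [A$2$3, - A$1$3, A$1$2, 0]]"

definition pfaff2 :: "'k::comm_ring_1^4^4 \<Rightarrow> 'k^4^4 \<Rightarrow> 'k"
  where "pfaff2 A B = A$1$2 * B$3$4 + A$3$4 * B$1$2 - A$1$3 * B$2$4 - A$2$4 * B$1$3
    + A$1$4 * B$2$3 + A$2$3 * B$1$4"

lemma star_linear: "star (A + B) = star A + star B" "star (smat c A) = smat c (star A)"
  "star (A - B) = star A - star B" "star (- A) = - star A" "star 0 = 0"
  by (auto simp: vec_eq_iff star_def forall_4)

lemma skew_star: "skew (star A)"
  by (auto simp: vec_eq_iff star_def forall_4 skew_def transpose_def)

lemma star_star: "skew A \<Longrightarrow> star (star A) = A"
  by (auto simp: vec_eq_iff star_def forall_4 skew_4)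

text \<open>Polarization of \<open>A ** star A = Pf A\<close>. Equivalently, on the sum of V and its
  dual the off-diagonal block operator with blocks \<open>A\<close> and \<open>star A\<close>
  squares to the scalar Pf A, so skew matrices act as Clifford generators.\<close>

lemma star_clifford:
  assumes "skew A" "skew B"
  shows "A ** star B + B ** star A = mat (pfaff2 A B)" "star A ** B + star B ** A = mat (pfaff2 A B)"
  by (simp_all add: vec_eq_iff star_def forall_4 skew_4[OF assms(1)] skew_4[OF assms(2)]
      matrix_mult_nth sum_4 mat_def pfaff2_def algebra_simps)

lemma skew_congruence:
  fixes M :: "'k::comm_ring_1^4^4"
  assumes "skew A"
  shows "skew (M ** A ** transpose M)"
proof -
  have "(M ** A ** transpose M) $ i $ i = 0" for i
    by (simp add: matrix_mult_nth sum_4 transpose_def skew_4[OF assms] algebra_simps)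
  then show ?thesis
    using assms by (simp add: skew_def matrix_transpose_mul matrix_mul_assoc)
qed

section \<open>Second compound matrices and Laplace expansion\<close>

definition minor :: "'k::comm_ring_1^4^4 \<Rightarrow> 4 \<Rightarrow> 4 \<Rightarrow> 4 \<Rightarrow> 4 \<Rightarrow> 'k"
  where "minor M i j a b = M$i$a * M$j$b - M$j$a * M$i$b"

text \<open>In the six entries above the diagonal, congruence by \<open>M\<close> is the second
  compound matrix of \<open>M\<close>, the matrix of its action on the exterior square.\<close>

lemma congruence_nth:
  assumes "skew (A :: 'k::comm_ring_1^4^4)"
  shows "(M ** A ** transpose M) $ k $ l =
    minor M k l 1 2 * A$1$2 + minor M k l 1 3 * A$1$3 + minor M k l 1 4 * A$1$4 +
    minor M k l 2 3 * A$2$3 + minor M k l 2 4 * A$2$4 + minor M k l 3 4 * A$3$4"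
  by (simp add: matrix_mult_nth sum_4 transpose_def skew_4[OF assms] minor_def algebra_simps)

lemma minor_transpose: "minor (transpose M) i j a b = minor M a b i j"
  by (simp add: minor_def transpose_def algebra_simps)

text \<open>The polarized Pfaffian form of the wedge of columns \<open>a\<close>, \<open>b\<close>
  with the wedge of columns \<open>c\<close>, \<open>d\<close> of \<open>M\<close>. By Laplace
  expansion it is the determinant of the matrix formed by these four columns, which explains the
  values in \<open>laplace_repeat\<close> and \<open>laplace_det\<close>.\<close>

definition laplace :: "'k::comm_ring_1^4^4 \<Rightarrow> 4 \<Rightarrow> 4 \<Rightarrow> 4 \<Rightarrow> 4 \<Rightarrow> 'k"
  where "laplace M a b c d =
    minor M 1 2 a b * minor M 3 4 c d - minor M 1 3 a b * minor M 2 4 c d +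
    minor M 1 4 a b * minor M 2 3 c d + minor M 2 3 a b * minor M 1 4 c d -
    minor M 2 4 a b * minor M 1 3 c d + minor M 3 4 a b * minor M 1 2 c d"

lemma laplace_repeat:
  "laplace M a b a d = 0" "laplace M a b b d = 0" "laplace M a b c a = 0" "laplace M a b c b = 0"
  by (simp_all add: laplace_def minor_def algebra_simps)

lemma laplace_det:
  "laplace M 1 2 3 4 = det M" "laplace M 3 4 1 2 = det M"
  "laplace M 1 3 2 4 = - det M" "laplace M 2 4 1 3 = - det M"
  "laplace M 1 4 2 3 = det M" "laplace M 2 3 1 4 = det M"
  by (simp_all add: laplace_def minor_def det_4 algebra_simps)

text \<open>Congruence by \<open>M\<close> preserves the Pfaffian form up to the factor
  \<open>det M\<close>, so under the identification of skew matrices with their duals it turns into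
  the contragredient action times \<open>det M\<close>. Multiplying by \<open>M\<close> and its
  transpose instead of their inverses makes this a polynomial identity over every commutative
  ring.\<close>

lemma star_congruence:
  fixes M :: "'k::comm_ring_1^4^4"
  assumes A: "skew A"
  shows "transpose M ** star (M ** A ** transpose M) ** M = smat (det M) (star A)"
    (is "?L = ?R")
proof -
  define X where "X = M ** A ** transpose M"
  have X: "X$k$l = minor M k l 1 2 * A$1$2 + minor M k l 1 3 * A$1$3 + minor M k l 1 4 * A$1$4 +
    minor M k l 2 3 * A$2$3 + minor M k l 2 4 * A$2$4 + minor M k l 3 4 * A$3$4" for k l
    unfolding X_def by (rule congruence_nth[OF A])
  have sk: "skew ?L"
    using skew_congruence[OF skew_star, of "transpose M"] by simp
  \<comment> \<open>\<open>star\<close> swaps complementary index pairs with the signs of the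
    Pfaffian form, so the coefficient of each entry of \<open>A\<close> collects into one value of
    \<open>laplace\<close>.\<close>
  have L: "?L $ a $ b = - (laplace M a b 1 2 * A$1$2 + laplace M a b 1 3 * A$1$3 +
      laplace M a b 1 4 * A$1$4 + laplace M a b 2 3 * A$2$3 + laplace M a b 2 4 * A$2$4 +
      laplace M a b 3 4 * A$3$4)" for a b
    unfolding X_def[symmetric]
    using congruence_nth[OF skew_star, of "transpose M" X a b]
    by (simp add: minor_transpose star_def X laplace_def algebra_simps)
  have R: "skew ?R"
    by (rule skew_smat[OF skew_star])
  have "?L$1$2 = ?R$1$2" "?L$1$3 = ?R$1$3" "?L$1$4 = ?R$1$4" "?L$2$3 = ?R$2$3"
    "?L$2$4 = ?R$2$4" "?L$3$4 = ?R$3$4"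
    unfolding L by (simp_all add: laplace_repeat laplace_det star_def)
  then show ?thesis
    using skew_4[OF sk] skew_4[OF R] by (simp add: vec_eq_iff forall_4)
qed

section \<open>Orthonormal bases\<close>

text \<open>Serves two forms: half of \<open>pfaff2\<close> on skew matrices, and a symmetric form
  on V itself.\<close>

locale symmetric_bilinear = vector_space s
  for s :: "'k::alg_closed_field \<Rightarrow> 'v::ab_group_add \<Rightarrow> 'v" +
  fixes \<beta> :: "'v \<Rightarrow> 'v \<Rightarrow> 'k"
  assumes add_left: "\<beta> (x + y) z = \<beta> x z + \<beta> y z"
    and scale_left: "\<beta> (s c x) z = c * \<beta> x z"
    and sym: "\<beta> x y = \<beta> y x"
begin

lemma add_right: "\<beta> z (x + y) = \<beta> z x + \<beta> z y"
  using add_left[of x y z] by (simp add: sym)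

lemma scale_right: "\<beta> z (s c x) = c * \<beta> z x"
  using scale_left[of c x z] by (simp add: sym)

lemma zero_left [simp]: "\<beta> 0 z = 0" and zero_right [simp]: "\<beta> z 0 = 0"
  using scale_left[of 0 0 z] scale_right[of z 0 0] by simp_all

lemma diff_left: "\<beta> (x - y) z = \<beta> x z - \<beta> y z"
  using add_left[of "x - y" y z] by simp

lemma sum_left: "\<beta> (sum f A) z = (\<Sum>a\<in>A. \<beta> (f a) z)"
  by (induction A rule: infinite_finite_induct) (simp_all add: add_left)

definition orthonormal :: "(nat \<Rightarrow> 'v) \<Rightarrow> nat \<Rightarrow> bool"
  where "orthonormal u n \<longleftrightarrow> (\<forall>i<n. \<forall>j<n. \<beta> (u i) (u j) = (if i = j then 1 else 0))"

lemma orthonormal_coeff: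
  assumes "orthonormal u n" "i < n"
  shows "\<beta> (\<Sum>j<n. s (c j) (u j)) (u i) = c i"
proof -
  have "\<beta> (\<Sum>j<n. s (c j) (u j)) (u i) = (\<Sum>j<n. if j = i then c j else 0)"
    unfolding sum_left scale_left using assms by (intro sum.cong) (auto simp: orthonormal_def)
  with assms(2) show ?thesis by simp
qed

text \<open>Pairing a linear relation with \<open>u i\<close> isolates its coefficient, so
  orthonormal vectors are independent.\<close>

lemma orthonormal_length:
  assumes on: "orthonormal u n" and "finite F" and sub: "\<And>i. i < n \<Longrightarrow> u i \<in> span F"
  shows "n \<le> card F"
proof -
  have inj: "inj_on u {..<n}"
    using on unfolding orthonormal_def inj_on_def by (metis lessThan_iff zero_neq_one)
  have "independent (u ` {..<n})"
  proof (rule independent_if_scalars_zero)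
    fix f x assume f: "(\<Sum>x\<in>u ` {..<n}. s (f x) x) = 0" and "x \<in> u ` {..<n}"
    then obtain i where i: "i < n" "x = u i" by auto
    have "(\<Sum>j<n. s (f (u j)) (u j)) = 0"
      using f by (simp add: sum.reindex[OF inj])
    with orthonormal_coeff[OF on i(1), of "\<lambda>j. f (u j)"] show "f x = 0"
      by (simp add: i)
  qed simp
  moreover have "u ` {..<n} \<subseteq> span F" using sub by auto
  ultimately show ?thesis
    using independent_span_bound[OF \<open>finite F\<close>, of "u ` {..<n}"] by (simp add: card_image[OF inj])
qed

lemma orthonormal_append:
  assumes "orthonormal u n" "orthonormal v m"
    and "\<And>i j. i < n \<Longrightarrow> j < m \<Longrightarrow> \<beta> (u i) (v j) = 0"
  shows "orthonormal (\<lambda>i. if i < n then u i else v (i - n)) (n + m)"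
  using assms by (auto simp: orthonormal_def sym)

text \<open>Choose an orthonormal system in \<open>U\<close> of maximal length, which exists because
  lengths are bounded by \<open>card F\<close>. In its complement \<open>perp\<close> a vector with
  nonzero square could be normalized by a square root and appended, so all vectors there are
  isotropic; by polarization the form vanishes on \<open>perp\<close>, which therefore lies in the
  radical of \<open>U\<close>.\<close>

lemma orthonormal_basis_exists:
  assumes two: "(2 :: 'k) \<noteq> 0" and U: "subspace U" "U \<subseteq> span F" "finite F"
    and rad: "\<And>x. x \<in> U \<Longrightarrow> (\<And>y. y \<in> U \<Longrightarrow> \<beta> x y = 0) \<Longrightarrow> x = 0"
  obtains u n where "orthonormal u n" "\<And>i. i < n \<Longrightarrow> u i \<in> U"
    "\<And>x. x \<in> U \<Longrightarrow> x = (\<Sum>i<n. s (\<beta> x (u i)) (u i))"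
proof -
  let ?P = "\<lambda>n. \<exists>u. orthonormal u n \<and> (\<forall>i<n. u i \<in> U)"
  have "?P 0" by (simp add: orthonormal_def)
  moreover have bound: "\<forall>n. ?P n \<longrightarrow> n \<le> card F"
    using orthonormal_length[OF _ U(3)] U(2) by blast
  ultimately have max: "?P (Greatest ?P)" "\<And>n. ?P n \<Longrightarrow> n \<le> Greatest ?P"
    using GreatestI_nat[of ?P] Greatest_le_nat[of ?P] by blast+
  define n where "n = Greatest ?P"
  from max(1) obtain u where u: "orthonormal u n" "\<And>i. i < n \<Longrightarrow> u i \<in> U"
    unfolding n_def by blast
  define perp where "perp = {x \<in> U. \<forall>i<n. \<beta> x (u i) = 0}"
  have perp: "x - (\<Sum>i<n. s (\<beta> x (u i)) (u i)) \<in> perp" if "x \<in> U" for x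
    using that u U(1) orthonormal_coeff[OF u(1), of _ "\<lambda>i. \<beta> x (u i)"]
    by (auto simp: perp_def diff_left intro!: subspace_diff subspace_sum subspace_scale)
  have iso: "\<beta> x x = 0" if x: "x \<in> perp" for x
  proof (rule ccontr)
    assume nz: "\<beta> x x \<noteq> 0"
    obtain r where r: "r ^ 2 = \<beta> x x" using nth_root_exists[of 2] by auto
    define v where "v = s (inverse r) x"
    have rn: "r \<noteq> 0" using r nz by auto
    have "\<beta> v v = inverse r * inverse r * r ^ 2"
      by (simp add: v_def scale_left scale_right r)
    then have "\<beta> v v = 1" using rn by (simp add: power2_eq_square field_simps)
    moreover have "v \<in> U" "\<forall>i<n. \<beta> v (u i) = 0"
      using x U(1) by (auto simp: v_def perp_def scale_left intro: subspace_scale)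
    ultimately have "orthonormal (u(n := v)) (Suc n)" "\<forall>i<Suc n. (u(n := v)) i \<in> U"
      using u by (auto simp: orthonormal_def sym less_Suc_eq)
    then have "Suc n \<le> n" unfolding n_def[symmetric] by (metis max(2) n_def)
    then show False by simp
  qed
  have tot: "\<beta> x y = 0" if "x \<in> perp" "y \<in> perp" for x y
  proof -
    have "x + y \<in> perp" using that U(1) by (auto simp: perp_def add_left intro: subspace_add)
    then have "2 * \<beta> x y = 0"
      using iso[of "x + y"] iso[OF that(1)] iso[OF that(2)]
      by (simp add: add_left add_right sym[of y x])
    with two show ?thesis by simp
  qed
  have perp0: "x = 0" if x: "x \<in> perp" for x
  proof (rule rad)
    show "x \<in> U" using x by (simp add: perp_def)
    fix y assume y: "y \<in> U"
    define p where "p = (\<Sum>i<n. s (\<beta> y (u i)) (u i))"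
    have "\<beta> (u i) x = 0" if "i < n" for i
      using x that sym[of "u i" x] by (simp add: perp_def)
    then have "\<beta> p x = 0"
      by (simp add: p_def sum_left scale_left)
    moreover have "\<beta> (y - p) x = 0" using tot perp[OF y] x by (simp add: p_def)
    ultimately show "\<beta> x y = 0" using sym[of x y] by (simp add: diff_left)
  qed
  show ?thesis
  proof (rule that[OF u])
    show "x = (\<Sum>i<n. s (\<beta> x (u i)) (u i))" if "x \<in> U" for x
      using perp0[OF perp[OF that]] by (simp only: right_minus_eq)
  qed
qed

end

section \<open>Skew matrices as a quadratic space\<close>

lemma two_neq_0: "CHAR('k::field) \<noteq> 2 \<Longrightarrow> (2 :: 'k) \<noteq> 0"
proof
  assume c: "CHAR('k) \<noteq> 2" and "(2 :: 'k) = 0"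
  then have "of_nat 2 = (0 :: 'k)" by simp
  then have "CHAR('k) dvd 2" by (simp only: of_nat_eq_0_iff_char_dvd)
  with c have "CHAR('k) = 1" by (meson prime_nat_iff two_is_prime_nat)
  then show False by simp
qed

lemma vector_space_smat: "vector_space (smat :: 'k::field \<Rightarrow> 'k^'n^'m \<Rightarrow> 'k^'n^'m)"
  by unfold_locales (auto simp: smat_add)

interpretation mat: vector_space "smat :: 'k::field \<Rightarrow> 'k^'n^'m \<Rightarrow> 'k^'n^'m"
  by (rule vector_space_smat)

definition skew_unit :: "4 \<Rightarrow> 4 \<Rightarrow> 'k::comm_ring_1^4^4"
  where "skew_unit a b = (\<chi> i j. (if i = a \<and> j = b then 1 else 0) - (if i = b \<and> j = a then 1 else 0))"

text \<open>Caps the length of orthonormal systems of skew matrices at six. The spanning set is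
  given as a list so that \<open>card_length\<close> bounds its size without comparing its
  members.\<close>

lemma skew_span:
  "{A. skew A} \<subseteq> mat.span (set [skew_unit 1 2, skew_unit 1 3, skew_unit 1 4, skew_unit 2 3,
    skew_unit 2 4, skew_unit 3 4 :: 'k::field^4^4])"
proof (rule subsetI, unfold mem_Collect_eq)
  fix A :: "'k^4^4" assume A: "skew A"
  have eq: "A = smat (A$1$2) (skew_unit 1 2) + smat (A$1$3) (skew_unit 1 3) + smat (A$1$4) (skew_unit 1 4)
    + smat (A$2$3) (skew_unit 2 3) + smat (A$2$4) (skew_unit 2 4) + smat (A$3$4) (skew_unit 3 4)"
    by (simp add: vec_eq_iff forall_4 skew_unit_def skew_4[OF A])
  moreover have "smat (A$1$2) (skew_unit 1 2) + smat (A$1$3) (skew_unit 1 3) + smat (A$1$4) (skew_unit 1 4)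
    + smat (A$2$3) (skew_unit 2 3) + smat (A$2$4) (skew_unit 2 4) + smat (A$3$4) (skew_unit 3 4)
    \<in> mat.span (set [skew_unit 1 2, skew_unit 1 3, skew_unit 1 4, skew_unit 2 3,
    skew_unit 2 4, skew_unit 3 4 :: 'k::field^4^4])"
    by (intro mat.span_add mat.span_scale mat.span_base) simp_all
  ultimately show "A \<in> mat.span (set [skew_unit 1 2, skew_unit 1 3, skew_unit 1 4, skew_unit 2 3,
    skew_unit 2 4, skew_unit 3 4 :: 'k::field^4^4])"
    by (simp only: eq[symmetric])
qed

lemma subspace_skew: "mat.subspace {A :: 'k::field^4^4. skew A}"
  by (auto simp: mat.subspace_def skew_0 skew_add skew_smat)

lemma pfaff2_simps: "pfaff2 (A + B) C = pfaff2 A C + pfaff2 B C"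
  "pfaff2 (smat c A) C = c * pfaff2 A C"
  by (simp_all add: pfaff2_def algebra_simps)

lemma pfaff2_sym: "pfaff2 A B = pfaff2 B A"
  by (simp add: pfaff2_def algebra_simps)

text \<open>Halving \<open>pfaff2\<close> turns the quadratic form into the Pfaffian itself: a unit
  vector \<open>u\<close> satisfies \<open>u ** star u = mat 1\<close>.\<close>

interpretation pf: symmetric_bilinear "smat :: 'k::alg_closed_field \<Rightarrow> 'k^4^4 \<Rightarrow> 'k^4^4"
    "\<lambda>A B. pfaff2 A B / 2"
proof unfold_locales
  fix A B C :: "'k^4^4" and c :: 'k
  show "pfaff2 A B / 2 = pfaff2 B A / 2" by (simp only: pfaff2_sym[of A B])
  show "pfaff2 (A + B) C / 2 = pfaff2 A C / 2 + pfaff2 B C / 2"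
    by (simp only: pfaff2_simps add_divide_distrib)
  show "pfaff2 (smat c A) C / 2 = c * (pfaff2 A C / 2)"
    by (simp only: pfaff2_simps times_divide_eq_right)
qed

section \<open>Irreducible matrix groups and stable spaces of skew matrices\<close>

text \<open>Over a finite field the product of all \<open>X - a\<close>, increased by one, takes
  only the value one and so has no root.\<close>

lemma infinite_UNIV_alg_closed: "infinite (UNIV :: 'k::alg_closed_field set)"
proof
  assume fin: "finite (UNIV :: 'k set)"
  define p where "p = (\<Prod>a\<in>(UNIV :: 'k set). [:- a, 1:])"
  have deg: "degree p = card (UNIV :: 'k set)"
    unfolding p_def by (subst degree_prod_eq_sum_degree) auto
  with fin have "degree p > 0" by (simp add: finite_UNIV_card_ge_0)
  then have "degree (p + 1) > 0"
    by (metis degree_1 degree_add_eq_left)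
  then obtain x where x: "poly (p + 1) x = 0" using alg_closed_imp_poly_has_root by blast
  have "poly p x = 0"
    using fin by (simp add: p_def poly_prod)
  with x show False by simp
qed

lemma poly_det: "poly (det X) t = det (\<chi> i j. poly (X $ i $ j) t)"
  for X :: "'k::comm_ring_1 poly^'n^'n"
  by (simp add: det_def poly_sum poly_prod)

lemma det_smat: "det (smat c A) = c ^ CARD('n) * det A" for A :: "'k::field^'n^'n"
  using det_rows_mul[of "\<lambda>_. c" "\<lambda>i. A $ i"]
  by (simp add: smat_def vector_scalar_mult_def)

lemma det_eq_0_kernel:
  fixes A :: "'k::field^'n^'n"
  assumes "det A = 0"
  obtains x where "x \<noteq> 0" "A *v x = 0"
  using assms invertible_det_nz[of A] matrix_left_invertible_ker[of A] invertible_left_inverse[of A]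
  by blast

text \<open>Without a root the characteristic polynomial \<open>P\<close> would be a constant
  \<open>c\<close>. Instead of computing its degree, reverse it: the polynomial \<open>Q\<close>
  with values \<open>det (smat t A - mat 1)\<close> would agree with \<open>c\<close> times a
  positive power of \<open>t\<close> for nonzero \<open>t\<close>, hence everywhere, and at zero
  this gives \<open>det (- mat 1) = 0\<close>.\<close>

lemma eigenvector_exists:
  fixes A :: "'k::alg_closed_field^'n^'n"
  obtains c x where "x \<noteq> 0" "A *v x = c *s x"
proof -
  define P where "P = det (\<chi> i j. [:A$i$j, if i = j then - 1 else 0:])"
  have P: "poly P t = det (A - mat t)" for t
    unfolding P_def poly_det by (intro arg_cong[of _ _ det]) (simp add: vec_eq_iff mat_def)
  have "\<exists>t. poly P t = 0"
  proof (rule ccontr)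
    assume nr: "\<not> ?thesis"
    then have "degree P = 0" using alg_closed_imp_poly_has_root[of P] by auto
    then obtain c where c: "P = [:c:]" by (auto elim: degree_eq_zeroE)
    define Q where "Q = det (\<chi> i j. [:if i = j then - 1 else 0, A$i$j:])"
    have Q: "poly Q t = det (smat t A - mat 1)" for t
      unfolding Q_def poly_det by (intro arg_cong[of _ _ det]) (simp add: vec_eq_iff mat_def)
    have "poly Q t = poly (monom c CARD('n)) t" if "t \<noteq> 0" for t
    proof -
      have "smat t A - mat 1 = smat t (A - mat (inverse t))"
        using that by (simp add: vec_eq_iff mat_def algebra_simps)
      then have "poly Q t = t ^ CARD('n) * poly P (inverse t)"
        unfolding P Q by (simp add: det_smat)
      then show ?thesis by (simp add: c poly_monom)
    qed
    then have "UNIV - {0} \<subseteq> {t. poly (Q - monom c CARD('n)) t = 0}" by auto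
    moreover have "infinite (UNIV - {0 :: 'k})"
      using infinite_UNIV_alg_closed by simp
    ultimately have "Q - monom c CARD('n) = 0"
      using poly_roots_finite finite_subset by blast
    then have "poly Q 0 = poly (monom c CARD('n)) 0" by simp
    then have "det (- mat 1 :: 'k^'n^'n) = 0"
      unfolding Q by (simp add: poly_monom zero_power)
    moreover have "- mat 1 = smat (- 1) (mat 1 :: 'k^'n^'n)"
      by (simp only: smat_minus smat_simps)
    ultimately have "(- 1) ^ CARD('n) * det (mat 1 :: 'k^'n^'n) = 0"
      by (simp only: det_smat)
    then show False by simp
  qed
  then obtain t where "det (A - mat t) = 0" by (auto simp: P)
  then obtain x where "x \<noteq> 0" "(A - mat t) *v x = 0" by (rule det_eq_0_kernel)
  moreover have "mat t *v x = t *s x" by (subst mat_eq_smat) simp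
  ultimately show ?thesis using that by (simp add: matrix_vector_mult_diff_rdistrib)
qed

section \<open>Clifford generators and isotropic spaces\<close>

lemma clifford_anticommute:
  assumes "skew A" "skew B" "pfaff2 A B = 0"
  shows "A ** star B = - (B ** star A)" "star A ** B = - (star B ** A)"
  using star_clifford[OF assms(1,2)] assms(3)
  by (simp_all add: eq_neg_iff_add_eq_0)

lemma mat_cancel_2:
  fixes A :: "'k::field^'n^'n"
  assumes "(2::'k) \<noteq> 0" "A + A = mat c"
  shows "A = mat (c / 2)"
proof -
  have "2 * A$i$j = mat c $ i $ j" for i j
    using arg_cong[OF assms(2), of "\<lambda>A. A $ i $ j"] by simp
  then have "A$i$j = mat c $ i $ j / 2" for i j
    using assms(1) by (metis nonzero_mult_div_cancel_left)
  then have "A$i$j = mat (c / 2) $ i $ j" for i j by (simp only: mat_def) simp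
  then show ?thesis by (simp only: vec_eq_iff) simp
qed

lemma clifford_square:
  fixes A :: "'k::field^4^4"
  assumes "(2::'k) \<noteq> 0" "skew A"
  shows "A ** star A = mat (pfaff2 A A / 2)" "star A ** A = mat (pfaff2 A A / 2)"
  using star_clifford[OF assms(2,2)] by (auto intro: mat_cancel_2[OF assms(1)])

text \<open>
  The sum of \<open>k\<^sup>4\<close> and its dual is a Clifford module, on which totally isotropic spaces act by
  exterior algebras; hence the generators have a common null vector in one of the two summands.
\<close>

lemma isotropic_common_kernel:
  fixes \<B> :: "('k::field^4^4) set"
  assumes two: "(2::'k) \<noteq> 0" and "finite \<B>" "\<And>A. A \<in> \<B> \<Longrightarrow> skew A"
    and "\<And>A B. A \<in> \<B> \<Longrightarrow> B \<in> \<B> \<Longrightarrow> pfaff2 A B = 0"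
  shows "(\<exists>x. x \<noteq> 0 \<and> (\<forall>A\<in>\<B>. A *v x = 0)) \<or> (\<exists>x. x \<noteq> 0 \<and> (\<forall>A\<in>\<B>. star A *v x = 0))"
  using assms(2-)
proof (induction \<B> rule: finite_induct)
  case empty
  have "(1 :: 'k^4) \<noteq> 0" by simp
  then show ?case by blast
next
  case (insert A \<B>)
  have IH: "(\<exists>x. x \<noteq> 0 \<and> (\<forall>A\<in>\<B>. A *v x = 0)) \<or> (\<exists>x. x \<noteq> 0 \<and> (\<forall>A\<in>\<B>. star A *v x = 0))"
    by (rule insert.IH) (simp_all add: insert.prems)
  have sq: "A ** star A = 0" "star A ** A = 0"
    using clifford_square[OF two, of A] insert.prems by (simp_all add: mat_def vec_eq_iff)
  have ac: "A ** star B = - (B ** star A)" "star A ** B = - (star B ** A)" if "B \<in> \<B>" for B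
    using clifford_anticommute[of A B] that insert.prems by blast+
  have neg: "(- X) *v x = - (X *v x)" for X :: "'k^4^4" and x
    by (simp add: vec_eq_iff matrix_vector_mult_def sum_negf)
  from IH show ?case
  proof (elim disjE exE conjE)
    fix x assume x: "x \<noteq> 0" "\<forall>B\<in>\<B>. B *v x = 0"
    show ?thesis
    proof (cases "A *v x = 0")
      case False
      \<comment> \<open>\<open>A\<close> carries the common null vector to the other summand: the
        old generators still kill it because they anticommute with \<open>A\<close>, and
        \<open>star A\<close> kills it because \<open>star A ** A = 0\<close>.\<close>
      have "star B *v (A *v x) = 0" if "B \<in> \<B>" for B
      proof -
        have "star B ** A = - (star A ** B)" using ac(2)[OF that] by simp
        then show ?thesis using x(2) that
          by (simp add: matrix_vector_mul_assoc neg) (simp flip: matrix_vector_mul_assoc)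
      qed
      moreover have "star A *v (A *v x) = 0" by (simp add: matrix_vector_mul_assoc sq)
      ultimately show ?thesis using False by (intro disjI2 exI[of _ "A *v x"]) auto
    qed (use x in auto)
  next
    fix x assume x: "x \<noteq> 0" "\<forall>B\<in>\<B>. star B *v x = 0"
    show ?thesis
    proof (cases "star A *v x = 0")
      case False
      have "B *v (star A *v x) = 0" if "B \<in> \<B>" for B
      proof -
        have "B ** star A = - (A ** star B)" using ac(1)[OF that] by simp
        then show ?thesis using x(2) that
          by (simp add: matrix_vector_mul_assoc neg) (simp flip: matrix_vector_mul_assoc)
      qed
      moreover have "A *v (star A *v x) = 0" by (simp add: matrix_vector_mul_assoc sq)
      ultimately show ?thesis using False by (intro disjI1 exI[of _ "star A *v x"]) auto
    qed (use x in auto)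
  qed
qed

locale irreducible_matrices =
  fixes \<M> :: "('k::alg_closed_field^4^4) set"
  assumes two: "(2::'k) \<noteq> 0"
    and inverse: "M \<in> \<M> \<Longrightarrow> \<exists>N\<in>\<M>. M ** N = mat 1 \<and> N ** M = mat 1"
    and irreducible: "vec.subspace X \<Longrightarrow> (\<And>M x. M \<in> \<M> \<Longrightarrow> x \<in> X \<Longrightarrow> M *v x \<in> X) \<Longrightarrow>
      X = {0} \<or> X = UNIV"
begin

lemma det_nz: "M \<in> \<M> \<Longrightarrow> det M \<noteq> 0"
  using inverse invertible_det_nz invertible_def by metis

lemma schur:
  assumes "\<And>M. M \<in> \<M> \<Longrightarrow> X ** M = M ** X"
  obtains c where "X = mat c"
proof -
  obtain c x where x: "x \<noteq> 0" "X *v x = c *s x" by (rule eigenvector_exists)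
  let ?E = "{y. X *v y = c *s y}"
  have "vec.subspace ?E"
    by (auto simp: vec.subspace_def matrix_vector_right_distrib vector_add_ldistrib
        vec.scale vector_smult_assoc mult.commute)
  moreover have "M *v y \<in> ?E" if "M \<in> \<M>" "y \<in> ?E" for M y
    using that assms[OF that(1)] by (simp add: matrix_vector_mul_assoc)
      (simp add: vec.scale flip: matrix_vector_mul_assoc)
  ultimately have "?E = {0} \<or> ?E = UNIV" by (rule irreducible)
  with x have "X *v y = c *s y" for y by blast
  then have "\<forall>y. X *v y = smat c (mat 1) *v y" by (auto simp only: smat_simps matrix_vector_mul_lid)
  then have "X = smat c (mat 1)" by (rule matrix_eq[THEN iffD2])
  also have "\<dots> = mat c" by (rule mat_eq_smat[symmetric])
  finally show ?thesis by (rule that)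
qed

end

section \<open>Transformation of Clifford products and of the Pfaffian form under congruence\<close>

lemma matrix_cancel:
  fixes M :: "'k::field^'n^'n"
  assumes "det M \<noteq> 0"
  shows "M ** A = M ** B \<longleftrightarrow> A = B" "A' ** M = B' ** M \<longleftrightarrow> A' = B'"
proof -
  obtain N where N: "M ** N = mat 1" "N ** M = mat 1"
    using assms invertible_det_nz invertible_def by metis
  show "M ** A = M ** B \<longleftrightarrow> A = B"
    by (metis N(2) matrix_mul_assoc matrix_mul_lid)
  show "A' ** M = B' ** M \<longleftrightarrow> A' = B'"
    by (metis N(1) matrix_mul_assoc matrix_mul_rid)
qed

lemma mat_eq_iff: "(mat a :: 'k::comm_ring_1^'n^'n) = mat b \<longleftrightarrow> a = b"
  by (auto simp: vec_eq_iff mat_def)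

text \<open>An even product such as \<open>A ** star B\<close> is an endomorphism of V, so by
  \<open>star_congruence\<close> it transforms by conjugation with \<open>M\<close>, up to
  \<open>det M\<close>. The trailing \<open>M\<close> on the left stands in for an inverse on the
  right.\<close>

lemma star_congruence_mult:
  fixes M :: "'k::comm_ring_1^4^4"
  assumes "skew B"
  shows "(M ** A ** transpose M) ** star (M ** B ** transpose M) ** M = smat (det M) (M ** A ** star B)"
proof -
  have "(M ** A ** transpose M) ** star (M ** B ** transpose M) ** M =
      (M ** A) ** (transpose M ** star (M ** B ** transpose M) ** M)"
    by (simp only: matrix_mul_assoc)
  then show ?thesis by (simp add: star_congruence[OF assms])
qed

text \<open>The Clifford relation encodes the form as a scalar matrix, and conjugation by
  \<open>M\<close> fixes scalar matrices; only the factor \<open>det M\<close> from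
  \<open>star_congruence_mult\<close> remains.\<close>

lemma pfaff2_congruence:
  fixes M :: "'k::field^4^4"
  assumes "skew A" "skew B" "det M \<noteq> 0"
  shows "pfaff2 (M ** A ** transpose M) (M ** B ** transpose M) = det M * pfaff2 A B"
proof -
  let ?c = "\<lambda>A. M ** A ** transpose M"
  have "mat (pfaff2 (?c A) (?c B)) ** M = (?c A ** star (?c B) + ?c B ** star (?c A)) ** M"
    by (simp only: star_clifford skew_congruence assms)
  also have "\<dots> = smat (det M) (M ** (A ** star B + B ** star A))"
    by (simp only: matrix_mult_distrib star_congruence_mult assms smat_add matrix_mul_assoc)
  also have "\<dots> = mat (det M * pfaff2 A B) ** M"
    by (simp add: star_clifford assms)
  finally show ?thesis
    by (simp only: matrix_cancel[OF assms(3)] mat_eq_iff)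
qed

lemma matrix_vector_neg: "(- X) *v x = - (X *v x)" for X :: "'k::comm_ring_1^'n^'m"
  by (simp add: vec_eq_iff matrix_vector_mult_def sum_negf)

lemma matrix_eq_0I:
  fixes A :: "'k::field^'n^'n"
  assumes "\<And>x. A *v x = 0"
  shows "A = 0"
  using assms by (auto intro!: matrix_eq[THEN iffD2])

text \<open>Extends a membership from generators to a span in one argument; nested applications
  treat the multilinear expressions in \<open>stable_dim_2\<close> and
  \<open>stable_dim_3\<close>.\<close>

lemma span_linear_mem:
  fixes g :: "'k::field^'n^'m \<Rightarrow> 'k^'p^'q"
  assumes "x \<in> mat.span S" "mat.subspace T" "\<And>y. y \<in> S \<Longrightarrow> g y \<in> T"
    and add: "\<And>x y. g (x + y) = g x + g y" and scale: "\<And>c x. g (smat c x) = smat c (g x)"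
  shows "g x \<in> T"
  using assms(1)
proof (rule mat.span_induct)
  have "g 0 = 0" using scale[of 0 0] by simp
  then show "mat.subspace {x. g x \<in> T}"
    using assms(2) by (auto simp: mat.subspace_def add scale)
qed (fact assms(3))

lemma subspace_range_smat: "mat.subspace (range (\<lambda>c. smat c A))" for A :: "'k::field^'n^'m"
  unfolding mat.subspace_def
proof safe
  show "0 \<in> range (\<lambda>c. smat c A)" by (rule range_eqI[of _ _ 0]) simp
  show "smat a A + smat b A \<in> range (\<lambda>c. smat c A)" for a b
    by (rule range_eqI[of _ _ "a + b"]) (simp add: smat_add)
  show "smat a (smat b A) \<in> range (\<lambda>c. smat c A)" for a b
    by (rule range_eqI[of _ _ "a * b"]) simp
qed

lemma scalar_product_simps:
  fixes x :: "'k::comm_ring_1^'n"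
  shows "scalar_product x (y + z) = scalar_product x y + scalar_product x z"
    "scalar_product x (c *s y) = c * scalar_product x y" "scalar_product x 0 = 0"
    "scalar_product (y + z) x = scalar_product y x + scalar_product z x"
    "scalar_product (c *s y) x = c * scalar_product y x" "scalar_product 0 x = 0"
  by (simp_all add: scalar_product_def algebra_simps sum.distrib sum_distrib_left)

section \<open>Stable isotropic spaces vanish\<close>

context irreducible_matrices
begin

definition stable :: "('k^4^4) set \<Rightarrow> bool"
  where "stable U \<longleftrightarrow> mat.subspace U \<and> (\<forall>A\<in>U. skew A) \<and> (\<forall>M\<in>\<M>. \<forall>A\<in>U. M ** A ** transpose M \<in> U)"

text \<open>\<open>star A\<close> maps V to its dual and \<open>A\<close> maps the dual to V. In one
  case of \<open>isotropic_common_kernel\<close> the common kernel of all \<open>star A\<close> is a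
  nonzero invariant subspace of V, hence V. In the other the common kernel \<open>Y\<close> lies in
  the dual, and irreducibility is applied to its annihilator \<open>X\<close> in V, which is proper,
  hence zero, and contains the range of every \<open>A\<close>.\<close>

lemma isotropic_trivial:
  assumes U: "stable U" and iso: "\<And>A B. A \<in> U \<Longrightarrow> B \<in> U \<Longrightarrow> pfaff2 A B = 0"
    and A: "A \<in> U"
  shows "A = 0"
proof -
  have sk: "skew A" if "A \<in> U" for A using U that by (simp add: stable_def)
  have cong: "M ** A ** transpose M \<in> U" if "M \<in> \<M>" "A \<in> U" for M A
    using U that by (simp add: stable_def)
  obtain \<B> where \<B>: "\<B> \<subseteq> U" "mat.independent \<B>" "U \<subseteq> mat.span \<B>"
    by (rule mat.basis_exists)
  have "\<B> \<subseteq> mat.span (set [skew_unit 1 2, skew_unit 1 3, skew_unit 1 4, skew_unit 2 3,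
      skew_unit 2 4, skew_unit 3 4 :: 'k^4^4])"
    using \<B>(1) sk skew_span by blast
  then have fin: "finite \<B>" using mat.independent_span_bound[OF _ \<B>(2)] by blast
  have "mat.subspace {A. A *v x = 0}" "mat.subspace {A. star A *v x = 0}" for x :: "'k^4"
    by (auto simp: mat.subspace_def star_linear matrix_vector_mult_add_rdistrib)
  then have ext: "(\<forall>A\<in>\<B>. A *v x = 0) \<Longrightarrow> (\<forall>A\<in>U. A *v x = 0)"
    "(\<forall>A\<in>\<B>. star A *v x = 0) \<Longrightarrow> (\<forall>A\<in>U. star A *v x = 0)" for x
    using \<B>(3) mat.span_minimal[of \<B> "{A. A *v x = 0}"] mat.span_minimal[of \<B> "{A. star A *v x = 0}"]
    by blast+
  have "(\<exists>x. x \<noteq> 0 \<and> (\<forall>A\<in>\<B>. A *v x = 0)) \<or> (\<exists>x. x \<noteq> 0 \<and> (\<forall>A\<in>\<B>. star A *v x = 0))"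
    using \<B>(1) by (intro isotropic_common_kernel[OF two fin]) (auto intro!: sk iso)
  then show "A = 0"
  proof (elim disjE exE conjE)
    fix x assume x: "x \<noteq> 0" "\<forall>A\<in>\<B>. star A *v x = 0"
    define X where "X = {x. \<forall>A\<in>U. star A *v x = 0}"
    have "vec.subspace X"
      by (auto simp: X_def vec.subspace_def matrix_vector_right_distrib vec.scale)
    moreover have "M *v y \<in> X" if M: "M \<in> \<M>" and y: "y \<in> X" for M y
      unfolding X_def
    proof safe
      fix A assume A: "A \<in> U"
      obtain N where N: "N \<in> \<M>" "M ** N = mat 1" "N ** M = mat 1" using inverse[OF M] by blast
      \<comment> \<open>\<open>A\<close> is moved back by the inverse \<open>N\<close> of
        \<open>M\<close> so that \<open>star_congruence\<close> can carry \<open>star A\<close> past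
        \<open>M\<close>.\<close>
      define A' where "A' = N ** A ** transpose N"
      have A': "A' \<in> U" unfolding A'_def by (rule cong[OF N(1) A])
      have "M ** A' ** transpose M = (M ** N) ** A ** transpose (M ** N)"
        by (simp only: A'_def matrix_transpose_mul matrix_mul_assoc)
      then have "M ** A' ** transpose M = A" by (simp add: N)
      with star_congruence[OF sk[OF A'], of M]
      have "transpose M ** star A ** M = smat (det M) (star A')" by simp
      then have "(transpose N ** transpose M) ** star A ** M = smat (det M) (transpose N ** star A')"
        by (metis matrix_mul_assoc smat_simps(2))
      then have "star A ** M = smat (det M) (transpose N ** star A')"
        by (simp add: N flip: matrix_transpose_mul)
      then show "star A *v (M *v y) = 0"
        using y A' by (simp add: matrix_vector_mul_assoc X_def) (simp add: X_def flip: matrix_vector_mul_assoc)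
    qed
    ultimately have "X = {0} \<or> X = UNIV" by (rule irreducible)
    moreover have "x \<in> X" using ext(2)[OF x(2)] by (simp add: X_def)
    ultimately have "star A *v y = 0" for y using x(1) A by (auto simp: X_def)
    then have "star A = 0" by (rule matrix_eq_0I)
    then show "A = 0" using star_star[OF sk[OF A]] by (simp add: star_linear)
  next
    fix x assume x: "x \<noteq> 0" "\<forall>A\<in>\<B>. A *v x = 0"
    define Y where "Y = {y. \<forall>A\<in>U. A *v y = 0}"
    define X where "X = {x. \<forall>y\<in>Y. scalar_product y x = 0}"
    have adj: "scalar_product y (M *v z) = scalar_product (transpose M *v y) z" for M :: "'k^4^4" and y z
      by (simp add: scalar_product_def matrix_vector_mult_def transpose_def sum_4 algebra_simps
          del: transpose_matrix_vector)
    have "vec.subspace X"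
      by (simp add: X_def vec.subspace_def scalar_product_simps)
    moreover have "M *v y \<in> X" if M: "M \<in> \<M>" and y: "y \<in> X" for M y
      unfolding X_def
    proof safe
      fix z assume z: "z \<in> Y"
      have "transpose M *v z \<in> Y"
        unfolding Y_def
      proof safe
        fix A assume A: "A \<in> U"
        obtain N where N: "N ** M = mat 1" using inverse[OF M] by blast
        have "(M ** A ** transpose M) *v z = 0" using z cong[OF M A] by (simp add: Y_def)
        then have "N *v ((M ** A ** transpose M) *v z) = 0" by simp
        then have "((N ** M) ** A ** transpose M) *v z = 0"
          by (simp only: matrix_vector_mul_assoc matrix_mul_assoc)
        then show "A *v (transpose M *v z) = 0"
          by (simp add: N matrix_vector_mul_assoc del: transpose_matrix_vector)
      qed
      with y show "scalar_product z (M *v y) = 0" unfolding adj by (simp add: X_def)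
    qed
    ultimately have "X = {0} \<or> X = UNIV" by (rule irreducible)
    moreover have "X \<noteq> UNIV"
    proof
      assume "X = UNIV"
      moreover have "x \<in> Y" using ext(1)[OF x(2)] by (simp add: Y_def)
      ultimately have "scalar_product x z = 0" for z by (auto simp: X_def)
      from this[of "axis _ 1"] have "x $ i = 0" for i
        by (simp add: scalar_product_def axis_def if_distrib cong: if_cong)
      with x(1) show False by (simp add: vec_eq_iff)
    qed
    \<comment> \<open>By skewness, the functionals in \<open>Y\<close>, being killed by
      \<open>A\<close>, vanish on the range of \<open>A\<close>.\<close>
    moreover have "A *v z \<in> X" for z
      unfolding X_def
    proof safe
      fix y assume "y \<in> Y"
      then have "transpose A *v y = 0"
        using sk[OF A] A by (simp add: skew_def Y_def matrix_vector_neg del: transpose_matrix_vector)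
      then show "scalar_product y (A *v z) = 0"
        unfolding adj by (simp add: scalar_product_def del: transpose_matrix_vector)
    qed
    ultimately have "A *v z = 0" for z by blast
    then show "A = 0" by (rule matrix_eq_0I)
  qed
qed

end

section \<open>Orthonormal bases of stable spaces and their volume elements\<close>

context irreducible_matrices
begin

lemma stable_perp:
  assumes "stable U"
  shows "stable {A. skew A \<and> (\<forall>B\<in>U. pfaff2 A B = 0)}" (is "stable ?P")
proof -
  have "mat.subspace ?P"
    by (auto simp: mat.subspace_def skew_0 skew_add skew_smat pfaff2_simps) (simp add: pfaff2_def)
  moreover have "M ** A ** transpose M \<in> ?P" if M: "M \<in> \<M>" and A: "A \<in> ?P" for M A
  proof -
    have "pfaff2 (M ** A ** transpose M) B = 0" if B: "B \<in> U" for B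
    proof -
      obtain N where N: "N \<in> \<M>" "M ** N = mat 1" using inverse[OF M] by blast
      define B' where "B' = N ** B ** transpose N"
      have "M ** B' ** transpose M = (M ** N) ** B ** transpose (M ** N)"
        by (simp only: B'_def matrix_transpose_mul matrix_mul_assoc)
      then have B': "M ** B' ** transpose M = B" by (simp add: N)
      have U': "B' \<in> U" "skew B'" using assms N(1) B by (auto simp: stable_def B'_def)
      then show ?thesis
        using pfaff2_congruence[of A B' M] A det_nz[OF M] B' by simp
    qed
    with A show ?thesis by (simp add: skew_congruence)
  qed
  ultimately show ?thesis by (simp add: stable_def)
qed

lemma stable_Int:
  assumes "stable U" "stable V"
  shows "stable (U \<inter> V)"
proof -
  have "mat.subspace (U \<inter> V)" using assms by (intro mat.subspace_inter) (simp_all only: stable_def)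
  moreover have "skew A" if "A \<in> U \<inter> V" for A using assms(1) that by (simp only: stable_def Int_iff)
  moreover have "M ** A ** transpose M \<in> U \<inter> V" if "A \<in> U \<inter> V" "M \<in> \<M>" for A M
    using assms that by (simp only: stable_def Int_iff simp_thms)
  ultimately show ?thesis unfolding stable_def by (intro conjI ballI)
qed

text \<open>The radical of \<open>U\<close> is its intersection with the orthogonal complement, a
  stable space on which the form vanishes.\<close>

lemma stable_radical:
  assumes "stable U" "A \<in> U" "\<And>B. B \<in> U \<Longrightarrow> pfaff2 A B = 0"
  shows "A = 0"
proof (rule isotropic_trivial)
  have "stable {A. skew A \<and> (\<forall>B\<in>U. pfaff2 A B = 0)}" by (rule stable_perp[OF assms(1)])
  with assms(1) show "stable (U \<inter> {A. skew A \<and> (\<forall>B\<in>U. pfaff2 A B = 0)})"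
    by (rule stable_Int)
  show "A \<in> U \<inter> {A. skew A \<and> (\<forall>B\<in>U. pfaff2 A B = 0)}"
    using assms by (auto simp: stable_def)
qed auto

lemma stable_orthonormal_basis:
  assumes U: "stable U"
  obtains u n where "pf.orthonormal u n" "\<forall>i<n. u i \<in> U"
    "\<forall>x\<in>U. x = (\<Sum>i<n. smat (pfaff2 x (u i) / 2) (u i))"
proof (rule pf.orthonormal_basis_exists[OF two])
  show "mat.subspace U" using U by (simp add: stable_def)
  show "U \<subseteq> mat.span (set [skew_unit 1 2, skew_unit 1 3, skew_unit 1 4, skew_unit 2 3,
    skew_unit 2 4, skew_unit 3 4])"
    using U skew_span unfolding stable_def by blast
  show "x = 0" if "x \<in> U" "\<And>y. y \<in> U \<Longrightarrow> pfaff2 x y / 2 = 0" for x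
    by (rule stable_radical[OF U that(1)]) (use that(2) two in auto)
qed (use that in auto)

lemma orthonormal_clifford:
  fixes u :: "nat \<Rightarrow> 'k^4^4"
  assumes "pf.orthonormal u n" "\<And>i. i < n \<Longrightarrow> skew (u i)" "i < n" "j < n"
  shows "u i ** star (u i) = mat 1" "star (u i) ** u i = mat 1"
    "i \<noteq> j \<Longrightarrow> u i ** star (u j) = - (u j ** star (u i))"
    "i \<noteq> j \<Longrightarrow> star (u i) ** u j = - (star (u j) ** u i)"
proof -
  have "pfaff2 (u i) (u i) / 2 = 1" "i \<noteq> j \<Longrightarrow> pfaff2 (u i) (u j) = 0"
    using assms two by (auto simp: pf.orthonormal_def)
  then show "u i ** star (u i) = mat 1" "star (u i) ** u i = mat 1"
    "i \<noteq> j \<Longrightarrow> u i ** star (u j) = - (u j ** star (u i))"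
    "i \<noteq> j \<Longrightarrow> star (u i) ** u j = - (star (u j) ** u i)"
    using clifford_square[OF two, of "u i"] clifford_anticommute[of "u i" "u j"] assms by simp_all
qed

lemma det_nz_if_left_inverse: "A ** B = mat 1 \<Longrightarrow> det A \<noteq> 0" for A B :: "'k^4^4"
  by (metis det_I det_mul mult_zero_left zero_neq_one)

lemma eq_smat_half:
  assumes "A + A = (B :: 'k^4^4)"
  shows "A = smat (1 / 2) B"
proof -
  have "A + A = smat 2 A" by (simp add: vec_eq_iff)
  then have "smat (1 / 2) B = smat (1 / 2 * 2) A" by (simp only: assms[symmetric] smat_simps)
  with two show ?thesis by simp
qed

lemma stable_congruence:
  assumes "stable U" "M \<in> \<M>" "A \<in> U"
  shows "M ** A ** transpose M \<in> U" "skew A"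
  using assms by (auto simp: stable_def)

lemma pfaff2_stable_congruence:
  assumes "stable U" "M \<in> \<M>" "A \<in> U" "B \<in> U"
  shows "pfaff2 (M ** A ** transpose M) (M ** B ** transpose M) = det M * pfaff2 A B"
  using assms stable_congruence det_nz by (intro pfaff2_congruence) auto

lemma stable_dim_1:
  assumes U: "stable U" and u: "\<omega> \<in> U" "\<omega> ** star \<omega> = mat 1"
    and span: "U \<subseteq> range (\<lambda>c. smat c \<omega>)"
  shows "skew \<omega> \<and> det \<omega> \<noteq> 0 \<and> (\<forall>M\<in>\<M>. \<exists>c. M ** \<omega> ** transpose M = smat c \<omega>)"
proof (intro conjI ballI)
  show "skew \<omega>" using U u by (simp add: stable_def)
  show "det \<omega> \<noteq> 0" by (rule det_nz_if_left_inverse[OF u(2)])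
  show "\<exists>c. M ** \<omega> ** transpose M = smat c \<omega>" if "M \<in> \<M>" for M
    using stable_congruence(1)[OF U that u(1)] span by blast
qed

text \<open>The map sending x, y to \<open>x ** star y - y ** star x\<close> is alternating and
  bilinear on a plane, so its values are multiples of \<open>J\<close>. For the images
  \<open>X\<close>, \<open>Y\<close> of \<open>a\<close>, \<open>b\<close> under \<open>M\<close> it
  is twice \<open>X ** star Y\<close>, which is also a conjugate of \<open>J\<close> up to
  \<open>det M\<close>. Hence \<open>M ** J\<close> is a multiple of \<open>J ** M\<close>, and
  \<open>J ** J = - mat 1\<close> leaves only the factors 1 and -1.\<close>

lemma stable_dim_2:
  assumes U: "stable U" and ab: "a \<in> U" "b \<in> U" and span: "U \<subseteq> mat.span {a, b}"
    and sq: "a ** star a = mat 1" "b ** star b = mat 1" "star a ** a = mat 1" "star b ** b = mat 1"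
    and anti: "b ** star a = - (a ** star b)" "star b ** a = - (star a ** b)"
    and orth: "pfaff2 a b = 0"
  defines "J \<equiv> a ** star b"
  shows "det J \<noteq> 0 \<and> (\<forall>M\<in>\<M>. J ** M = M ** J \<or> J ** M = - (M ** J)) \<and>
    \<not> (\<forall>M\<in>\<M>. J ** M = M ** J)"
proof (intro conjI ballI)
  have "J ** J = a ** (star b ** a) ** star b"
    by (simp add: J_def matrix_mul_assoc)
  also have "\<dots> = - (a ** star a ** (b ** star b))"
    by (simp add: anti) (simp add: matrix_mul_assoc)
  finally have JJ: "J ** J = - mat 1" by (simp add: sq)
  then have "J ** (- J) = mat 1" by simp
  then show detJ: "det J \<noteq> 0" by (rule det_nz_if_left_inverse)
  have base: "x ** star y - y ** star x \<in> range (\<lambda>c. smat c J)" if "x \<in> {a, b}" "y \<in> {a, b}" for x y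
  proof -
    have "J - (- J) = smat 2 J" "- J - J = smat (- 2) J" "x - x = smat 0 J" for x
      by (simp_all add: vec_eq_iff)
    then show ?thesis using that unfolding insert_iff empty_iff
      by (elim disjE) (simp_all only: anti J_def[symmetric], (rule rangeI)+)
  qed
  have comm: "x ** star y - y ** star x \<in> range (\<lambda>c. smat c J)" if x: "x \<in> U" and y: "y \<in> U" for x y
  proof (rule span_linear_mem[of x "{a, b}" _ "\<lambda>x. x ** star y - y ** star x"])
    fix z assume z: "z \<in> {a, b}"
    show "z ** star y - y ** star z \<in> range (\<lambda>c. smat c J)"
    proof (rule span_linear_mem[of y "{a, b}" _ "\<lambda>y. z ** star y - y ** star z"])
    qed (use span y z base subspace_range_smat in
      \<open>auto simp: star_linear matrix_mult_distrib smat_diff\<close>)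
  qed (use span x subspace_range_smat in \<open>auto simp: star_linear matrix_mult_distrib smat_diff\<close>)
  fix M assume M: "M \<in> \<M>"
  define X Y where "X = M ** a ** transpose M" and "Y = M ** b ** transpose M"
  have XY: "X \<in> U" "Y \<in> U" "skew X" "skew Y"
    using stable_congruence[OF U] M ab by (simp_all add: X_def Y_def skew_congruence)
  have "pfaff2 X Y = 0"
    using pfaff2_stable_congruence[OF U M ab] orth by (simp add: X_def Y_def)
  then have "Y ** star X = - (X ** star Y)"
    using clifford_anticommute[OF XY(3,4)] by simp
  moreover obtain k where "X ** star Y - Y ** star X = smat k J"
    using comm[OF XY(1,2)] by blast
  ultimately have "X ** star Y + X ** star Y = smat k J" by simp
  then have "X ** star Y = smat (k / 2) J" using eq_smat_half by fastforce
  moreover have "X ** star Y ** M = smat (det M) (M ** J)"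
    using star_congruence_mult[OF stable_congruence(2)[OF U M ab(2)], of M a]
    by (simp add: X_def Y_def J_def matrix_mul_assoc)
  ultimately have eq: "smat (k / 2) (J ** M) = smat (det M) (M ** J)" by simp
  define e where "e = k / 2 / det M"
  have "smat (1 / det M) (smat (k / 2) (J ** M)) = M ** J"
    unfolding eq using det_nz[OF M] by simp
  then have MJ: "M ** J = smat e (J ** M)" by (simp add: e_def mult.commute)
  \<comment> \<open>Moving \<open>J\<close> past \<open>M\<close> twice produces the factor
    \<open>e * e\<close>; as \<open>J ** J\<close> is the scalar -1, this factor must be 1.\<close>
  have "M ** J ** J = smat e (J ** (M ** J))" by (simp only: MJ smat_simps matrix_mul_assoc[symmetric])
  also have "\<dots> = smat (e * e) (J ** J ** M)" by (simp only: MJ smat_simps matrix_mul_assoc)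
  finally have "smat 1 M = smat (e * e) M"
    using JJ by (simp add: smat_minus flip: matrix_mul_assoc)
  then have "smat (1 - e * e) M = 0" by (simp only: smat_diff right_minus_eq)
  then have "det (smat (1 - e * e) M) = 0" by (simp only: det_0[unfolded mat_0])
  then have "1 - e * e = 0" using det_nz[OF M] by (simp add: det_smat)
  then have "e = 1 \<or> e = - 1" by (simp add: square_eq_1_iff)
  then show "J ** M = M ** J \<or> J ** M = - (M ** J)"
    unfolding MJ by (auto simp: smat_minus)
next
  show "\<not> (\<forall>M\<in>\<M>. J ** M = M ** J)"
  proof
    assume "\<forall>M\<in>\<M>. J ** M = M ** J"
    then obtain c where "J = mat c" using schur[of J] by blast
    \<comment> \<open>Since \<open>star b ** b = mat 1\<close>, multiplying by \<open>b\<close>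
      recovers \<open>a\<close> from \<open>J\<close>; a scalar \<open>J\<close> would make
      \<open>a\<close> a multiple of \<open>b\<close>, against their orthogonality.\<close>
    then have "J ** b = smat c b" by simp
    then have "a = smat c b" by (simp add: J_def sq flip: matrix_mul_assoc)
    then have "pfaff2 a a = c * pfaff2 b a" by (metis pfaff2_simps(2))
    then have "pfaff2 a a = 0" using orth pfaff2_sym[of b a] by simp
    moreover have "a ** star a = mat (pfaff2 a a / 2)"
      by (rule clifford_square[OF two]) (use U ab in \<open>simp add: stable_def\<close>)
    ultimately have "(mat 1 :: 'k^4^4) = mat 0" using sq(1) by simp
    then show False by (simp only: mat_eq_iff one_neq_zero)
  qed
qed

text \<open>As in dimension two, \<open>x ** star y ** z - z ** star y ** x\<close> takes values in
  the multiples of \<open>C\<close> on all of \<open>U\<close>, and is twice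
  \<open>x ** star y ** z\<close> on orthogonal triples. Applied to the images of \<open>a\<close>,
  \<open>b\<close>, \<open>c\<close> this gives \<open>C\<close> a multiplier \<open>e\<close> for
  each \<open>M\<close>. The link between \<open>e\<close> and \<open>det M\<close> comes from the
  quadratic identity \<open>anticomm\<close>.\<close>

lemma stable_dim_3:
  assumes U: "stable U" and abc: "a \<in> U" "b \<in> U" "c \<in> U" and span: "U \<subseteq> mat.span {a, b, c}"
    and sq: "\<And>x. x \<in> {a, b, c} \<Longrightarrow> x ** star x = mat 1" "\<And>x. x \<in> {a, b, c} \<Longrightarrow> star x ** x = mat 1"
    and orth: "pfaff2 a b = 0" "pfaff2 a c = 0" "pfaff2 b c = 0"
  defines "C \<equiv> a ** star b ** c"
  shows "transpose C = C \<and> det C \<noteq> 0 \<and> (\<forall>M\<in>\<M>. \<exists>e. M ** C ** transpose M = smat e C \<and> det M = e\<^sup>2)"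
proof (intro conjI ballI)
  have sk: "skew a" "skew b" "skew c" using U abc by (simp_all add: stable_def)
  have sksq: "star x ** y = - (star y ** x)" "x ** star y = - (y ** star x)"
    if "pfaff2 x y = 0" "skew x" "skew y" for x y
    using clifford_anticommute[OF that(2,3,1)] by simp_all
  note anti = sksq[OF orth(1) sk(1,2)] sksq[OF orth(2) sk(1,3)] sksq[OF orth(3) sk(2,3)]
  have swap12: "y ** star x ** z = - (x ** star y ** z)"
    if "pfaff2 x y = 0" "skew x" "skew y" for x y z
    using sksq(2)[OF that] by simp
  have swap23: "x ** star z ** y = - (x ** star y ** z)"
    if "pfaff2 y z = 0" "skew y" "skew z" for x y z
    using sksq(1)[OF that] by (simp flip: matrix_mul_assoc)
  have perm: "b ** star a ** c = - C" "a ** star c ** b = - C" "b ** star c ** a = C"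
    "c ** star a ** b = C" "c ** star b ** a = - C"
  proof -
    show 1: "b ** star a ** c = - C" unfolding C_def by (rule swap12[OF orth(1) sk(1,2)])
    show 2: "a ** star c ** b = - C" unfolding C_def by (rule swap23[OF orth(3) sk(2,3)])
    show 3: "b ** star c ** a = C" using swap23[OF orth(2) sk(1,3), of b] 1 by simp
    show 4: "c ** star a ** b = C" using swap12[OF orth(2) sk(1,3), of b] 2 by simp
    show "c ** star b ** a = - C" using swap12[OF orth(3) sk(2,3), of a] 3 by simp
  qed
  have tr: "transpose (x ** star y ** z) = - (z ** star y ** x)" if "skew x" "skew y" "skew z" for x y z
    using that skew_star[of y] by (simp add: skew_def matrix_transpose_mul matrix_mul_assoc)
  show "transpose C = C"
    unfolding C_def tr[OF sk] perm(5)[unfolded C_def] by simp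
  show "det C \<noteq> 0"
    using det_nz_if_left_inverse[OF sq(1)[of a]] det_nz_if_left_inverse[OF sq(1)[of c]]
      det_nz_if_left_inverse[OF sq(2)[of b]] by (simp add: C_def det_mul)
  \<comment> \<open>Distinct basis vectors give twice a signed \<open>C\<close>; if two coincide,
    the squares collapse and the two terms cancel.\<close>
  have base: "x ** star y ** z - z ** star y ** x \<in> range (\<lambda>k. smat k C)"
    if "x \<in> {a, b, c}" "y \<in> {a, b, c}" "z \<in> {a, b, c}" for x y z
  proof -
    have "C - (- C) = smat 2 C" "- C - C = smat (- 2) C" "A - A = smat 0 C" for A
      by (simp_all add: vec_eq_iff)
    moreover have "x ** star x ** z = z" "z ** star x ** x = z" if "x \<in> {a, b, c}" for x z
      using sq that by (simp_all add: matrix_mul_assoc[symmetric, of z])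
    ultimately show ?thesis using that unfolding insert_iff empty_iff
      by (elim disjE) (simp_all only: perm C_def[symmetric] insert_iff simp_thms, (rule rangeI)+)
  qed
  have comm: "x ** star y ** z - z ** star y ** x \<in> range (\<lambda>k. smat k C)"
    if xyz: "x \<in> U" "y \<in> U" "z \<in> U" for x y z
  proof (rule span_linear_mem[of x "{a, b, c}" _ "\<lambda>x. x ** star y ** z - z ** star y ** x"])
    fix x assume x: "x \<in> {a, b, c}"
    show "x ** star y ** z - z ** star y ** x \<in> range (\<lambda>k. smat k C)"
    proof (rule span_linear_mem[of y "{a, b, c}" _ "\<lambda>y. x ** star y ** z - z ** star y ** x"])
      fix y assume y: "y \<in> {a, b, c}"
      show "x ** star y ** z - z ** star y ** x \<in> range (\<lambda>k. smat k C)"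
      proof (rule span_linear_mem[of z "{a, b, c}" _ "\<lambda>z. x ** star y ** z - z ** star y ** x"])
        show "z \<in> mat.span {a, b, c}" using span xyz(3) by (rule subsetD)
      qed (simp_all add: base[OF x y] subspace_range_smat star_linear matrix_mult_distrib smat_diff)
    qed (simp_all add: subspace_range_smat star_linear matrix_mult_distrib smat_diff subsetD[OF span xyz(2)])
  qed (simp_all add: subspace_range_smat star_linear matrix_mult_distrib smat_diff subsetD[OF span xyz(1)])
  \<comment> \<open>In the Clifford algebra the volume element of three orthonormal generators
    commutes with each of them and has square -1, so sandwiching \<open>x\<close> between two copies
    gives \<open>- x\<close>. By linearity the three basis vectors suffice.\<close>
  have anticomm: "C ** star x ** C = - x" if "x \<in> U" for x
  proof -
    let ?T = "{y. C ** star y ** C = - y}"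
    have sub: "mat.subspace ?T"
      by (simp add: mat.subspace_def star_linear matrix_mult_distrib smat_minus)
    have sq': "y ** x ** star x = y" "y ** star x ** x = y" if "x \<in> {a, b, c}" for x y
      using sq[OF that] by (simp_all flip: matrix_mul_assoc)
    note sq' = sq' sq
    have "C ** star a ** C = - a"
    proof -
      have "C ** star a ** C = C ** (star a ** a) ** star b ** c"
        by (simp only: C_def matrix_mul_assoc)
      also have "\<dots> = c ** star a ** (b ** star b) ** c"
        by (simp only: sq' insert_iff simp_thms matrix_mul_rid matrix_mul_lid minus_minus perm(4)[symmetric] matrix_mul_assoc)
      also have "\<dots> = - (a ** (star c ** c))"
        using swap12[OF orth(2) sk(1,3), of c]
        by (simp only: sq' insert_iff simp_thms matrix_mul_rid matrix_mul_lid minus_minus matrix_mul_assoc)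
      finally show ?thesis by (simp only: sq' insert_iff simp_thms matrix_mul_rid matrix_mul_lid minus_minus matrix_mul_assoc)
    qed
    moreover have "C ** star b ** C = - b"
    proof -
      have "C ** star b ** C = - (C ** star b ** (b ** star a ** c))"
        using perm(1) by simp
      also have "\<dots> = - (C ** (star b ** b) ** star a ** c)"
        by (simp only: matrix_mul_assoc)
      also have "\<dots> = - (b ** star c ** (a ** star a) ** c)"
        by (simp only: sq' insert_iff simp_thms matrix_mul_rid matrix_mul_lid minus_minus perm(3)[symmetric] matrix_mul_assoc)
      also have "\<dots> = - (b ** (star c ** c))"
        by (simp only: sq' insert_iff simp_thms matrix_mul_rid matrix_mul_lid minus_minus matrix_mul_assoc)
      finally show ?thesis by (simp only: sq' insert_iff simp_thms matrix_mul_rid matrix_mul_lid minus_minus matrix_mul_assoc)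
    qed
    moreover have "C ** star c ** C = - c"
    proof -
      have "C ** star c ** C = C ** star c ** (c ** star a ** b)"
        by (simp only: perm(4))
      also have "\<dots> = C ** (star c ** c) ** star a ** b"
        by (simp only: matrix_mul_assoc)
      also have "\<dots> = b ** star c ** (a ** star a) ** b"
        by (simp only: sq' insert_iff simp_thms matrix_mul_rid matrix_mul_lid minus_minus perm(3)[symmetric] matrix_mul_assoc)
      also have "\<dots> = - (c ** (star b ** b))"
        using arg_cong[OF swap12[OF orth(3) sk(2,3), of b], of uminus]
        by (simp only: sq' insert_iff simp_thms matrix_mul_rid matrix_mul_lid minus_minus matrix_mul_assoc)
      finally show ?thesis by (simp only: sq' insert_iff simp_thms matrix_mul_rid matrix_mul_lid minus_minus matrix_mul_assoc)
    qed
    ultimately have "mat.span {a, b, c} \<subseteq> ?T" using sub by (intro mat.span_minimal) simp_all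
    with span that show ?thesis by blast
  qed
  fix M assume M: "M \<in> \<M>"
  define X Y Z where "X = M ** a ** transpose M" and "Y = M ** b ** transpose M"
    and "Z = M ** c ** transpose M"
  have XYZ: "X \<in> U" "Y \<in> U" "Z \<in> U" and skX: "skew X" "skew Y" "skew Z"
    using stable_congruence[OF U] M abc by (simp_all add: X_def Y_def Z_def skew_congruence)
  have o: "pfaff2 X Y = 0" "pfaff2 X Z = 0" "pfaff2 Y Z = 0"
    using pfaff2_stable_congruence[OF U M] abc orth by (simp_all add: X_def Y_def Z_def)
  have "Z ** star Y ** X = - (X ** star Y ** Z)"
  proof -
    have "Z ** star Y ** X = - (Y ** star Z ** X)" by (rule swap12[OF o(3) skX(2,3)])
    also have "Y ** star Z ** X = - (Y ** star X ** Z)" by (rule swap23[OF o(2) skX(1,3)])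
    also have "Y ** star X ** Z = - (X ** star Y ** Z)" by (rule swap12[OF o(1) skX(1,2)])
    finally show ?thesis by simp
  qed
  moreover obtain k where "X ** star Y ** Z - Z ** star Y ** X = smat k C"
    using comm[OF XYZ] by blast
  ultimately have "X ** star Y ** Z + X ** star Y ** Z = smat k C" by simp
  then have k: "X ** star Y ** Z = smat (k / 2) C" using eq_smat_half by fastforce
  have "X ** star Y ** Z = X ** star Y ** M ** (c ** transpose M)"
    by (simp add: Z_def matrix_mul_assoc)
  also have "X ** star Y ** M = smat (det M) (M ** a ** star b)"
    unfolding X_def Y_def by (rule star_congruence_mult[OF sk(2)])
  finally have MC: "smat (det M) (M ** C ** transpose M) = smat (k / 2) C"
    unfolding k by (simp add: C_def matrix_mul_assoc)
  define e where "e = k / 2 / det M"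
  have "smat (1 / det M) (smat (det M) (M ** C ** transpose M)) = smat e C"
    unfolding MC by (simp add: e_def mult.commute)
  then have e: "M ** C ** transpose M = smat e C" using det_nz[OF M] by simp
  \<comment> \<open>The identity \<open>anticomm\<close> is used at \<open>X\<close> and, after
    \<open>star_congruence\<close> has moved \<open>M\<close> through, at \<open>a\<close>; the two
    sides carry the factors \<open>e * e\<close> and \<open>det M\<close>.\<close>
  have "smat (e * e) (C ** star X ** C) = (M ** C ** transpose M) ** star X ** (M ** C ** transpose M)"
    by (simp add: e)
  also have "\<dots> = M ** C ** (transpose M ** star X ** M) ** C ** transpose M"
    by (simp only: matrix_mul_assoc)
  also have "transpose M ** star X ** M = smat (det M) (star a)"
    unfolding X_def by (rule star_congruence[OF sk(1)])
  also have "M ** C ** smat (det M) (star a) ** C ** transpose M =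
      smat (det M) (M ** (C ** star a ** C) ** transpose M)"
    by (simp add: matrix_mul_assoc)
  finally have "smat (e * e) X = smat (det M) X"
    unfolding anticomm[OF abc(1)] anticomm[OF XYZ(1)] by (simp add: X_def smat_minus)
  then have "smat (e * e - det M) X = 0" by (simp only: smat_diff right_minus_eq)
  then have "det (smat (e * e - det M) X) = 0" by (simp only: det_0[unfolded mat_0])
  moreover have "det X \<noteq> 0"
    using det_nz[OF M] det_nz_if_left_inverse[OF sq(1)[of a]] by (simp add: X_def det_mul)
  ultimately have "det M = e\<^sup>2" by (simp add: det_smat power2_eq_square)
  with e show "\<exists>e. M ** C ** transpose M = smat e C \<and> det M = e\<^sup>2" by blast
qed

text \<open>Orthonormal bases of \<open>U\<close> and of its complement together have at most six
  members, so when \<open>U\<close> has more than three, the complement has at most two. The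
  argument \<open>low\<close> is stated for an arbitrary stable space so that it serves
  both.\<close>

theorem stable_cases:
  assumes U: "stable U" "U \<noteq> {0}" "U \<noteq> {A. skew A}"
  obtains (symplectic) \<omega> where "skew \<omega>" "det \<omega> \<noteq> 0" "\<And>M. M \<in> \<M> \<Longrightarrow> \<exists>c. M ** \<omega> ** transpose M = smat c \<omega>"
  | (self_twist) J where "det J \<noteq> 0" "\<And>M. M \<in> \<M> \<Longrightarrow> J ** M = M ** J \<or> J ** M = - (M ** J)"
      "\<exists>M\<in>\<M>. J ** M \<noteq> M ** J"
  | (orthogonal) C where "transpose C = C" "det C \<noteq> 0"
      "\<And>M. M \<in> \<M> \<Longrightarrow> \<exists>c. M ** C ** transpose M = smat c C \<and> det M = c\<^sup>2"
proof -
  have low: thesis if V: "stable V" and on: "pf.orthonormal u n" and u: "\<And>i. i < n \<Longrightarrow> u i \<in> V"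
    and dec: "\<And>x. x \<in> V \<Longrightarrow> x = (\<Sum>i<n. smat (pfaff2 x (u i) / 2) (u i))" and n: "n = 1 \<or> n = 2 \<or> n = 3"
    for V and u :: "nat \<Rightarrow> 'k^4^4" and n
  proof -
    have sk: "skew (u i)" if "i < n" for i using V u[OF that] by (simp only: stable_def)
    note cl = orthonormal_clifford[OF on sk]
    have sq: "u i ** star (u i) = mat 1" "star (u i) ** u i = mat 1" if "i < n" for i
      using cl(1,2)[OF _ that that] by simp_all
    have orth: "pfaff2 (u i) (u j) = 0" if "i < n" "j < n" "i \<noteq> j" for i j
      using on that two by (auto simp: pf.orthonormal_def)
    have V_span: "V \<subseteq> mat.span (u ` {..<n})"
    proof
      fix x assume "x \<in> V"
      from dec[OF this] show "x \<in> mat.span (u ` {..<n})"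
        by (metis (no_types, lifting) imageI mat.span_base mat.span_scale mat.span_sum)
    qed
    from n show thesis
    proof (elim disjE)
      assume n: "n = 1"
      have "V \<subseteq> range (\<lambda>c. smat c (u 0))"
      proof
        fix x assume "x \<in> V"
        from dec[OF this] show "x \<in> range (\<lambda>c. smat c (u 0))"
          unfolding n by (intro range_eqI) simp
      qed
      from stable_dim_1[OF V u sq(1) this] n show thesis
        by (intro symplectic[of "u 0"]) simp_all
    next
      assume n: "n = 2"
      have "V \<subseteq> mat.span {u 0, u 1}"
        using V_span by (simp add: n lessThan_nat_numeral lessThan_Suc numeral_2_eq_2 insert_commute)
      from stable_dim_2[OF V u u this sq(1) sq(1) sq(2) sq(2) cl(3)[of 1 0] cl(4)[of 1 0] orth] n
      show thesis by (intro self_twist[of "u 0 ** star (u 1)"]) simp_all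
    next
      assume n: "n = 3"
      have "V \<subseteq> mat.span {u 0, u 1, u 2}"
        using V_span by (simp add: n lessThan_Suc numeral_3_eq_3 numeral_2_eq_2 insert_commute)
      moreover have "x ** star x = mat 1" "star x ** x = mat 1" if "x \<in> {u 0, u 1, u 2}" for x
        using that sq n by auto
      ultimately show thesis
        using stable_dim_3[OF V u u u _ _ _ orth orth orth, of 0 1 2] n
        by (intro orthogonal[of "u 0 ** star (u 1) ** u 2"]) simp_all
    qed
  qed
  obtain u n where u': "pf.orthonormal u n" "\<forall>i<n. u i \<in> U"
    "\<forall>x\<in>U. x = (\<Sum>i<n. smat (pfaff2 x (u i) / 2) (u i))"
    by (rule stable_orthonormal_basis[OF U(1)])
  note u = u'(1) u'(2,3)[rule_format]
  have subU: "mat.subspace U" and skU: "\<And>A. A \<in> U \<Longrightarrow> skew A" using U(1) by (simp_all only: stable_def)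
  show thesis
  proof (cases "n \<le> 3")
    case True
    have "n \<noteq> 0"
    proof
      assume "n = 0"
      then have "x = 0" if "x \<in> U" for x using u(3)[OF that] by simp
      with U(2) mat.subspace_0[OF subU] show False by blast
    qed
    with True have "n = 1 \<or> n = 2 \<or> n = 3" by linarith
    with low[OF U(1) u] show thesis by blast
  next
    case False
    define P where "P = {A. skew A \<and> (\<forall>B\<in>U. pfaff2 A B = 0)}"
    have P: "stable P" unfolding P_def by (rule stable_perp[OF U(1)])
  obtain v m where v': "pf.orthonormal v m" "\<forall>i<m. v i \<in> P"
      "\<forall>x\<in>P. x = (\<Sum>i<m. smat (pfaff2 x (v i) / 2) (v i))"
      by (rule stable_orthonormal_basis[OF P])
    note v = v'(1) v'(2,3)[rule_format]
    have "pfaff2 (u i) (v j) / 2 = 0" if "i < n" "j < m" for i j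
      using u(2)[OF that(1)] v(2)[OF that(2)] pfaff2_sym[of "u i" "v j"] by (simp add: P_def)
    then have on: "pf.orthonormal (\<lambda>i. if i < n then u i else v (i - n)) (n + m)"
      by (rule pf.orthonormal_append[OF u(1) v(1)])
    let ?F = "set [skew_unit 1 2, skew_unit 1 3, skew_unit 1 4, skew_unit 2 3,
      skew_unit 2 4, skew_unit 3 4 :: 'k^4^4]"
    have "n + m \<le> card ?F"
    proof (rule pf.orthonormal_length[OF on finite_set])
      fix i assume "i < n + m"
      then have "skew (if i < n then u i else v (i - n))"
        using u(2)[of i] v(2)[of "i - n"] skU by (simp add: P_def)
      then show "(if i < n then u i else v (i - n)) \<in> mat.span ?F" using skew_span by blast
    qed
    also have "\<dots> \<le> 6" by (rule order.trans[OF card_length]) simp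
    finally have "m \<le> 2" using False by simp
    moreover have "m \<noteq> 0"
    proof
      assume m: "m = 0"
      then have P0: "x = 0" if "x \<in> P" for x using v(3)[OF that] by simp
      \<comment> \<open>If the complement vanished, subtracting from \<open>x\<close> its orthogonal
        projection \<open>y\<close> to \<open>U\<close> would leave zero, so \<open>U\<close> would
        contain every skew matrix.\<close>
      have "x \<in> U" if x: "skew x" for x
      proof -
        define y where "y = (\<Sum>i<n. smat (pfaff2 x (u i) / 2) (u i))"
        have yU: "y \<in> U" unfolding y_def using u(2) subU
          by (intro mat.subspace_sum mat.subspace_scale) simp_all
        have yu: "pfaff2 y (u i) / 2 = pfaff2 x (u i) / 2" if "i < n" for i
          unfolding y_def by (rule pf.orthonormal_coeff[OF u(1) that])
        have "pfaff2 (x - y) z / 2 = 0" if "z \<in> U" for z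
        proof -
          have "pfaff2 (x - y) (u i) / 2 = 0" if "i < n" for i
            using yu[OF that] by (simp only: pf.diff_left right_minus_eq)
          then have *: "pfaff2 (u i) (x - y) / 2 = 0" if "i < n" for i
            using that pfaff2_sym[of "u i" "x - y"] by simp
          have "pfaff2 z (x - y) / 2 = pfaff2 (\<Sum>i<n. smat (pfaff2 z (u i) / 2) (u i)) (x - y) / 2"
            using u(3)[OF that] by simp
          also have "\<dots> = 0"
            unfolding pf.sum_left pf.scale_left by (intro sum.neutral ballI) (simp only: * lessThan_iff mult_zero_right)
          finally show ?thesis by (simp only: pfaff2_sym[of "x - y" z])
        qed
        then have "x - y \<in> P" using x skU[OF yU] two by (simp add: P_def skew_diff)
        then have "x - y = 0" by (rule P0)
        then have "x = y" by simp
        with yU show "x \<in> U" by simp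
      qed
      with skU U(3) show False by blast
    qed
    ultimately have "m = 1 \<or> m = 2 \<or> m = 3" by linarith
    with low[OF P v] show thesis by blast
  qed
qed

end

section \<open>Curves of similitudes\<close>

text \<open>A matrix over \<open>k[t]\<close> with \<open>\<Gamma> \<Gamma>\<^sup>T = c\<close> specializes to a similitude wherever \<open>c(t) \<noteq> 0\<close>, in
  particular at the two ends.\<close>

definition joined :: "'k::field^'n^'n \<Rightarrow> 'k^'n^'n \<Rightarrow> bool"
  where "joined A B \<longleftrightarrow> (\<exists>(\<Gamma> :: 'k poly^'n^'n) c. \<Gamma> ** transpose \<Gamma> = mat c \<and> poly c 0 \<noteq> 0 \<and> poly c 1 \<noteq> 0 \<and>
    (\<chi> i j. poly (\<Gamma>$i$j) 0) = A \<and> (\<chi> i j. poly (\<Gamma>$i$j) 1) = B)"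

lemma poly_matrix_mult:
  "(\<chi> i j. poly ((X ** Y)$i$j) t) = (\<chi> i j. poly (X$i$j) t) ** (\<chi> i j. poly (Y$i$j) t)"
  for X :: "'k::comm_ring_1 poly^'n^'m" and Y :: "'k poly^'l^'n"
  by (simp add: vec_eq_iff matrix_mult_nth poly_sum)

lemma joined_mult:
  assumes "joined A B" "joined A' B'"
  shows "joined (A ** A') (B ** B')"
proof -
  obtain X c where X: "X ** transpose X = mat c" "poly c 0 \<noteq> 0" "poly c 1 \<noteq> 0"
    "(\<chi> i j. poly (X$i$j) 0) = A" "(\<chi> i j. poly (X$i$j) 1) = B"
    using assms(1) unfolding joined_def by auto
  obtain Y d where Y: "Y ** transpose Y = mat d" "poly d 0 \<noteq> 0" "poly d 1 \<noteq> 0"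
    "(\<chi> i j. poly (Y$i$j) 0) = A'" "(\<chi> i j. poly (Y$i$j) 1) = B'"
    using assms(2) unfolding joined_def by auto
  have "(X ** Y) ** transpose (X ** Y) = X ** (Y ** transpose Y) ** transpose X"
    by (simp only: matrix_transpose_mul matrix_mul_assoc)
  also have "\<dots> = smat d (mat c)" by (simp add: X(1) Y(1))
  also have "\<dots> = mat (d * c)" by (auto simp: vec_eq_iff mat_def)
  finally show ?thesis
    unfolding joined_def using X Y
    by (intro exI[of _ "X ** Y"] exI[of _ "d * c"]) (simp add: poly_matrix_mult)
qed

text \<open>The reflection in the hyperplane orthogonal to \<open>a\<close>, multiplied by
  \<open>scalar_product a a\<close>. Without a denominator it also makes sense over k[t], where the
  vector can move along a curve.\<close>

definition refl_matrix :: "'k::comm_ring_1^'n \<Rightarrow> 'k^'n^'n"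
  where "refl_matrix a = (\<chi> i j. (if i = j then scalar_product a a else 0) - 2 * a$i * a$j)"

lemma transpose_refl_matrix: "transpose (refl_matrix a) = refl_matrix a"
  by (auto simp: refl_matrix_def transpose_def vec_eq_iff)

lemma refl_matrix_square: "refl_matrix a ** refl_matrix a = mat ((scalar_product a a)\<^sup>2)"
proof -
  have "(\<Sum>k\<in>UNIV. ((if i = k then q else 0) - 2 * a$i * a$k) * ((if k = j then q else 0) - 2 * a$k * a$j))
     = (if i = j then q\<^sup>2 else 0) - 4 * q * a$i * a$j + 4 * a$i * a$j * (\<Sum>k\<in>UNIV. a$k * a$k)" for i j q
  proof -
    have "(\<Sum>k\<in>UNIV. ((if i = k then q else 0) - 2 * a$i * a$k) * ((if k = j then q else 0) - 2 * a$k * a$j))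
      = (\<Sum>k\<in>UNIV. (if i = k then q * ((if k = j then q else 0) - 2 * a$k * a$j) else 0)
         - (if k = j then 2 * a$i * a$k * q else 0) + 4 * a$i * a$j * (a$k * a$k))"
      by (intro sum.cong) (auto simp: algebra_simps)
    then show ?thesis
      by (simp add: sum.distrib sum_subtractf sum_distrib_left power2_eq_square algebra_simps)
  qed
  from this[of _ "scalar_product a a"] show ?thesis
    by (simp add: vec_eq_iff matrix_mult_nth refl_matrix_def mat_def)
      (simp add: scalar_product_def algebra_simps)
qed

lemma refl_matrix_vec: "refl_matrix a *v x = scalar_product a a *s x - (2 * scalar_product a x) *s a"
proof -
  have "(refl_matrix a *v x) $ i = (\<Sum>k\<in>UNIV. (if i = k then scalar_product a a * x$k else 0) - 2 * a$i * (a$k * x$k))" for i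
    unfolding matrix_vector_mult_def refl_matrix_def vec_lambda_beta
    by (intro sum.cong) (auto simp: algebra_simps)
  then show ?thesis
    by (simp add: vec_eq_iff sum_subtractf scalar_product_def sum_distrib_left algebra_simps)
qed

text \<open>The vector moves along the straight line from \<open>a\<close> to \<open>b\<close>.
  Points where it becomes isotropic do no harm, as \<open>joined\<close> asks for a nonzero
  multiplier at the two ends.\<close>

lemma joined_refl:
  fixes a b :: "'k::field^'n"
  assumes "scalar_product a a \<noteq> 0" "scalar_product b b \<noteq> 0"
  shows "joined (refl_matrix a) (refl_matrix b)"
proof -
  define v :: "'k poly^'n" where "v = (\<chi> i. [:a$i, b$i - a$i:])"
  have sp: "poly (scalar_product v v) t = scalar_product (\<chi> i. poly (v$i) t) (\<chi> i. poly (v$i) t)" for t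
    by (simp add: scalar_product_def poly_sum)
  have r: "(\<chi> i j. poly (refl_matrix v $ i $ j) t) = refl_matrix (\<chi> i. poly (v$i) t)" for t
    by (auto simp: refl_matrix_def vec_eq_iff sp)
  have v: "(\<chi> i. poly (v$i) 0) = a" "(\<chi> i. poly (v$i) 1) = b"
    by (simp_all add: v_def vec_eq_iff)
  show ?thesis
    unfolding joined_def
    by (rule exI[of _ "refl_matrix v"], rule exI[of _ "(scalar_product v v)\<^sup>2"])
      (simp add: transpose_refl_matrix refl_matrix_square r sp v assms)
qed

lemma joined_smat:
  assumes "c \<noteq> 0"
  shows "joined (smat c (mat 1 :: 'k::field^'n^'n)) (mat 1)"
  unfolding joined_def
proof (intro exI conjI)
  show "mat [:c, 1 - c:] ** transpose (mat [:c, 1 - c:]) = (mat ([:c, 1 - c:]\<^sup>2) :: 'k poly^'n^'n)"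
    by (simp only: transpose_mat matrix_mult_simps) (auto simp: vec_eq_iff mat_def power2_eq_square)
qed (use assms in \<open>simp_all add: vec_eq_iff mat_def\<close>)

text \<open>In the domain \<open>k[t]\<close>, \<open>(det \<Gamma>)\<^sup>2 = c\<^sup>4\<close> forces \<open>det \<Gamma> = c\<^sup>2\<close> or \<open>det \<Gamma> = - c\<^sup>2\<close>, so the sign is
  constant along the curve.\<close>

lemma joined_det:
  fixes A B :: "'k::alg_closed_field^4^4"
  assumes two: "(2 :: 'k) \<noteq> 0" and "joined A B" "A ** transpose A = mat a" "det A = a\<^sup>2"
  obtains b where "B ** transpose B = mat b" "b \<noteq> 0" "det B = b\<^sup>2"
proof -
  obtain \<Gamma> c where \<Gamma>: "\<Gamma> ** transpose \<Gamma> = mat c" "poly c 0 \<noteq> 0" "poly c 1 \<noteq> 0"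
    "(\<chi> i j. poly (\<Gamma>$i$j) 0) = A" "(\<chi> i j. poly (\<Gamma>$i$j) 1) = B"
    using assms(2) unfolding joined_def by auto
  have ev: "(\<chi> i j. poly (\<Gamma>$i$j) t) ** transpose (\<chi> i j. poly (\<Gamma>$i$j) t) = mat (poly c t)" for t
  proof -
    have "transpose (\<chi> i j. poly (\<Gamma>$i$j) t) = (\<chi> i j. poly (transpose \<Gamma>$i$j) t)"
      by (simp add: vec_eq_iff transpose_def)
    then show ?thesis
      by (simp flip: poly_matrix_mult add: \<Gamma>(1)) (simp add: vec_eq_iff mat_def)
  qed
  have "det \<Gamma> * det \<Gamma> = det (mat c :: 'k poly^4^4)"
    unfolding \<Gamma>(1)[symmetric] by (simp add: det_mul)
  also have "\<dots> = c ^ 4"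
    by (simp add: det_4 mat_def power4_eq_xxxx)
  finally have "(det \<Gamma> - c\<^sup>2) * (det \<Gamma> + c\<^sup>2) = 0"
    by (simp add: algebra_simps power2_eq_square power4_eq_xxxx)
  then have "det \<Gamma> = c\<^sup>2 \<or> det \<Gamma> = - c\<^sup>2" by (auto simp: eq_neg_iff_add_eq_0)
  moreover have "poly c 0 = a" using ev[of 0] assms(3) by (simp add: \<Gamma>(4) mat_eq_iff)
  moreover have "poly (det \<Gamma>) 0 = det A" by (simp add: poly_det \<Gamma>(4))
  ultimately have "det \<Gamma> = c\<^sup>2"
  proof (elim disjE)
    assume *: "det \<Gamma> = - c\<^sup>2" "poly c 0 = a" "poly (det \<Gamma>) 0 = det A"
    then have "2 * (poly c 0)\<^sup>2 = 0" using assms(4) by simp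
    with two \<Gamma>(2) show ?thesis by simp
  qed
  then have "poly (det \<Gamma>) 1 = (poly c 1)\<^sup>2" by simp
  then have "det B = (poly c 1)\<^sup>2" by (simp add: poly_det \<Gamma>(5))
  with ev[of 1] \<Gamma>(3) show ?thesis by (intro that[of "poly c 1"]) (simp_all add: \<Gamma>(5))
qed

section \<open>Generation by reflections, up to polynomial curves\<close>

definition std_refl :: "'k::comm_ring_1^4^4"
  where "std_refl = refl_matrix (axis 1 1)"

lemma scalar_product_axis: "scalar_product (axis i 1) x = x $ i" "scalar_product x (axis i 1) = x $ i"
  for x :: "'k::comm_ring_1^'n"
  by (simp_all add: scalar_product_def axis_def if_distrib[of "\<lambda>u. u * _"] if_distrib[of "(*) _"]
      cong: if_cong)

lemma scalar_product_diff:
  fixes x :: "'k::comm_ring_1^'n"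
  shows "scalar_product (y - z) x = scalar_product y x - scalar_product z x"
    "scalar_product x (y - z) = scalar_product x y - scalar_product x z"
    "scalar_product x (- y) = - scalar_product x y"
  by (simp_all add: scalar_product_def algebra_simps sum_subtractf sum_negf)

lemma scalar_product_mult: "scalar_product (M *v x) (M *v y) = scalar_product ((transpose M ** M) *v x) y"
  for M :: "'k::comm_ring_1^4^4"
  by (simp add: scalar_product_def matrix_vector_mult_def transpose_def sum_4 algebra_simps matrix_mult_nth)

lemma std_refl_square: "std_refl ** std_refl = mat 1"
  by (simp add: std_refl_def refl_matrix_square scalar_product_axis)

lemma det_std_refl: "det std_refl = (- 1 :: 'k::comm_ring_1)"
  by (simp add: std_refl_def refl_matrix_def det_4 scalar_product_axis) (simp add: axis_def)

text \<open>\<open>std_refl\<close> represents the improper similitudes. Since \<open>joined\<close>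
  is multiplicative and \<open>std_refl\<close> is an involution, the property passes to products,
  so it can be checked on generators.\<close>

definition reflected :: "'k::field^4^4 \<Rightarrow> bool"
  where "reflected A \<longleftrightarrow> joined A (mat 1) \<or> joined A std_refl"

lemma reflected_mult: "reflected A \<Longrightarrow> reflected B \<Longrightarrow> reflected (A ** B)"
  unfolding reflected_def
  using joined_mult[of A "mat 1" B "mat 1"] joined_mult[of A "mat 1" B std_refl]
    joined_mult[of A std_refl B "mat 1"] joined_mult[of A std_refl B std_refl]
  by (auto simp: std_refl_square)

lemma reflected_smat: "c \<noteq> 0 \<Longrightarrow> reflected (smat c (mat 1))"
  by (simp add: reflected_def joined_smat)

lemma reflected_refl: "scalar_product a a \<noteq> 0 \<Longrightarrow> reflected (refl_matrix a)"
  unfolding reflected_def std_refl_def by (intro disjI2 joined_refl) (simp_all add: scalar_product_axis)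

lemma reflected_refl_normalized:
  assumes "scalar_product a a \<noteq> 0"
  shows "reflected (smat (1 / scalar_product a a) (refl_matrix a))"
  using reflected_mult[OF reflected_smat reflected_refl[OF assms], of "1 / scalar_product a a"] assms
  by simp

lemma refl_matrix_normalized_square:
  fixes a :: "'k::field^'n"
  assumes "scalar_product a a \<noteq> 0"
  defines "R \<equiv> smat (1 / scalar_product a a) (refl_matrix a)"
  shows "R ** R = mat 1"
proof -
  have "R ** R = smat (1 / scalar_product a a * (1 / scalar_product a a)) (mat ((scalar_product a a)\<^sup>2))"
    by (simp only: R_def smat_simps refl_matrix_square)
  also have "\<dots> = mat 1" using assms(1) by (simp add: vec_eq_iff mat_def power2_eq_square)
  finally show ?thesis .
qed

lemma neq_0_if_sum_neq_0: "a + b \<noteq> 0 \<Longrightarrow> a \<noteq> 0 \<or> b \<noteq> (0 :: 'a::comm_monoid_add)"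
  by auto

text \<open>Cartan--Dieudonne: for a unit vector \<open>e\<close>, one of \<open>N e - e\<close> and \<open>N e + e\<close> is anisotropic, so
  at most two reflections move \<open>N e\<close> back to \<open>e\<close>.\<close>

lemma reflected_step:
  fixes N :: "'k::field^4^4"
  assumes two: "(2 :: 'k) \<noteq> 0" and N: "transpose N ** N = mat 1"
  obtains R S where "R ** S = mat 1" "transpose R ** R = mat 1" "reflected S"
    "R *v (N *v axis i 1) = axis i 1"
    "\<And>j. j \<noteq> i \<Longrightarrow> N *v axis j 1 = axis j 1 \<Longrightarrow> R *v axis j 1 = axis j 1"
proof -
  define e :: "'k^4" where "e = axis i 1"
  define y where "y = N *v e"
  have ee: "scalar_product e e = 1" by (simp add: e_def scalar_product_axis)
  have yy: "scalar_product y y = 1" unfolding y_def scalar_product_mult N by (simp add: ee)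
  have comm: "scalar_product x z = scalar_product z x" for x z :: "'k^4"
    by (simp add: scalar_product_def mult.commute)
  have ye: "scalar_product y e = scalar_product e y" by (rule comm)
  define \<rho> where "\<rho> a = smat (1 / scalar_product a a) (refl_matrix a)" for a :: "'k^4"
  have \<rho>: "\<rho> a ** \<rho> a = mat 1" "transpose (\<rho> a) = \<rho> a" "reflected (\<rho> a)"
    if "scalar_product a a \<noteq> 0" for a
    using refl_matrix_normalized_square[OF that] reflected_refl_normalized[OF that]
    by (simp_all add: \<rho>_def transpose_refl_matrix)
  have fix_orth: "\<rho> a *v x = x" if "scalar_product a a \<noteq> 0" "scalar_product a x = 0" for a x
    using that by (simp add: \<rho>_def refl_matrix_vec)
  have yj: "scalar_product y (axis j 1) = 0" "scalar_product e (axis j 1) = 0"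
    if "j \<noteq> i" "N *v axis j 1 = axis j 1" for j
  proof -
    show 0: "scalar_product e (axis j 1) = 0"
      using that(1) by (simp add: e_def scalar_product_axis) (simp add: axis_def)
    have "scalar_product y (N *v axis j 1) = 0"
      unfolding y_def scalar_product_mult N by (simp add: 0)
    then show "scalar_product y (axis j 1) = 0" by (simp only: that(2))
  qed
  \<comment> \<open>Both \<open>y - e\<close> and \<open>y + e\<close> satisfy the condition on
    \<open>a\<close>, because \<open>y\<close> and \<open>e\<close> are unit vectors.\<close>
  have map: "\<rho> a *v y = y - a" if "scalar_product a a \<noteq> 0" "2 * scalar_product a y = scalar_product a a" for a
  proof -
    have "\<rho> a *v y = (1 / scalar_product a a) *s (scalar_product a a *s y - scalar_product a a *s a)"
      by (simp add: \<rho>_def refl_matrix_vec that(2))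
    also have "\<dots> = y - a" using that(1) by (simp add: vec_eq_iff field_simps)
    finally show ?thesis .
  qed
  define m p where "m = y - e" and "p = y + e"
  have mm: "scalar_product m m = 2 - 2 * scalar_product e y" "scalar_product m y = 1 - scalar_product e y"
    and pp: "scalar_product p p = 2 + 2 * scalar_product e y" "scalar_product p y = 1 + scalar_product e y"
    by (simp_all add: m_def p_def scalar_product_simps scalar_product_diff yy ee ye)
  \<comment> \<open>The parallelogram law for two unit vectors; 4 is nonzero, so \<open>m\<close>
    and \<open>p\<close> cannot both be isotropic.\<close>
  have "scalar_product m m + scalar_product p p = 2 * 2" by (simp add: mm pp)
  with two have "scalar_product m m + scalar_product p p \<noteq> 0" by (metis mult_eq_0_iff)
  from neq_0_if_sum_neq_0[OF this] show ?thesis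
  proof
    assume nz: "scalar_product m m \<noteq> 0"
    have "\<rho> m *v y = e" using map[OF nz] by (simp add: mm right_diff_distrib) (simp add: m_def vec_eq_iff)
    moreover have "\<rho> m *v axis j 1 = axis j 1" if "j \<noteq> i" "N *v axis j 1 = axis j 1" for j
      using yj[OF that] by (intro fix_orth[OF nz]) (simp add: m_def scalar_product_diff)
    ultimately show ?thesis
      using \<rho>[OF nz] by (intro that[of "\<rho> m" "\<rho> m"]) (simp_all add: y_def e_def)
  next
    assume nz: "scalar_product p p \<noteq> 0"
    have en: "scalar_product e e \<noteq> 0" by (simp add: ee)
    have "\<rho> p *v y = y - p" using map[OF nz] by (simp add: pp distrib_left)
    \<comment> \<open>Reflecting in \<open>p\<close> overshoots to the negative of \<open>e\<close>,
      and the reflection in \<open>e\<close> corrects the sign; it fixes the other basis vectors,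
      which are orthogonal to \<open>e\<close>.\<close>
    then have 1: "\<rho> p *v y = (- 1) *s e" by (simp add: p_def vec_eq_iff)
    have 2: "\<rho> e *v ((- 1) *s e) = e"
      by (simp add: \<rho>_def refl_matrix_vec ee scalar_product_simps scalar_product_diff) (simp add: vec_eq_iff scalar_product_diff ee)
    show ?thesis
    proof (rule that[of "\<rho> e ** \<rho> p" "\<rho> p ** \<rho> e"])
      have "\<rho> e ** \<rho> p ** (\<rho> p ** \<rho> e) = \<rho> e ** (\<rho> p ** \<rho> p) ** \<rho> e"
        by (simp only: matrix_mul_assoc)
      then show "\<rho> e ** \<rho> p ** (\<rho> p ** \<rho> e) = mat 1" by (simp add: \<rho>[OF nz] \<rho>[OF en])
      have "transpose (\<rho> e ** \<rho> p) ** (\<rho> e ** \<rho> p) = \<rho> p ** (\<rho> e ** \<rho> e) ** \<rho> p"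
        by (simp only: matrix_mul_assoc matrix_transpose_mul \<rho>(2)[OF nz] \<rho>(2)[OF en])
      then show "transpose (\<rho> e ** \<rho> p) ** (\<rho> e ** \<rho> p) = mat 1" by (simp add: \<rho>[OF nz] \<rho>[OF en])
      show "reflected (\<rho> p ** \<rho> e)" using \<rho>[OF nz] \<rho>[OF en] by (intro reflected_mult)
      show "(\<rho> e ** \<rho> p) *v (N *v axis i 1) = axis i 1"
        using 1 2 by (simp only: y_def e_def matrix_vector_mul_assoc[symmetric])
      show "(\<rho> e ** \<rho> p) *v axis j 1 = axis j 1" if "j \<noteq> i" "N *v axis j 1 = axis j 1" for j
        using fix_orth[OF nz] fix_orth[OF en] yj[OF that]
        by (simp add: p_def scalar_product_simps flip: matrix_vector_mul_assoc)
    qed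
  qed
qed

text \<open>Induction on a set \<open>J\<close> of indices outside which \<open>N\<close> fixes the
  standard basis vectors: \<open>reflected_step\<close> makes one more of them fixed without
  disturbing the others, until only the identity is left.\<close>

lemma orthogonal_reflected:
  fixes N :: "'k::field^4^4"
  assumes two: "(2 :: 'k) \<noteq> 0" and N: "transpose N ** N = mat 1"
  shows "reflected N"
proof -
  have "reflected N" if "finite J" "\<And>j. j \<notin> J \<Longrightarrow> N *v axis j 1 = axis j 1" "transpose N ** N = mat 1"
    for J and N :: "'k^4^4"
    using that
  proof (induction J arbitrary: N rule: finite_induct)
    case empty
    then have "N $ i $ j = mat 1 $ i $ j" for i j
    proof -
      have "N $ i $ j = (N *v axis j 1) $ i" by (simp add: matrix_vector_mult_def axis_def if_distrib[of "(*) _"] cong: if_cong)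
      also have "\<dots> = axis j 1 $ i" using empty(1)[of j] by simp
      finally show ?thesis by (simp add: axis_def mat_def)
    qed
    then have "N = smat 1 (mat 1)" by (simp add: vec_eq_iff)
    moreover have "reflected (smat 1 (mat 1))" by (rule reflected_smat) simp
    ultimately show ?case by (simp only:)
  next
    case (insert i J)
    obtain R S where RS: "R ** S = mat 1" "transpose R ** R = mat 1" "reflected S"
      "R *v (N *v axis i 1) = axis i 1"
      "\<And>j. j \<noteq> i \<Longrightarrow> N *v axis j 1 = axis j 1 \<Longrightarrow> R *v axis j 1 = axis j 1"
      using reflected_step[OF two insert.prems(2), of i] by metis
    have "reflected (R ** N)"
    proof (rule insert.IH)
      fix j assume j: "j \<notin> J"
      show "(R ** N) *v axis j 1 = axis j 1"
      proof (cases "j = i")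
        case True
        then show ?thesis using RS(4) by (simp add: matrix_vector_mul_assoc)
      next
        case False
        then have "N *v axis j 1 = axis j 1" using insert.prems(1)[of j] j by simp
        then show ?thesis using RS(5)[OF False] by (simp flip: matrix_vector_mul_assoc)
      qed
    next
      have "transpose (R ** N) ** (R ** N) = transpose N ** (transpose R ** R) ** N"
        by (simp only: matrix_mul_assoc matrix_transpose_mul)
      then show "transpose (R ** N) ** (R ** N) = mat 1" by (simp add: RS(2) insert.prems(2))
    qed
    from reflected_mult[OF RS(3) this] have "reflected (S ** R ** N)" by (simp only: matrix_mul_assoc)
    moreover have "S ** R = mat 1" using RS(1) by (simp only: matrix_left_right_inverse)
    ultimately show ?case by simp
  qed
  from this[of UNIV N] N show ?thesis by simp
qed

text \<open>Dividing by a square root of \<open>c\<close> makes \<open>M\<close> orthogonal, so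
  \<open>M\<close> is joined to the identity or to \<open>std_refl\<close>. By
  \<open>joined_det\<close> the sign of the determinant persists along a curve, and
  \<open>std_refl\<close> has multiplier 1 but determinant -1.\<close>

theorem proper_similitude_joined:
  fixes M :: "'k::alg_closed_field^4^4"
  assumes two: "(2 :: 'k) \<noteq> 0" and M: "M ** transpose M = mat c" "c \<noteq> 0" "det M = c\<^sup>2"
  shows "joined M (mat 1)"
proof -
  obtain s where s: "s ^ 2 = c" using nth_root_exists[of 2 c] by auto
  with M(2) have s0: "s \<noteq> 0" by auto
  define N where "N = smat (1 / s) M"
  have "N ** transpose N = smat (1 / s * (1 / s)) (mat c)"
    by (simp only: N_def smat_simps M(1))
  also have "\<dots> = mat 1" using s0 by (auto simp: vec_eq_iff mat_def power2_eq_square simp flip: s)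
  finally have "transpose N ** N = mat 1" by (simp only: matrix_left_right_inverse)
  then have "reflected (smat s (mat 1) ** N)"
    by (intro reflected_mult reflected_smat s0 orthogonal_reflected two)
  then have "reflected M" using s0 by (simp add: N_def)
  moreover have "\<not> joined M std_refl"
  proof
    assume "joined M std_refl"
    from joined_det[OF two this M(1,3)] obtain b
      where b: "(std_refl ** transpose std_refl :: 'k^4^4) = mat b" "det (std_refl :: 'k^4^4) = b\<^sup>2" by metis
    have "(mat 1 :: 'k^4^4) = mat b"
      using b(1) by (simp add: std_refl_def transpose_refl_matrix std_refl_square[unfolded std_refl_def])
    then have "b = 1" by (simp only: mat_eq_iff)
    with b(2) have "(- 1 :: 'k) = 1" by (simp add: det_std_refl)
    then have "(2 :: 'k) = 0" by (metis add.right_inverse one_add_one)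
    with two show False by simp
  qed
  ultimately show ?thesis by (simp add: reflected_def)
qed

section \<open>Coordinates\<close>

locale coordinates =
  fixes s :: "'k::field \<Rightarrow> 'v::ab_group_add \<Rightarrow> 'v" and \<kappa> :: "'k^4 \<Rightarrow> 'v"
  assumes vs: "vector_space s" and two: "(2 :: 'k) \<noteq> 0"
    and lin: "Vector_Spaces.linear (*s) s \<kappa>" and bij: "bij \<kappa>"
begin

definition coord :: "'v \<Rightarrow> 'k^4" where "coord = inv_into UNIV \<kappa>"

definition basis :: "4 \<Rightarrow> 'v" where "basis i = \<kappa> (axis i 1)"

definition mtx :: "('v \<Rightarrow> 'v) \<Rightarrow> 'k^4^4" where "mtx f = (\<chi> i j. coord (f (basis j)) $ i)"

text \<open>The tensor with coefficient matrix \<open>A\<close> in the chosen basis. The value zero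
  outside bilinear forms agrees with the convention of \<open>pure_tensor\<close>.\<close>

definition tens :: "'k^4^4 \<Rightarrow> ('k, 'v) tensor2"
  where "tens A = (\<lambda>B. if bilinear_form s B then \<Sum>i\<in>UNIV. \<Sum>j\<in>UNIV. A$i$j * B (basis i) (basis j) else 0)"

lemma coord_inverse [simp]: "coord (\<kappa> x) = x" "\<kappa> (coord v) = v"
  using bij by (simp_all add: coord_def bij_is_inj bij_is_surj surj_f_inv_f)

lemma \<kappa>_linear: "\<kappa> (x + y) = \<kappa> x + \<kappa> y" "\<kappa> (c *s x) = s c (\<kappa> x)"
  using lin by (simp_all add: linear_char)

lemma coord_linear: "coord (v + w) = coord v + coord w" "coord (s c v) = c *s coord v"
  by (metis \<kappa>_linear(1) coord_inverse) (metis \<kappa>_linear(2) coord_inverse)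

lemma coord_basis [simp]: "coord (basis i) = axis i 1"
  by (simp add: basis_def)

lemma linear_times: "Vector_Spaces.linear s (*) f \<longleftrightarrow>
    (\<forall>x y. f (x + y) = f x + f y) \<and> (\<forall>c x. f (s c x) = c * f x)"
  using vs vector_space_times by (auto simp: linear_char)

lemma vec_expand: "x = (\<Sum>i\<in>UNIV. x$i *s axis i 1)" for x :: "'k^4"
  by (simp add: vec_eq_iff axis_def if_distrib[of "(*) _"] cong: if_cong)

lemma \<kappa>_0: "\<kappa> 0 = 0"
  using \<kappa>_linear(1)[of 0 0] by simp

lemma coord_0: "coord 0 = 0"
  using coord_linear(1)[of 0 0] by simp

lemma \<kappa>_sum: "\<kappa> (sum f A) = (\<Sum>a\<in>A. \<kappa> (f a))"
  by (induction A rule: infinite_finite_induct) (simp_all add: \<kappa>_0 \<kappa>_linear)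

lemma basis_expand: "v = (\<Sum>i\<in>UNIV. s (coord v $ i) (basis i))"
proof -
  have "v = \<kappa> (\<Sum>i\<in>UNIV. coord v $ i *s axis i 1)" by (simp flip: vec_expand)
  then show ?thesis by (simp only: \<kappa>_sum \<kappa>_linear basis_def)
qed

lemma functional_expand:
  assumes "\<And>x y. f (x + y) = f x + f y" "\<And>c x. f (s c x) = c * (f x :: 'k)"
  shows "f v = (\<Sum>i\<in>UNIV. coord v $ i * f (basis i))"
proof -
  have "f 0 + f 0 = f 0 + 0" using assms(1)[of 0 0] by (simp only: add_0_right)
  then have "f 0 = 0" by (rule add_left_imp_eq)
  then have "f (sum g A) = (\<Sum>a\<in>A. f (g a))" for g and A :: "4 set"
    by (induction A rule: infinite_finite_induct) (simp_all add: assms)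
  then show ?thesis by (subst basis_expand) (simp only: assms)
qed

lemma mtx:
  assumes "Vector_Spaces.linear s s f"
  shows "coord (f v) = mtx f *v coord v"
proof -
  have "coord (f v) $ k = (\<Sum>i\<in>UNIV. coord v $ i * coord (f (basis i)) $ k)" for k
    using assms by (intro functional_expand) (simp_all add: linear_char coord_linear)
  then show ?thesis
    by (simp add: vec_eq_iff matrix_vector_mult_def mtx_def mult.commute)
qed

lemma mtx_\<kappa>:
  assumes "Vector_Spaces.linear s s f"
  shows "f (\<kappa> x) = \<kappa> (mtx f *v x)"
  using mtx[OF assms, of "\<kappa> x"] by (metis coord_inverse)

lemma matrix_eqI:
  fixes A B :: "'k^4^4"
  assumes "\<And>x. A *v x = B *v x"
  shows "A = B"
  by (rule matrix_eq[THEN iffD2]) (simp add: assms)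

lemma bilinear_form_simps:
  assumes "bilinear_form s B"
  shows "B (v + v') w = B v w + B v' w" "B v (w + w') = B v w + B v w'"
    "B (s c v) w = c * B v w" "B v (s c w) = c * B v w"
  using assms by (simp_all add: bilinear_form_def linear_times)

lemma bilinear_form_expand:
  assumes "bilinear_form s B"
  shows "B v w = (\<Sum>i\<in>UNIV. \<Sum>j\<in>UNIV. coord v $ i * coord w $ j * B (basis i) (basis j))"
proof -
  have "B v w = (\<Sum>i\<in>UNIV. coord v $ i * B (basis i) w)"
    by (rule functional_expand[of "\<lambda>v. B v w"]) (simp_all add: bilinear_form_simps[OF assms])
  also have "\<dots> = (\<Sum>i\<in>UNIV. coord v $ i * (\<Sum>j\<in>UNIV. coord w $ j * B (basis i) (basis j)))"
    by (subst functional_expand[of "\<lambda>w. B _ w" w]) (simp_all add: bilinear_form_simps[OF assms])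
  finally show ?thesis by (simp add: sum_distrib_left mult.assoc)
qed

lemma tens_linear: "tens (A + B) = tens A + tens B" "tens (smat c A) = fun_scale c (tens A)"
  by (auto simp: tens_def fun_scale_def fun_eq_iff algebra_simps sum.distrib sum_distrib_left)

lemma tens_0: "tens 0 = 0" using tens_linear(2)[of 0 0] by (simp add: fun_scale_def fun_eq_iff)

lemma tens_diff: "tens (A - B) = tens A - tens B"
  using tens_linear(1)[of "A - B" B] by simp

lemma tens_sum: "tens (sum f A) = (\<Sum>a\<in>A. tens (f a))"
  by (induction A rule: infinite_finite_induct) (simp_all add: tens_0 tens_linear)

definition outer :: "'k^4 \<Rightarrow> 'k^4 \<Rightarrow> 'k^4^4" where "outer x y = (\<chi> i j. x$i * y$j)"

lemma pure_tensor_tens: "pure_tensor s v w = tens (outer (coord v) (coord w))"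
  using bilinear_form_expand by (auto simp: pure_tensor_def tens_def outer_def fun_eq_iff)

lemma outer_expand: "A = (\<Sum>i\<in>UNIV. \<Sum>j\<in>UNIV. smat (A$i$j) (outer (axis i 1) (axis j 1)))"
  by (simp add: vec_eq_iff outer_def axis_def if_distrib[of "(*) _"] cong: if_cong)

lemma outer_congruence: "M ** outer x y ** transpose M = outer (M *v x) (M *v y)"
  by (simp add: vec_eq_iff outer_def matrix_mult_nth matrix_vector_mult_def transpose_def
      sum_distrib_left sum_distrib_right algebra_simps)

lemma congruence_sum: "M ** (sum f A) ** N = (\<Sum>a\<in>A. M ** f a ** N)" for M N :: "'k^4^4"
  by (induction A rule: infinite_finite_induct) (simp_all add: matrix_mult_distrib)

text \<open>The entries of \<open>A\<close> are recovered by evaluating \<open>tens A\<close> at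
  products of two coordinate functions, which are bilinear forms.\<close>

lemma tens_inj: "tens A = tens B \<longleftrightarrow> A = B"
proof
  assume eq: "tens A = tens B"
  have "A$i$j = B$i$j" for i j
  proof -
    let ?B = "\<lambda>v w. coord v $ i * coord w $ j"
    have B: "bilinear_form s ?B"
      by (simp add: bilinear_form_def linear_times coord_linear algebra_simps)
    have "tens A ?B = A$i$j" for A
    proof -
      have "tens A ?B = (\<Sum>k\<in>UNIV. \<Sum>l\<in>UNIV. if k = i then if l = j then A$k$l else 0 else 0)"
        using B by (auto simp: tens_def axis_def intro!: sum.cong)
      also have "\<dots> = (\<Sum>k\<in>UNIV. if k = i then (\<Sum>l\<in>UNIV. if l = j then A$k$l else 0) else 0)"
        by (intro sum.cong) auto
      finally show ?thesis by simp
    qed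
    with eq show ?thesis by metis
  qed
  then show "A = B" by (simp add: vec_eq_iff)
qed simp

lemma subspace_image_tens:
  assumes "mat.subspace U"
  shows "module.subspace fun_scale (tens ` U)"
proof -
  interpret T: vector_space "fun_scale :: 'k \<Rightarrow> ('k, 'v) tensor2 \<Rightarrow> _" by (rule vector_space_fun_scale)
  have U: "0 \<in> U" "\<And>x y. x \<in> U \<Longrightarrow> y \<in> U \<Longrightarrow> x + y \<in> U" "\<And>c x. x \<in> U \<Longrightarrow> smat c x \<in> U"
    using assms by (simp_all add: mat.subspace_def)
  show ?thesis unfolding T.subspace_def
  proof safe
    show "0 \<in> tens ` U" by (rule image_eqI[of _ _ 0]) (simp_all only: tens_0 U)
    show "tens x + tens y \<in> tens ` U" if "x \<in> U" "y \<in> U" for x y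
      by (rule image_eqI[of _ _ "x + y"]) (simp_all only: tens_linear U that)
    show "fun_scale c (tens x) \<in> tens ` U" if "x \<in> U" for c x
      by (rule image_eqI[of _ _ "smat c x"]) (simp_all only: tens_linear U that)
  qed
qed

lemma tens_pure_sum: "tens A = (\<Sum>i\<in>UNIV. \<Sum>j\<in>UNIV. fun_scale (A$i$j) (pure_tensor s (basis i) (basis j)))"
  by (subst outer_expand) (simp only: tens_sum tens_linear pure_tensor_tens coord_basis)

lemma skew_outer: "skew (outer x y - outer y x)"
  by (auto simp: skew_def outer_def vec_eq_iff transpose_def)

lemma exterior_square_tens: "exterior_square s = tens ` {A. skew A}"
proof -
  interpret T: vector_space "fun_scale :: 'k \<Rightarrow> ('k, 'v) tensor2 \<Rightarrow> _" by (rule vector_space_fun_scale)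
  show ?thesis
  proof
    show "exterior_square s \<subseteq> tens ` {A. skew A}"
      unfolding exterior_square_def
    proof (rule T.span_minimal)
      show "T.subspace (tens ` {A. skew A})" by (rule subspace_image_tens[OF subspace_skew])
      show "{pure_tensor s v w - pure_tensor s w v |v w. True} \<subseteq> tens ` {A. skew A}"
        using skew_outer by (auto simp: pure_tensor_tens simp flip: tens_diff)
    qed
    show "tens ` {A. skew A} \<subseteq> exterior_square s"
    proof safe
      fix A :: "'k^4^4" assume A: "skew A"
      have "2 * (A$i$j / 2) = A$i$j" for i j using two by simp
      \<comment> \<open>Antisymmetrizing each elementary matrix counts every entry of a skew matrix
        twice, whence the factor one half.\<close>
      then have "A = smat (1/2) (\<Sum>i\<in>UNIV. \<Sum>j\<in>UNIV. smat (A$i$j) (outer (axis i 1) (axis j 1) - outer (axis j 1) (axis i 1)))"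
        using two by (simp add: vec_eq_iff forall_4 sum_4 outer_def axis_def skew_4[OF A])
      from arg_cong[OF this, of tens] have "tens A = fun_scale (1/2) (\<Sum>i\<in>UNIV. \<Sum>j\<in>UNIV. fun_scale (A$i$j)
          (pure_tensor s (basis i) (basis j) - pure_tensor s (basis j) (basis i)))"
        by (simp only: tens_linear tens_sum tens_diff pure_tensor_tens coord_basis)
      moreover have "\<dots> \<in> exterior_square s"
        unfolding exterior_square_def
        by (intro T.span_scale T.span_sum T.span_base) blast
      ultimately show "tens A \<in> exterior_square s" by (simp only:)
    qed
  qed
qed

lemma tens_symmetric:
  assumes A: "transpose A = A"
  shows "tens A \<in> symmetric_square s"
proof -
  interpret T: vector_space "fun_scale :: 'k \<Rightarrow> ('k, 'v) tensor2 \<Rightarrow> _" by (rule vector_space_fun_scale)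
  have "A$j$i = A$i$j" for i j using arg_cong[OF A, of "\<lambda>A. A $ i $ j"] by (simp add: transpose_def)
  then have sym: "A$2$1 = A$1$2" "A$3$1 = A$1$3" "A$4$1 = A$1$4" "A$3$2 = A$2$3" "A$4$2 = A$2$4" "A$4$3 = A$3$4"
    by blast+
  have "A = smat (1/2) (\<Sum>i\<in>UNIV. \<Sum>j\<in>UNIV. smat (A$i$j) (outer (axis i 1) (axis j 1) + outer (axis j 1) (axis i 1)))"
    using two by (simp add: vec_eq_iff forall_4 sum_4 outer_def axis_def sym)
  from arg_cong[OF this, of tens] have "tens A = fun_scale (1/2) (\<Sum>i\<in>UNIV. \<Sum>j\<in>UNIV. fun_scale (A$i$j)
      (pure_tensor s (basis i) (basis j) + pure_tensor s (basis j) (basis i)))"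
    by (simp only: tens_linear tens_sum tens_diff pure_tensor_tens coord_basis)
  moreover have "\<dots> \<in> symmetric_square s"
    unfolding symmetric_square_def
    by (intro T.span_scale T.span_sum T.span_base) blast
  ultimately show ?thesis by (simp only:)
qed

end

lemma coordinates_exist:
  fixes s :: "'k::field \<Rightarrow> 'v::ab_group_add \<Rightarrow> 'v"
  assumes "vector_space s" "vector_space.dim s (UNIV :: 'v set) = 4"
  shows "\<exists>\<kappa>. Vector_Spaces.linear (*s) s \<kappa> \<and> bij (\<kappa> :: 'k^4 \<Rightarrow> 'v)"
proof -
  interpret V: vector_space s by fact
  obtain B where B: "V.independent B" "UNIV \<subseteq> V.span B" "card B = V.dim UNIV"
    by (rule V.basis_exists[of UNIV]) blast
  have card: "card B = CARD(4)" using B(3) assms(2) by simp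
  then have fin: "finite B" by (intro card_ge_0_finite) simp
  obtain h :: "4 \<Rightarrow> 'v" where h: "bij_betw h UNIV B"
    using finite_same_card_bij[OF finite_class.finite_UNIV fin] card by force
  have inj: "inj h" and img: "range h = B" using h by (auto simp: bij_betw_def)
  define \<kappa> where "\<kappa> x = (\<Sum>i\<in>UNIV. s (x$i) (h i))" for x :: "'k^4"
  have lin: "\<kappa> (x + y) = \<kappa> x + \<kappa> y" "\<kappa> (c *s x) = s c (\<kappa> x)" for x y c
    by (simp_all add: \<kappa>_def V.scale_left_distrib sum.distrib V.scale_sum_right)
  have "vector_space ((*s) :: 'k \<Rightarrow> 'k^4 \<Rightarrow> _)" by (rule vec.vector_space_axioms)
  then have L: "Vector_Spaces.linear (*s) s \<kappa>" using assms(1) lin by (simp add: linear_char)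
  have sumB: "(\<Sum>v\<in>B. s (f v) v) = \<kappa> (\<chi> i. f (h i))" for f
    unfolding \<kappa>_def img[symmetric] by (simp add: sum.reindex[OF inj])
  have "x = 0" if "\<kappa> x = 0" for x
  proof -
    have "(\<Sum>v\<in>B. s (x $ (inv_into UNIV h v)) v) = 0" using that by (simp add: sumB inv_f_f[OF inj])
    then have "x $ inv_into UNIV h v = 0" if "v \<in> B" for v
      using V.independentD[OF B(1) fin subset_refl, of "\<lambda>v. x $ inv_into UNIV h v"] that by blast
    then have "x $ i = 0" for i using img inv_f_f[OF inj, of i] by (metis rangeI)
    then show "x = 0" by (simp add: vec_eq_iff)
  qed
  then have "inj \<kappa>"
    by (intro injI) (metis diff_add_cancel lin(1) add_cancel_left_left right_minus_eq)
  moreover have "surj \<kappa>"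
  proof -
    have "v \<in> range \<kappa>" for v
    proof -
      have "v \<in> V.span B" using B(2) by auto
      then obtain f where "(\<Sum>w\<in>B. s (f w) w) = v" using V.span_finite[OF fin] by auto
      then show ?thesis by (simp add: sumB) (metis rangeI)
    qed
    then show ?thesis by blast
  qed
  ultimately show ?thesis using L by (intro exI[of _ \<kappa>]) (simp add: bij_def)
qed

section \<open>Reducibility criteria\<close>

lemma matrix_vector_scale: "A *v (c *s x) = c *s (A *v x)" for A :: "'k::comm_ring_1^'n^'m"
  by (simp add: vec_eq_iff matrix_vector_mult_def sum_distrib_left algebra_simps)

context irreducible_matrices
begin

lemma skew_unit_neq_0: "skew (skew_unit 1 2 :: 'k^4^4)" "skew_unit 1 2 \<noteq> (0 :: 'k^4^4)"
  "skew (skew_unit 3 4 :: 'k^4^4)" "skew_unit 3 4 \<notin> range (\<lambda>c. smat c (skew_unit 1 2 :: 'k^4^4))"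
proof -
  show "skew (skew_unit 1 2 :: 'k^4^4)" "skew (skew_unit 3 4 :: 'k^4^4)"
    by (auto simp: skew_def skew_unit_def vec_eq_iff transpose_def)
  have "skew_unit 1 2 $ 1 $ 2 = (1 :: 'k)" "skew_unit 3 4 $ 3 $ 4 = (1 :: 'k)" "skew_unit 1 2 $ 3 $ 4 = (0 :: 'k)"
    by (simp_all add: skew_unit_def)
  note nth = this
  show "skew_unit 1 2 \<noteq> (0 :: 'k^4^4)" using nth(1) by auto
  show "skew_unit 3 4 \<notin> range (\<lambda>c. smat c (skew_unit 1 2 :: 'k^4^4))"
  proof
    assume "skew_unit 3 4 \<in> range (\<lambda>c. smat c (skew_unit 1 2 :: 'k^4^4))"
    then obtain c where "skew_unit 3 4 = smat c (skew_unit 1 2 :: 'k^4^4)" by blast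
    then have "skew_unit 3 4 $ 3 $ 4 = smat c (skew_unit 1 2 :: 'k^4^4) $ 3 $ 4" by (simp only:)
    then show False by (simp add: nth)
  qed
qed

lemma stable_line:
  assumes "skew \<omega>" "\<omega> \<noteq> 0" "\<And>M. M \<in> \<M> \<Longrightarrow> \<exists>c. M ** \<omega> ** transpose M = smat c \<omega>"
  shows "\<exists>U. stable U \<and> U \<noteq> {0} \<and> U \<noteq> {A. skew A}"
proof (intro exI[of _ "range (\<lambda>c. smat c \<omega>)"] conjI)
  show "stable (range (\<lambda>c. smat c \<omega>))"
    unfolding stable_def
  proof (intro conjI ballI)
    fix M A assume M: "M \<in> \<M>" and "A \<in> range (\<lambda>c. smat c \<omega>)"
    then obtain a where a: "A = smat a \<omega>" by blast
    obtain c where "M ** \<omega> ** transpose M = smat c \<omega>" using assms(3)[OF M] by blast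
    then have "M ** A ** transpose M = smat (a * c) \<omega>" by (simp add: a)
    then show "M ** A ** transpose M \<in> range (\<lambda>c. smat c \<omega>)" by (rule range_eqI)
  next
    fix A assume "A \<in> range (\<lambda>c. smat c \<omega>)"
    then obtain a where "A = smat a \<omega>" by blast
    then show "skew A" using skew_smat[OF assms(1)] by simp
  qed (rule subspace_range_smat)
  have "smat 1 \<omega> \<in> range (\<lambda>c. smat c \<omega>)" by (rule rangeI)
  with assms(2) show "range (\<lambda>c. smat c \<omega>) \<noteq> {0}" by auto
  show "range (\<lambda>c. smat c \<omega>) \<noteq> {A. skew A}"
  proof
    assume eq: "range (\<lambda>c. smat c \<omega>) = {A. skew A}"
    obtain a where a: "skew_unit 1 2 = smat a \<omega>" using skew_unit_neq_0(1) eq by blast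
    obtain b where b: "skew_unit 3 4 = smat b \<omega>" using skew_unit_neq_0(3) eq by blast
    have "a \<noteq> 0" using a skew_unit_neq_0(2) by auto
    then have "smat (b / a) (skew_unit 1 2) = smat b \<omega>" by (simp add: a)
    then show False using skew_unit_neq_0(4) b by (metis rangeI)
  qed
qed

text \<open>Placing \<open>star_congruence\<close> between \<open>M\<close> and its transpose, whose
  product is \<open>c\<close>, shows that \<open>star\<close> commutes with the action up to the
  ratio of \<open>det M\<close> to the square of \<open>c\<close>. This ratio is 1 here; the value
  -1 would exchange the two eigenspaces of \<open>star\<close>.\<close>

lemma stable_selfdual:
  assumes "\<And>M. M \<in> \<M> \<Longrightarrow> \<exists>c. M ** transpose M = mat c \<and> det M = c\<^sup>2"
  shows "\<exists>U. stable U \<and> U \<noteq> {0} \<and> U \<noteq> {A. skew A}"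
proof (intro exI[of _ "{A. skew A \<and> star A = A}"] conjI)
  have "M ** A ** transpose M \<in> {A. skew A \<and> star A = A}" if M: "M \<in> \<M>" and A: "A \<in> {A. skew A \<and> star A = A}" for M A
  proof -
    obtain c where c: "M ** transpose M = mat c" "det M = c\<^sup>2" using assms[OF M] by blast
    have "c \<noteq> 0" using det_nz[OF M] c(2) by auto
    have "M ** (transpose M ** star (M ** A ** transpose M) ** M) ** transpose M
        = smat (c\<^sup>2) (M ** A ** transpose M)"
      using star_congruence[of A M] A by (simp add: c(2))
    moreover have "M ** (transpose M ** star (M ** A ** transpose M) ** M) ** transpose M
        = (M ** transpose M) ** star (M ** A ** transpose M) ** (M ** transpose M)"
      by (simp only: matrix_mul_assoc)
    ultimately have "smat (c\<^sup>2) (star (M ** A ** transpose M)) = smat (c\<^sup>2) (M ** A ** transpose M)"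
      by (simp add: c(1) power2_eq_square)
    then have "smat (1 / c\<^sup>2) (smat (c\<^sup>2) (star (M ** A ** transpose M))) = smat (1 / c\<^sup>2) (smat (c\<^sup>2) (M ** A ** transpose M))"
      by (simp only:)
    then show ?thesis using A \<open>c \<noteq> 0\<close> by (simp add: skew_congruence)
  qed
  then show "stable {A. skew A \<and> star A = A}"
    unfolding stable_def
    by (auto simp: mat.subspace_def star_linear skew_0 skew_add skew_smat)
  \<comment> \<open>\<open>star\<close> sends \<open>skew_unit 1 2\<close> to
    \<open>- skew_unit 3 4\<close>, so this combination is self-dual while
    \<open>skew_unit 1 2\<close> alone is not.\<close>
  have "skew_unit 1 2 - skew_unit 3 4 \<in> {A :: 'k^4^4. skew A \<and> star A = A}"
    by (simp add: skew_diff skew_unit_neq_0 star_def vec_eq_iff forall_4) (simp add: skew_unit_def)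
  moreover have "skew_unit 1 2 - skew_unit 3 4 \<noteq> (0 :: 'k^4^4)"
    using skew_unit_neq_0(4) by (metis rangeI right_minus_eq smat_simps(4))
  ultimately show "{A :: 'k^4^4. skew A \<and> star A = A} \<noteq> {0}" by blast
  have "star (skew_unit 1 2) $ 1 $ 2 = (0 :: 'k)" "skew_unit 1 2 $ 1 $ 2 = (1 :: 'k)"
    by (simp_all add: star_def skew_unit_def)
  then have "star (skew_unit 1 2 :: 'k^4^4) \<noteq> skew_unit 1 2" by (metis zero_neq_one)
  then show "{A :: 'k^4^4. skew A \<and> star A = A} \<noteq> {A. skew A}" using skew_unit_neq_0(1) by blast
qed

section \<open>Eigenspaces of a self-twist and their wedge products\<close>

definition wedge :: "'k^4 \<Rightarrow> 'k^4 \<Rightarrow> 'k^4^4"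
  where "wedge x y = (\<chi> i j. x$i * y$j - y$i * x$j)"

lemma skew_wedge: "skew (wedge x y)"
  by (simp add: skew_def wedge_def vec_eq_iff transpose_def mult.commute)

lemma wedge_congruence: "M ** wedge x y ** transpose M = wedge (M *v x) (M *v y)"
  by (simp add: vec_eq_iff wedge_def matrix_mult_nth matrix_vector_mult_def transpose_def sum_4 algebra_simps)

lemma wedge_eq_0:
  assumes "wedge x y = 0" "x \<noteq> 0"
  obtains c where "y = c *s x"
proof -
  obtain i where i: "x$i \<noteq> 0" using assms(2) by (auto simp: vec_eq_iff)
  have "x$i * y$j = y$i * x$j" for j
    using arg_cong[OF assms(1), of "\<lambda>A. A $ i $ j"] by (simp add: wedge_def)
  then have "y = (y$i / x$i) *s x" using i by (simp add: vec_eq_iff field_simps)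
  then show ?thesis by (rule that)
qed

lemma wedge_linear: "wedge x (y + z) = wedge x y + wedge x z" "wedge x (c *s y) = smat c (wedge x y)"
  "wedge (c *s x) y = smat c (wedge x y)"
  by (simp_all add: wedge_def vec_eq_iff algebra_simps)

text \<open>When \<open>J\<close> squares to the square of \<open>t\<close>, the factor
  \<open>J - t\<close> annihilates the image of \<open>J + t\<close>, so \<open>J + t\<close> maps
  into the eigenspace for \<open>t\<close>.\<close>

lemma eigen_shift:
  fixes J :: "'k^4^4"
  assumes "J *v (J *v w) = c *s w" "t * t = c"
  shows "J *v (J *v w + t *s w) = t *s (J *v w + t *s w)"
proof -
  have "J *v (J *v w + t *s w) = c *s w + t *s (J *v w)"
    using assms(1) by (simp add: matrix_vector_right_distrib matrix_vector_scale)
  also have "\<dots> = t *s (J *v w + t *s w)"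
    by (simp add: assms(2)[symmetric] vec_eq_iff algebra_simps)
  finally show ?thesis .
qed

text \<open>With \<open>J\<^sup>2 = c = r\<^sup>2\<close>, the exterior square of an eigenspace of \<open>J\<close> lies in the \<open>c\<close>-eigenspace
  of \<open>\<Lambda>\<^sup>2J\<close>, and the products of the two eigenspaces lie in the \<open>-c\<close>-eigenspace.\<close>

lemma stable_self_twist:
  assumes detJ: "det J \<noteq> 0" and J: "\<And>M. M \<in> \<M> \<Longrightarrow> J ** M = M ** J \<or> J ** M = - (M ** J)"
    and nt: "\<exists>M\<in>\<M>. J ** M \<noteq> M ** J"
  shows "\<exists>U. stable U \<and> U \<noteq> {0} \<and> U \<noteq> {A. skew A}"
proof -
  have "(J ** J) ** M = M ** (J ** J)" if "M \<in> \<M>" for M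
  proof -
    have "(J ** J) ** M = J ** (J ** M)" by (simp only: matrix_mul_assoc)
    also have "\<dots> = M ** (J ** J)"
      using J[OF that]
    proof
      assume *: "J ** M = M ** J"
      have "J ** (J ** M) = (J ** M) ** J" by (simp only: *) (simp only: * matrix_mul_assoc)
      then show ?thesis by (simp only: * matrix_mul_assoc)
    next
      assume *: "J ** M = - (M ** J)"
      have "J ** (J ** M) = - ((J ** M) ** J)" by (subst *) (simp only: matrix_mult_simps matrix_mul_assoc)
      then show ?thesis by (simp only: * matrix_mul_assoc matrix_mult_simps minus_minus)
    qed
    finally show ?thesis .
  qed
  \<comment> \<open>The sign appears twice when \<open>J ** J\<close> moves past a group element, so
    \<open>J ** J\<close> is central and Schur's lemma makes it scalar.\<close>
  then obtain c where c: "J ** J = mat c" using schur[of "J ** J"] by metis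
  obtain r where r: "r ^ 2 = c" using nth_root_exists[of 2 c] by auto
  have c0: "c \<noteq> 0"
  proof
    assume "c = 0"
    then have "det (J ** J) = 0" using c by (simp only: det_0)
    with detJ show False by (simp add: det_mul)
  qed
  then have r0: "r \<noteq> 0" using r by auto
  have not_scalar: "J \<noteq> mat a" for a using nt by auto
  have JJ: "J *v (J *v x) = c *s x" for x
  proof -
    have "J *v (J *v x) = mat c *v x" by (simp only: matrix_vector_mul_assoc c)
    then show ?thesis by (simp only: mat_eq_smat[of c] smat_simps matrix_vector_mul_lid)
  qed
  define U where "U = {A. skew A \<and> J ** A ** transpose J = smat c A}"
  have "stable U" unfolding stable_def
  proof (intro conjI ballI)
    show "mat.subspace U"
      by (auto simp: U_def mat.subspace_def skew_0 skew_add skew_smat matrix_mult_distrib smat_add mult.commute)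
    show "skew A" if "A \<in> U" for A using that by (simp add: U_def)
    fix M A assume M: "M \<in> \<M>" and A: "A \<in> U"
    have "J ** (M ** A ** transpose M) ** transpose J = (J ** M) ** A ** transpose (J ** M)"
      by (simp only: matrix_mul_assoc matrix_transpose_mul)
    \<comment> \<open>A sign between \<open>J ** M\<close> and \<open>M ** J\<close> occurs twice in
      the congruence and cancels.\<close>
    also have "\<dots> = (M ** J) ** A ** transpose (M ** J)" using J[OF M] by auto
    also have "\<dots> = M ** (J ** A ** transpose J) ** transpose M"
      by (simp only: matrix_mul_assoc matrix_transpose_mul)
    finally show "M ** A ** transpose M \<in> U" using A by (simp add: U_def skew_congruence)
  qed
  moreover have ev: "\<exists>x. x \<noteq> 0 \<and> J *v x = t *s x" if t: "t = r \<or> t = - r" for t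
  proof -
    \<comment> \<open>Since \<open>J\<close> is not scalar, \<open>J + t\<close> does not vanish on
      some \<open>z\<close>, and its value there is an eigenvector for \<open>t\<close>.\<close>
    have "\<exists>z. J *v z \<noteq> (- t) *s z"
    proof (rule ccontr)
      assume "\<not> ?thesis"
      then have "\<forall>z. J *v z = smat (- t) (mat 1) *v z" by (simp only: smat_simps matrix_vector_mul_lid) simp
      then have "J = smat (- t) (mat 1)" by (rule matrix_eq[THEN iffD2])
      then have "J = mat (- t)" by (simp only: mat_eq_smat[of "- t"])
      with not_scalar show False by blast
    qed
    then obtain z where z: "J *v z \<noteq> (- t) *s z" by blast
    have tt: "t * t = c" using t r by (auto simp: power2_eq_square)
    have "J *v (J *v z + t *s z) = t *s (J *v z + t *s z)"
      by (rule eigen_shift[OF JJ tt])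
    moreover have "J *v z + t *s z \<noteq> 0"
    proof
      assume "J *v z + t *s z = 0"
      then have "J *v z = - (t *s z)" by (rule eq_neg_iff_add_eq_0[THEN iffD2])
      with z show False by (simp only: vec.scale_minus_left simp_thms)
    qed
    ultimately show ?thesis by blast
  qed
  obtain x where x: "x \<noteq> 0" "J *v x = r *s x" using ev[of r] by blast
  obtain y where y: "y \<noteq> 0" "J *v y = (- r) *s y" using ev[of "- r"] by blast
  have rr: "r * r = c" using r by (simp add: power2_eq_square)
  have "U \<noteq> {A. skew A}"
  proof
    assume "U = {A. skew A}"
    then have "wedge x y \<in> U" using skew_wedge by simp
    then have "J ** wedge x y ** transpose J = smat c (wedge x y)" by (simp only: U_def mem_Collect_eq)
    then have "smat (r * - r) (wedge x y) = smat c (wedge x y)"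
      by (simp only: wedge_congruence x(2) y(2) wedge_linear smat_simps mult.commute)
    then have "smat (2 * c) (wedge x y) = 0" by (simp add: rr vec_eq_iff algebra_simps)
    then have "smat (1 / (2 * c)) (smat (2 * c) (wedge x y)) = 0" by (simp only: smat_simps)
    then have "wedge x y = 0" using two c0 by simp
    then obtain a where a: "y = a *s x" using wedge_eq_0 x(1) by metis
    have "J *v y = r *s y" by (simp add: a vec.scale x vec_eq_iff)
    then have "(2 * r) *s y = 0" using y(2) by (simp add: vec_eq_iff algebra_simps)
    then show False using two r0 y(1) by (simp add: vec_eq_iff)
  qed
  moreover have "U \<noteq> {0}"
  proof
    assume U0: "U = {0}"
    \<comment> \<open>Were \<open>U\<close> zero, wedges of two vectors from the same eigenspace
      would vanish, so both eigenspaces would be lines; but V is their sum and has dimension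
      four.\<close>
    have *: "\<exists>a. J *v w + t *s w = a *s z" if z: "z \<noteq> 0" "J *v z = t *s z" and tt: "t * t = c" for t z w
    proof -
      have "J *v (J *v w + t *s w) = t *s (J *v w + t *s w)"
        by (rule eigen_shift[OF JJ tt])
      then have "wedge z (J *v w + t *s w) \<in> U"
        by (simp add: U_def skew_wedge wedge_congruence z wedge_linear(2,3) tt)
      then have "wedge z (J *v w + t *s w) = 0" using U0 by blast
      then show ?thesis using wedge_eq_0 z(1) by metis
    qed
    have "w \<in> vec.span {x, y}" for w
    proof -
      obtain a b where a: "J *v w + r *s w = a *s x" and b: "J *v w + (- r) *s w = b *s y"
        using *[OF x rr, of w] *[OF y, of w] rr by auto
      have "(2 * r) *s w = (J *v w + r *s w) + (- 1) *s (J *v w + (- r) *s w)"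
        by (simp add: vec_eq_iff algebra_simps)
      then have "(1 / (2 * r)) *s ((2 * r) *s w) = (1 / (2 * r)) *s (a *s x + (- 1) *s (b *s y))"
        by (simp only: a b)
      then have "w = (1 / (2 * r)) *s (a *s x + (- 1) *s (b *s y))"
        using two r0 by (simp add: vec_eq_iff)
      moreover have "(1 / (2 * r)) *s (a *s x + (- 1) *s (b *s y)) \<in> vec.span {x, y}"
        by (intro vec.span_scale vec.span_add vec.span_base) simp_all
      ultimately show ?thesis by (simp only:)
    qed
    then have "vec.dim (UNIV :: ('k^4) set) \<le> card {x, y}"
      by (intro vec.span_card_ge_dim) auto
    also have "\<dots> \<le> 2" by (simp add: card_insert_if)
    finally have "CARD(4) \<le> 2" by (simp only: vec_dim_card)
    then show False by simp
  qed
  ultimately show ?thesis by blast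
qed

end

text \<open>An orthonormal basis for \<open>D\<close>, used as coordinates, turns \<open>D\<close>
  into the standard dot product and makes \<open>M ** transpose M\<close> scalar for its
  similitudes. Independence and spanning force the length of the basis to be four.\<close>

lemma symmetric_form_coordinates:
  fixes s :: "'k::alg_closed_field \<Rightarrow> 'v::ab_group_add \<Rightarrow> 'v"
  assumes two: "(2 :: 'k) \<noteq> 0" and vs: "vector_space s" "vector_space.dim s (UNIV :: 'v set) = 4"
    and D: "bilinear_form s D" "symmetric_form D" "nondegenerate_form D"
  shows "\<exists>\<kappa>. Vector_Spaces.linear (*s) s \<kappa> \<and> bij (\<kappa> :: 'k^4 \<Rightarrow> 'v) \<and>
    (\<forall>x y. D (\<kappa> x) (\<kappa> y) = scalar_product x y)"
proof -
  interpret symmetric_bilinear s D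
    using vs(1) D(1,2)
    by (simp add: symmetric_bilinear_def symmetric_bilinear_axioms_def bilinear_form_def linear_char symmetric_form_def)
  obtain B where B: "independent B" "UNIV \<subseteq> span B" "card B = dim UNIV"
    by (rule basis_exists[of UNIV]) blast
  have "card B = 4" using B(3) vs(2) by simp
  then have fin: "finite B" by (intro card_ge_0_finite) simp
  have "\<exists>u n. orthonormal u n \<and> (\<forall>x. x = (\<Sum>i<n. s (D x (u i)) (u i)))"
  proof (rule orthonormal_basis_exists[OF two subspace_UNIV B(2) fin])
    show "x = 0" if "\<And>y. y \<in> UNIV \<Longrightarrow> D x y = 0" for x
      using D(3) that by (simp add: nondegenerate_form_def)
  qed (intro exI conjI allI; assumption?; simp?)
  then obtain u n where on: "orthonormal u n" and dec: "\<And>x. x = (\<Sum>i<n. s (D x (u i)) (u i))" by metis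
  have "n \<le> 4" using orthonormal_length[OF on fin] B(2) \<open>card B = 4\<close> by auto
  moreover have "4 \<le> n"
  proof -
    have "x \<in> span (u ` {..<n})" for x
    proof -
      have "(\<Sum>i<n. s (D x (u i)) (u i)) \<in> span (u ` {..<n})"
        by (intro span_sum span_scale span_base) simp
      then show ?thesis by (simp only: dec[of x, symmetric])
    qed
    then have "dim UNIV \<le> card (u ` {..<n})" by (intro span_card_ge_dim) auto
    also have "\<dots> \<le> n" using card_image_le[of "{..<n}" u] by simp
    finally show ?thesis using vs(2) by simp
  qed
  ultimately have n: "n = 4" by simp
  obtain h :: "4 \<Rightarrow> nat" where h: "bij_betw h UNIV {..<n}"
    using finite_same_card_bij[OF finite_class.finite_UNIV finite_lessThan, of n] n by force
  have hn: "h i < n" for i using h by (auto simp: bij_betw_def)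
  have hh: "D (u (h i)) (u (h j)) = (if i = j then 1 else 0)" for i j
    using on hn h by (auto simp: orthonormal_def bij_betw_def inj_eq)
  define \<kappa> where "\<kappa> x = (\<Sum>i\<in>UNIV. s (x$i) (u (h i)))" for x :: "'k^4"
  have lin: "\<kappa> (x + y) = \<kappa> x + \<kappa> y" "\<kappa> (c *s x) = s c (\<kappa> x)" for x y c
    by (simp_all add: \<kappa>_def scale_left_distrib sum.distrib scale_sum_right)
  have L: "Vector_Spaces.linear (*s) s \<kappa>" using vs(1) lin vec.vector_space_axioms by (simp add: linear_char)
  have coeff: "D (\<kappa> x) (u (h j)) = x $ j" for x j
    by (simp add: \<kappa>_def sum_left scale_left hh if_distrib[of "(*) _"] cong: if_cong)
  have form: "D (\<kappa> x) (\<kappa> y) = scalar_product x y" for x y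
  proof -
    have "D (\<kappa> y) w = (\<Sum>i\<in>UNIV. y $ i * D (u (h i)) w)" for w
      by (simp add: \<kappa>_def sum_left scale_left)
    from this[of "\<kappa> x"] show ?thesis
      by (simp only: sym[of "\<kappa> x"] sym[of "u _" "\<kappa> x"] coeff scalar_product_def)
        (simp add: sym[of "u _" "\<kappa> x"] coeff mult.commute)
  qed
  have "inj \<kappa>"
  proof (rule injI)
    fix x y assume "\<kappa> x = \<kappa> y"
    then have "x $ j = y $ j" for j using coeff[of x j] coeff[of y j] by simp
    then show "x = y" by (simp add: vec_eq_iff)
  qed
  moreover have "v \<in> range \<kappa>" for v
  proof (rule range_eqI)
    have "v = (\<Sum>i\<in>{..<n}. s (D v (u i)) (u i))" by (rule dec)
    also have "\<dots> = (\<Sum>i\<in>UNIV. s (D v (u (h i))) (u (h i)))"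
      by (rule sum.reindex_bij_betw[OF h, symmetric])
    finally show "v = \<kappa> (\<chi> i. D v (u (h i)))" by (simp add: \<kappa>_def)
  qed
  ultimately have "bij \<kappa>" by (auto simp: bij_def)
  with L form show ?thesis by blast
qed

section \<open>Representations in coordinates\<close>

locale coord_rep = coordinates s \<kappa>
  for s :: "'k::alg_closed_field \<Rightarrow> 'v::ab_group_add \<Rightarrow> 'v" and \<kappa> :: "'k^4 \<Rightarrow> 'v" +
  fixes G :: "('g, 'm) monoid_scheme" and \<sigma> :: "'g \<Rightarrow> 'v \<Rightarrow> 'v"
  assumes rep: "group_rep G s UNIV \<sigma>" and irr: "irreducible_rep G s UNIV \<sigma>"
begin

definition mat_rep :: "'g \<Rightarrow> 'k^4^4" where "mat_rep g = mtx (\<sigma> g)"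

lemma group: "group G" using rep by (simp add: group_rep_def)

lemma linear_\<sigma>: "g \<in> carrier G \<Longrightarrow> Vector_Spaces.linear s s (\<sigma> g)"
  using rep by (simp add: group_rep_def)

lemma \<sigma>_\<kappa>: "g \<in> carrier G \<Longrightarrow> \<sigma> g (\<kappa> x) = \<kappa> (mat_rep g *v x)"
  unfolding mat_rep_def by (rule mtx_\<kappa>[OF linear_\<sigma>])

lemma \<kappa>_inj: "\<kappa> x = \<kappa> y \<longleftrightarrow> x = y"
  by (metis coord_inverse(1))

lemma inv_closed: "g \<in> carrier G \<Longrightarrow> inv\<^bsub>G\<^esub> g \<in> carrier G"
  using group by (rule group.inv_closed)

lemma mult_closed: "g \<in> carrier G \<Longrightarrow> h \<in> carrier G \<Longrightarrow> g \<otimes>\<^bsub>G\<^esub> h \<in> carrier G"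
  using group by (simp add: group.is_monoid monoid.m_closed)

lemma mat_rep_mult:
  assumes "g \<in> carrier G" "h \<in> carrier G"
  shows "mat_rep (g \<otimes>\<^bsub>G\<^esub> h) = mat_rep g ** mat_rep h"
proof (rule matrix_eqI)
  fix x
  have "\<kappa> (mat_rep (g \<otimes>\<^bsub>G\<^esub> h) *v x) = \<sigma> g (\<sigma> h (\<kappa> x))"
    using rep assms mult_closed[OF assms] by (simp add: \<sigma>_\<kappa>[symmetric] group_rep_def)
  also have "\<dots> = \<kappa> ((mat_rep g ** mat_rep h) *v x)"
    by (simp only: \<sigma>_\<kappa> assms matrix_vector_mul_assoc)
  finally show "mat_rep (g \<otimes>\<^bsub>G\<^esub> h) *v x = (mat_rep g ** mat_rep h) *v x" by (simp only: \<kappa>_inj)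
qed

lemma mat_rep_inverse:
  assumes "g \<in> carrier G"
  shows "mat_rep g ** mat_rep (inv\<^bsub>G\<^esub> g) = mat 1" "mat_rep (inv\<^bsub>G\<^esub> g) ** mat_rep g = mat 1"
proof -
  note inv = inv_closed[OF assms]
  have "\<kappa> ((mat_rep g ** mat_rep (inv\<^bsub>G\<^esub> g)) *v x) = \<kappa> (mat 1 *v x)" for x
    using group_rep_inv(1)[OF rep assms, of "\<kappa> x"]
    by (simp only: \<sigma>_\<kappa> assms inv matrix_vector_mul_assoc matrix_vector_mul_lid)
  then show "mat_rep g ** mat_rep (inv\<^bsub>G\<^esub> g) = mat 1" by (intro matrix_eqI) (simp only: \<kappa>_inj)
  then show "mat_rep (inv\<^bsub>G\<^esub> g) ** mat_rep g = mat 1" by (simp only: matrix_left_right_inverse)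
qed

sublocale irreducible_matrices "mat_rep ` carrier G"
proof
  show "(2 :: 'k) \<noteq> 0" by (rule two)
  show "\<exists>N\<in>mat_rep ` carrier G. M ** N = mat 1 \<and> N ** M = mat 1" if "M \<in> mat_rep ` carrier G" for M
    using that mat_rep_inverse inv_closed by blast
  fix X :: "('k^4) set"
  assume X: "vec.subspace X" and stab: "\<And>M x. M \<in> mat_rep ` carrier G \<Longrightarrow> x \<in> X \<Longrightarrow> M *v x \<in> X"
  have X': "0 \<in> X" "\<And>x y. x \<in> X \<Longrightarrow> y \<in> X \<Longrightarrow> x + y \<in> X" "\<And>c x. x \<in> X \<Longrightarrow> c *s x \<in> X"
    using X by (simp_all add: vec.subspace_def)
  interpret V: vector_space s by (rule vs)
  have "V.subspace (\<kappa> ` X)" unfolding V.subspace_def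
  proof safe
    show "0 \<in> \<kappa> ` X" by (rule image_eqI[of _ _ 0]) (simp_all only: \<kappa>_0 X')
    show "\<kappa> x + \<kappa> y \<in> \<kappa> ` X" if "x \<in> X" "y \<in> X" for x y
      by (rule image_eqI[of _ _ "x + y"]) (simp_all only: \<kappa>_linear X' that)
    show "s c (\<kappa> x) \<in> \<kappa> ` X" if "x \<in> X" for c x
      by (rule image_eqI[of _ _ "c *s x"]) (simp_all only: \<kappa>_linear X' that)
  qed
  moreover have "\<sigma> g ` \<kappa> ` X \<subseteq> \<kappa> ` X" if g: "g \<in> carrier G" for g
  proof safe
    fix x assume "x \<in> X"
    then show "\<sigma> g (\<kappa> x) \<in> \<kappa> ` X" using stab[of "mat_rep g" x] g by (simp only: \<sigma>_\<kappa>) blast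
  qed
  ultimately have "\<kappa> ` X = {0} \<or> \<kappa> ` X = UNIV"
    using irr by (simp add: irreducible_rep_def subrep_def)
  then show "X = {0} \<or> X = UNIV"
  proof
    assume "\<kappa> ` X = {0}"
    then have "\<kappa> x = \<kappa> 0" if "x \<in> X" for x using that \<kappa>_0 by auto
    then have "X \<subseteq> {0}" by (auto simp only: \<kappa>_inj)
    then show ?thesis using X'(1) by blast
  next
    assume "\<kappa> ` X = UNIV"
    then have "x \<in> X" for x using \<kappa>_inj by (metis UNIV_I imageE)
    then show ?thesis by blast
  qed
qed

lemma tensor_square_rep_tens:
  assumes g: "g \<in> carrier G"
  shows "tensor_square_rep \<sigma> g (tens A) = tens (mat_rep g ** A ** transpose (mat_rep g))"
proof -
  have sum: "tensor_square_rep \<sigma> g (sum f B) = (\<Sum>b\<in>B. tensor_square_rep \<sigma> g (f b))"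
    for f :: "4 \<Rightarrow> ('k, 'v) tensor2" and B
    by (induction B rule: infinite_finite_induct) (simp_all add: tensor_square_rep_def fun_eq_iff)
  have scale: "tensor_square_rep \<sigma> g (fun_scale c t) = fun_scale c (tensor_square_rep \<sigma> g t)"
    for c and t :: "('k, 'v) tensor2"
    by (simp add: tensor_square_rep_def fun_scale_def)
  have pure: "tensor_square_rep \<sigma> g (pure_tensor s (basis i) (basis j)) =
      tens (mat_rep g ** outer (axis i 1) (axis j 1) ** transpose (mat_rep g))" for i j
  proof -
    have "tensor_square_rep \<sigma> g (pure_tensor s (basis i) (basis j)) =
        pure_tensor s (\<sigma> g (basis i)) (\<sigma> g (basis j))"
      by (rule tensor_square_rep_pure[OF rep g])
    also have "\<dots> = tens (outer (coord (\<sigma> g (basis i))) (coord (\<sigma> g (basis j))))"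
      by (rule pure_tensor_tens)
    finally show ?thesis
      by (simp only: mtx[OF linear_\<sigma>[OF g]] mat_rep_def coord_basis outer_congruence)
  qed
  have "mat_rep g ** A ** transpose (mat_rep g) = (\<Sum>i\<in>UNIV. \<Sum>j\<in>UNIV.
      smat (A$i$j) (mat_rep g ** outer (axis i 1) (axis j 1) ** transpose (mat_rep g)))"
    by (subst outer_expand[of A]) (simp only: congruence_sum smat_simps)
  from arg_cong[OF this, of tens] show ?thesis
    by (simp only: tens_pure_sum[of A] sum scale pure tens_sum tens_linear)
qed

text \<open>\<open>tens\<close> is an equivariant isomorphism from skew matrices to the exterior
  square, whatever the coordinates; the freedom in choosing them is used in the orthogonal
  case.\<close>

lemma reducible_iff_stable:
  "reducible_rep G fun_scale (exterior_square s) (tensor_square_rep \<sigma>) \<longleftrightarrow>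
    (\<exists>U. stable U \<and> U \<noteq> {0} \<and> U \<noteq> {A. skew A})"
proof
  interpret T: vector_space "fun_scale :: 'k \<Rightarrow> ('k, 'v) tensor2 \<Rightarrow> _" by (rule vector_space_fun_scale)
  assume "reducible_rep G fun_scale (exterior_square s) (tensor_square_rep \<sigma>)"
  then obtain U where U: "T.subspace U" "U \<subseteq> exterior_square s"
    "\<And>g t. g \<in> carrier G \<Longrightarrow> t \<in> U \<Longrightarrow> tensor_square_rep \<sigma> g t \<in> U" "U \<noteq> {0}" "U \<noteq> exterior_square s"
    unfolding reducible_rep_def subrep_def by blast
  define W where "W = {A. tens A \<in> U}"
  have W: "tens ` W = U"
    unfolding W_def using U(2) by (auto simp: exterior_square_tens)
  have "mat.subspace W"
    using U(1) by (simp add: W_def mat.subspace_def T.subspace_def tens_0 tens_linear)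
  moreover have "skew A" if "A \<in> W" for A
    using that U(2) by (auto simp: W_def exterior_square_tens tens_inj)
  moreover have "M ** A ** transpose M \<in> W" if "M \<in> mat_rep ` carrier G" "A \<in> W" for M A
    using that U(3) by (auto simp: W_def simp flip: tensor_square_rep_tens)
  ultimately have "stable W" unfolding stable_def by (intro conjI ballI)
  moreover have "W \<noteq> {0}" using W U(4) tens_0 by auto
  moreover have "W \<noteq> {A. skew A}" using W U(5) by (auto simp: exterior_square_tens)
  ultimately show "\<exists>U. stable U \<and> U \<noteq> {0} \<and> U \<noteq> {A. skew A}" by blast
next
  assume "\<exists>U. stable U \<and> U \<noteq> {0} \<and> U \<noteq> {A. skew A}"
  then obtain U where U: "stable U" "U \<noteq> {0}" "U \<noteq> {A. skew A}" by blast
  have U': "mat.subspace U" "\<And>A. A \<in> U \<Longrightarrow> skew A"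
    "\<And>g A. g \<in> carrier G \<Longrightarrow> A \<in> U \<Longrightarrow> mat_rep g ** A ** transpose (mat_rep g) \<in> U"
    using U(1) by (simp_all add: stable_def)
  have inj: "tens ` U = tens ` V \<longleftrightarrow> U = V" for V
    by (rule inj_image_eq_iff) (simp add: inj_on_def tens_inj)
  show "reducible_rep G fun_scale (exterior_square s) (tensor_square_rep \<sigma>)"
    unfolding reducible_rep_def subrep_def
  proof (intro exI[of _ "tens ` U"] conjI ballI)
    show "module.subspace fun_scale (tens ` U)" by (rule subspace_image_tens[OF U'(1)])
    show "tens ` U \<subseteq> exterior_square s" using U'(2) by (auto simp: exterior_square_tens)
    show "tensor_square_rep \<sigma> g ` tens ` U \<subseteq> tens ` U" if "g \<in> carrier G" for g
      using U'(3)[OF that] by (auto simp: tensor_square_rep_tens[OF that])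
    show "tens ` U \<noteq> {0}" using inj[of "{0}"] U(2) by (simp add: tens_0)
    show "tens ` U \<noteq> exterior_square s" using inj[of "{A. skew A}"] U(3) by (simp add: exterior_square_tens)
  qed
qed

text \<open>The multiplier is inverted because essential self-duality via a character makes the
  inverse of that character occur in the tensor square.\<close>

definition similitude_character :: "'k^4^4 \<Rightarrow> 'g \<Rightarrow> 'k"
  where "similitude_character \<omega> g =
    inverse (SOME c. mat_rep g ** \<omega> ** transpose (mat_rep g) = smat c \<omega>)"

text \<open>Read \<open>\<omega>\<close> as a map from the dual of V to V. The similitude relation,
  multiplied by the transposed inverse of \<open>mat_rep g\<close>, says that this map intertwines
  the dual representation with the twist by the inverse multiplier.\<close>

lemma ess_self_dual:
  assumes det: "det \<omega> \<noteq> 0"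
    and sim: "\<And>g. g \<in> carrier G \<Longrightarrow> \<exists>c. mat_rep g ** \<omega> ** transpose (mat_rep g) = smat c \<omega>"
  shows "ess_self_dual_via G s \<sigma> (similitude_character \<omega>)"
    and "g \<in> carrier G \<Longrightarrow> tensor_square_rep \<sigma> g (tens \<omega>) = fun_scale (inverse (similitude_character \<omega> g)) (tens \<omega>)"
    and "tens \<omega> \<noteq> 0"
proof -
  let ?\<chi> = "similitude_character \<omega>"
  define c where "c g = (SOME c. mat_rep g ** \<omega> ** transpose (mat_rep g) = smat c \<omega>)" for g
  have c: "mat_rep g ** \<omega> ** transpose (mat_rep g) = smat (c g) \<omega>" if "g \<in> carrier G" for g
    unfolding c_def by (rule someI_ex[OF sim[OF that]])
  have \<chi>: "?\<chi> g = inverse (c g)" for g by (simp add: similitude_character_def c_def)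
  have \<omega>0: "\<omega> \<noteq> 0" using det det_0[where 'a = 'k and 'n = 4] by (auto simp: mat_0)
  have inj: "smat a \<omega> = smat b \<omega> \<longleftrightarrow> a = b" for a b
  proof
    assume "smat a \<omega> = smat b \<omega>"
    then have "a * \<omega>$i$j = b * \<omega>$i$j" for i j by (metis smat_nth)
    moreover obtain i j where "\<omega>$i$j \<noteq> 0" using \<omega>0 by (auto simp: vec_eq_iff)
    ultimately show "a = b" by (metis mult_right_cancel)
  qed simp
  have cnz: "c g \<noteq> 0" if g: "g \<in> carrier G" for g
  proof
    assume "c g = 0"
    then have "mat_rep g ** \<omega> ** transpose (mat_rep g) = mat 0"
      using c[OF g] by (simp add: mat_0)
    then have "det (mat_rep g ** \<omega> ** transpose (mat_rep g)) = 0" by (simp only: det_0)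
    then show False using det det_nz[of "mat_rep g"] g by (simp add: det_mul)
  qed
  have "c (g \<otimes>\<^bsub>G\<^esub> h) = c g * c h" if "g \<in> carrier G" "h \<in> carrier G" for g h
  proof -
    have "smat (c (g \<otimes>\<^bsub>G\<^esub> h)) \<omega> = mat_rep g ** (mat_rep h ** \<omega> ** transpose (mat_rep h)) ** transpose (mat_rep g)"
      unfolding c[OF mult_closed[OF that], symmetric]
      by (simp only: mat_rep_mult that matrix_transpose_mul matrix_mul_assoc)
    also have "\<dots> = smat (c g * c h) \<omega>"
      by (simp add: c that mult.commute)
    finally show ?thesis by (simp only: inj)
  qed
  with cnz have char: "group_character G ?\<chi>" by (simp add: group_character_def \<chi>)
  define vals :: "('v \<Rightarrow> 'k) \<Rightarrow> 'k^4" where "vals f = (\<chi> i. f (basis i))" for f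
  define T where "T f = \<kappa> (\<omega> *v vals f)" for f
  have T_lin: "Vector_Spaces.linear fun_scale s T"
    unfolding linear_char
  proof (intro conjI allI vector_space_fun_scale vs)
    fix f h :: "'v \<Rightarrow> 'k" and a
    have "vals (f + h) = vals f + vals h" "vals (fun_scale a f) = a *s vals f"
      by (simp_all add: vals_def vec_eq_iff fun_scale_def)
    then show "T (f + h) = T f + T h" "T (fun_scale a f) = s a (T f)"
      by (simp_all only: T_def matrix_vector_right_distrib matrix_vector_scale \<kappa>_linear)
  qed
  have dual: "f \<in> dual_space s \<longleftrightarrow> (\<forall>x y. f (x + y) = f x + f y) \<and> (\<forall>c x. f (s c x) = c * f x)" for f
    by (simp add: dual_space_def linear_times)
  obtain \<omega>' where \<omega>': "\<omega> ** \<omega>' = mat 1" "\<omega>' ** \<omega> = mat 1"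
    using det invertible_det_nz invertible_def by metis
  have expand: "f v = (\<Sum>i\<in>UNIV. coord v $ i * vals f $ i)" if "f \<in> dual_space s" for f v
    using functional_expand[of f v] that by (simp add: dual vals_def)
  have T_bij: "bij_betw T (dual_space s) UNIV"
    unfolding bij_betw_def
  proof
    show "inj_on T (dual_space s)"
    proof (rule inj_onI)
      fix f h assume f: "f \<in> dual_space s" and h: "h \<in> dual_space s" and "T f = T h"
      then have "\<omega>' *v (\<omega> *v vals f) = \<omega>' *v (\<omega> *v vals h)" by (simp add: T_def \<kappa>_inj)
      then have "vals f = vals h" by (simp add: matrix_vector_mul_assoc \<omega>')
      then show "f = h" using expand[OF f] expand[OF h] by (simp add: fun_eq_iff)
    qed
    have "v \<in> T ` dual_space s" for v
    proof (rule image_eqI)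
      define y where "y = \<omega>' *v coord v"
      define f where "f v = (\<Sum>i\<in>UNIV. coord v $ i * y $ i)" for v
      show "f \<in> dual_space s"
        by (simp add: dual f_def coord_linear algebra_simps sum.distrib sum_distrib_left)
      have "vals f = y" by (simp add: vals_def f_def vec_eq_iff axis_def if_distrib[of "\<lambda>u. u * _"] cong: if_cong)
      then show "v = T f" by (simp add: T_def y_def matrix_vector_mul_assoc \<omega>')
    qed
    then show "T ` dual_space s = UNIV" by blast
  qed
  have T_eq: "T (dual_rep G \<sigma> g f) = twist_rep s ?\<chi> \<sigma> g (T f)" if g: "g \<in> carrier G" and f: "f \<in> dual_space s" for g f
  proof -
    let ?M = "mat_rep g" and ?N = "mat_rep (inv\<^bsub>G\<^esub> g)"
    note ig = inv_closed[OF g]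
    have "vals (dual_rep G \<sigma> g f) $ i = (transpose ?N *v vals f) $ i" for i
    proof -
      have "coord (\<sigma> (inv\<^bsub>G\<^esub> g) (basis i)) = ?N *v axis i 1"
        by (simp add: mtx[OF linear_\<sigma>[OF ig]] mat_rep_def)
      moreover have "(?N *v axis i 1) $ k = ?N $ k $ i" for k
        by (simp add: matrix_vector_mult_def axis_def if_distrib[of "(*) _"] cong: if_cong)
      ultimately have "f (\<sigma> (inv\<^bsub>G\<^esub> g) (basis i)) = (\<Sum>k\<in>UNIV. ?N $ k $ i * vals f $ k)"
        by (simp add: expand[OF f, of "\<sigma> _ _"])
      moreover have "vals (dual_rep G \<sigma> g f) $ i = f (\<sigma> (inv\<^bsub>G\<^esub> g) (basis i))"
        by (simp add: vals_def dual_rep_def)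
      ultimately show ?thesis
        by (simp add: matrix_vector_mult_def transpose_def del: transpose_matrix_vector)
    qed
    then have v: "vals (dual_rep G \<sigma> g f) = transpose ?N *v vals f" by (simp only: vec_eq_iff) simp
    have "?M ** \<omega> ** transpose ?M ** transpose ?N = smat (c g) (\<omega> ** transpose ?N)"
      by (simp add: c[OF g])
    moreover have "?M ** \<omega> ** transpose ?M ** transpose ?N = ?M ** \<omega> ** transpose (?N ** ?M)"
      by (simp only: matrix_transpose_mul matrix_mul_assoc)
    ultimately have "smat (c g) (\<omega> ** transpose ?N) = ?M ** \<omega>"
      by (simp add: mat_rep_inverse[OF g])
    then have "smat (?\<chi> g) (smat (c g) (\<omega> ** transpose ?N)) = smat (?\<chi> g) (?M ** \<omega>)" by (simp only:)
    then have eq: "\<omega> ** transpose ?N = smat (?\<chi> g) (?M ** \<omega>)" using cnz[OF g] by (simp add: \<chi>)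
    have "T (dual_rep G \<sigma> g f) = \<kappa> ((\<omega> ** transpose ?N) *v vals f)"
      by (simp only: T_def v matrix_vector_mul_assoc)
    also have "\<dots> = s (?\<chi> g) (\<kappa> (?M *v (\<omega> *v vals f)))"
      by (simp only: eq smat_simps \<kappa>_linear matrix_vector_mul_assoc)
    finally show ?thesis by (simp only: twist_rep_def \<sigma>_\<kappa>[OF g, symmetric] T_def)
  qed
  show "ess_self_dual_via G s \<sigma> ?\<chi>"
    unfolding ess_self_dual_via_def iso_rep_def using char T_lin T_bij T_eq by blast
  show "tensor_square_rep \<sigma> g (tens \<omega>) = fun_scale (inverse (?\<chi> g)) (tens \<omega>)" if "g \<in> carrier G"
    by (simp add: tensor_square_rep_tens that c \<chi> tens_linear)
  show "tens \<omega> \<noteq> 0" using \<omega>0 tens_inj[of \<omega> 0] by (simp add: tens_0)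
qed

section \<open>Passage between matrices and the types of the representation\<close>

lemma symplectic_typeI:
  assumes "skew \<omega>" "det \<omega> \<noteq> 0"
    and "\<And>g. g \<in> carrier G \<Longrightarrow> \<exists>c. mat_rep g ** \<omega> ** transpose (mat_rep g) = smat c \<omega>"
  shows "symplectic_type G s \<sigma>"
  unfolding symplectic_type_def character_occurs_def
proof (intro exI[of _ "similitude_character \<omega>"] conjI bexI[of _ "tens \<omega>"] ballI)
  show "tens \<omega> \<in> exterior_square s" using assms(1) by (simp add: exterior_square_tens)
qed (simp_all add: ess_self_dual assms)

lemma orthogonal_typeI:
  assumes "transpose \<omega> = \<omega>" "det \<omega> \<noteq> 0"
    and "\<And>g. g \<in> carrier G \<Longrightarrow> \<exists>c. mat_rep g ** \<omega> ** transpose (mat_rep g) = smat c \<omega>"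
  shows "orthogonal_type G s \<sigma>"
  unfolding orthogonal_type_def character_occurs_def
proof (intro exI[of _ "similitude_character \<omega>"] conjI bexI[of _ "tens \<omega>"] ballI)
  show "tens \<omega> \<in> symmetric_square s" using assms(1) by (rule tens_symmetric)
qed (simp_all add: ess_self_dual assms)

text \<open>\<open>J\<close> itself is the isomorphism onto the twist. The scalar relating
  \<open>J ** mat_rep g\<close> to \<open>mat_rep g ** J\<close> is unique because these products
  are invertible, and uniqueness makes it multiplicative in \<open>g\<close>.\<close>

lemma quadratic_self_twistI:
  assumes det: "det J \<noteq> 0" and J: "\<And>M. M \<in> mat_rep ` carrier G \<Longrightarrow> J ** M = M ** J \<or> J ** M = - (M ** J)"
    and nt: "\<exists>M\<in>mat_rep ` carrier G. J ** M \<noteq> M ** J"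
  shows "quadratic_self_twist G s \<sigma>"
proof -
  define \<epsilon> :: "'g \<Rightarrow> 'k" where "\<epsilon> g = (if J ** mat_rep g = mat_rep g ** J then 1 else - 1)" for g
  have one: "(1 :: 'k) \<noteq> - 1" using two by (metis add.right_inverse one_add_one)
  have \<epsilon>: "J ** mat_rep g = smat (\<epsilon> g) (mat_rep g ** J)" if "g \<in> carrier G" for g
    using J[of "mat_rep g"] that by (auto simp: \<epsilon>_def smat_minus)
  have inj: "a = b" if eq: "smat a (mat_rep g ** J) = smat b (mat_rep g ** J)" and g: "g \<in> carrier G" for a b g
  proof (rule ccontr)
    assume "a \<noteq> b"
    have "smat (1 / (a - b)) (smat (a - b) (mat_rep g ** J)) = 0"
      using eq by (simp add: smat_diff)
    then have "mat_rep g ** J = mat 0" using \<open>a \<noteq> b\<close> by (simp add: mat_0)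
    then have "det (mat_rep g ** J) = 0" by (simp only: det_0)
    then show False using det det_nz[of "mat_rep g"] g by (simp add: det_mul)
  qed
  have "\<epsilon> (g \<otimes>\<^bsub>G\<^esub> h) = \<epsilon> g * \<epsilon> h" if g: "g \<in> carrier G" and h: "h \<in> carrier G" for g h
  proof -
    have "smat (\<epsilon> (g \<otimes>\<^bsub>G\<^esub> h)) (mat_rep (g \<otimes>\<^bsub>G\<^esub> h) ** J) = (J ** mat_rep g) ** mat_rep h"
      using \<epsilon>[OF mult_closed[OF g h]] by (simp only: mat_rep_mult[OF g h] matrix_mul_assoc)
    also have "\<dots> = smat (\<epsilon> g) (mat_rep g ** (J ** mat_rep h))"
      by (simp only: \<epsilon>[OF g] smat_simps matrix_mul_assoc)
    also have "\<dots> = smat (\<epsilon> g * \<epsilon> h) (mat_rep (g \<otimes>\<^bsub>G\<^esub> h) ** J)"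
      by (simp only: \<epsilon>[OF h] smat_simps matrix_mul_assoc mat_rep_mult[OF g h])
    finally show ?thesis using inj mult_closed[OF g h] by blast
  qed
  then have char: "group_character G \<epsilon>" by (simp add: group_character_def) (simp add: \<epsilon>_def)
  have nt': "\<exists>g\<in>carrier G. \<epsilon> g \<noteq> 1" using nt one by (auto simp: \<epsilon>_def)
  define T where "T v = \<kappa> (J *v coord v)" for v
  obtain J' where J': "J ** J' = mat 1" "J' ** J = mat 1"
    using det invertible_det_nz invertible_def by metis
  have "Vector_Spaces.linear s s T"
    using vs by (simp add: linear_char T_def coord_linear \<kappa>_linear matrix_vector_right_distrib matrix_vector_scale)
  moreover have "bij T"
  proof (rule o_bij)
    show "(\<lambda>v. \<kappa> (J' *v coord v)) \<circ> T = id" "T \<circ> (\<lambda>v. \<kappa> (J' *v coord v)) = id"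
      by (simp_all add: fun_eq_iff T_def matrix_vector_mul_assoc J')
  qed
  moreover have "T (\<sigma> g v) = twist_rep s \<epsilon> \<sigma> g (T v)" if g: "g \<in> carrier G" for g v
  proof -
    have "T (\<sigma> g v) = \<kappa> ((J ** mat_rep g) *v coord v)"
      by (simp only: T_def mtx[OF linear_\<sigma>[OF g]] mat_rep_def matrix_vector_mul_assoc)
    also have "\<dots> = s (\<epsilon> g) (\<kappa> (mat_rep g *v (J *v coord v)))"
      by (simp only: \<epsilon>[OF g] smat_simps \<kappa>_linear matrix_vector_mul_assoc)
    finally show ?thesis by (simp only: twist_rep_def \<sigma>_\<kappa>[OF g, symmetric] T_def)
  qed
  ultimately have "iso_rep G s UNIV \<sigma> s UNIV (twist_rep s \<epsilon> \<sigma>)"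
    unfolding iso_rep_def by blast
  moreover have "\<forall>g\<in>carrier G. \<epsilon> g = 1 \<or> \<epsilon> g = - 1" by (simp add: \<epsilon>_def)
  ultimately show ?thesis unfolding quadratic_self_twist_def using char nt' by blast
qed

lemma quadratic_self_twistE:
  assumes "quadratic_self_twist G s \<sigma>"
  obtains J where "det J \<noteq> 0" "\<And>M. M \<in> mat_rep ` carrier G \<Longrightarrow> J ** M = M ** J \<or> J ** M = - (M ** J)"
    "\<exists>M\<in>mat_rep ` carrier G. J ** M \<noteq> M ** J"
proof -
  obtain \<epsilon> T where *: "\<forall>g\<in>carrier G. \<epsilon> g = 1 \<or> \<epsilon> g = - 1" "\<exists>g\<in>carrier G. \<epsilon> g \<noteq> 1"
    "Vector_Spaces.linear s s T" "bij_betw T UNIV UNIV"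
    "\<forall>g\<in>carrier G. \<forall>v\<in>UNIV. T (\<sigma> g v) = s (\<epsilon> g) (\<sigma> g (T v))"
    using assms unfolding quadratic_self_twist_def iso_rep_def twist_rep_def by blast
  note \<epsilon> = *(1)[rule_format] *(2) and T = *(3,4) *(5)[rule_format, OF _ UNIV_I]
  define J where "J = mtx T"
  have det: "det J \<noteq> 0"
  proof
    assume "det J = 0"
    then obtain x where x: "x \<noteq> 0" "J *v x = 0" by (rule det_eq_0_kernel)
    have "T (\<kappa> x) = T (\<kappa> 0)" using x(2) by (simp add: mtx_\<kappa>[OF T(1)] J_def)
    then have "x = 0" using T(2) by (simp add: bij_def inj_eq \<kappa>_inj)
    with x(1) show False by simp
  qed
  have eq: "J ** mat_rep g = smat (\<epsilon> g) (mat_rep g ** J)" if g: "g \<in> carrier G" for g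
  proof (rule matrix_eqI)
    fix x
    have "\<kappa> ((J ** mat_rep g) *v x) = T (\<sigma> g (\<kappa> x))"
      by (simp only: J_def mtx_\<kappa>[OF T(1)] \<sigma>_\<kappa>[OF g] matrix_vector_mul_assoc)
    also have "\<dots> = s (\<epsilon> g) (\<sigma> g (T (\<kappa> x)))" by (rule T(3)[OF g])
    also have "\<dots> = \<kappa> (smat (\<epsilon> g) (mat_rep g ** J) *v x)"
      by (simp only: mtx_\<kappa>[OF T(1), folded J_def] \<sigma>_\<kappa>[OF g] matrix_vector_mul_assoc smat_simps \<kappa>_linear)
    finally show "(J ** mat_rep g) *v x = smat (\<epsilon> g) (mat_rep g ** J) *v x" by (simp only: \<kappa>_inj)
  qed
  have pm: "J ** mat_rep g = mat_rep g ** J \<or> J ** mat_rep g = - (mat_rep g ** J)" if g: "g \<in> carrier G" for g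
    using \<epsilon>(1)[OF g] eq[OF g] by (auto simp: smat_minus)
  obtain g where g: "g \<in> carrier G" "\<epsilon> g \<noteq> 1" using \<epsilon>(2) by blast
  have "J ** mat_rep g \<noteq> mat_rep g ** J"
  proof
    assume *: "J ** mat_rep g = mat_rep g ** J"
    have "J ** mat_rep g = - (mat_rep g ** J)" using eq[OF g(1)] \<epsilon>(1)[OF g(1)] g(2) by (auto simp: smat_minus)
    with * have "smat 2 (mat_rep g ** J) = 0" by (simp add: vec_eq_iff eq_neg_iff_add_eq_0)
    then have "smat (1/2) (smat 2 (mat_rep g ** J)) = 0" by (simp only: smat_simps)
    then have "mat_rep g ** J = mat 0" using two by (simp add: mat_0)
    then have "det (mat_rep g ** J) = 0" by (simp only: det_0)
    then show False using det det_nz[of "mat_rep g"] g by (simp add: det_mul)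
  qed
  with that[OF det] pm g(1) show ?thesis by blast
qed

lemma symplectic_typeE:
  assumes "symplectic_type G s \<sigma>"
  obtains \<omega> where "skew \<omega>" "\<omega> \<noteq> 0" "\<And>M. M \<in> mat_rep ` carrier G \<Longrightarrow> \<exists>c. M ** \<omega> ** transpose M = smat c \<omega>"
proof -
  obtain \<epsilon> t where t: "t \<in> exterior_square s" "t \<noteq> 0"
    "\<And>g. g \<in> carrier G \<Longrightarrow> tensor_square_rep \<sigma> g t = fun_scale (inverse (\<epsilon> g)) t"
    using assms unfolding symplectic_type_def character_occurs_def by blast
  obtain \<omega> where \<omega>: "skew \<omega>" "t = tens \<omega>" using t(1) by (auto simp: exterior_square_tens)
  have "\<exists>c. M ** \<omega> ** transpose M = smat c \<omega>" if "M \<in> mat_rep ` carrier G" for M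
  proof -
    from that obtain g where g: "g \<in> carrier G" "M = mat_rep g" by blast
    have "tens (M ** \<omega> ** transpose M) = tens (smat (inverse (\<epsilon> g)) \<omega>)"
      using t(3)[OF g(1)] by (simp only: \<omega>(2) g(2) tensor_square_rep_tens[OF g(1)] tens_linear)
    then show ?thesis by (auto simp only: tens_inj)
  qed
  moreover have "\<omega> \<noteq> 0" using t(2) \<omega>(2) tens_0 by auto
  ultimately show ?thesis using that \<omega>(1) by blast
qed

end

section \<open>Proper similitudes\<close>

lemma poly_functions_sum:
  assumes "\<And>i. i \<in> A \<Longrightarrow> (\<lambda>f. p i f) \<in> poly_functions s"
  shows "(\<lambda>f. \<Sum>i\<in>A. p i f) \<in> poly_functions s"
  using assms
proof (induction A rule: infinite_finite_induct)
  case (insert x F)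
  then show ?case using poly_functions.add[of "p x" s "\<lambda>f. \<Sum>i\<in>F. p i f"] by simp
qed (simp_all add: poly_functions.const)

lemma poly_functions_prod:
  assumes "\<And>i. i \<in> A \<Longrightarrow> (\<lambda>f. p i f) \<in> poly_functions s"
  shows "(\<lambda>f. \<Prod>i\<in>A. p i f) \<in> poly_functions s"
  using assms
proof (induction A rule: infinite_finite_induct)
  case (insert x F)
  then show ?case using poly_functions.mult[of "p x" s "\<lambda>f. \<Prod>i\<in>F. p i f"] by simp
qed (simp_all add: poly_functions.const)

lemma openin_zariski_basic:
  assumes "p \<in> poly_functions s"
  shows "openin (zariski_topology s X) {f \<in> X. p f \<noteq> 0}"
  unfolding zariski_topology_def using assms by (intro topology_generated_by_Basis) blast

lemma topspace_zariski:
  fixes s :: "'k::field \<Rightarrow> 'v::ab_group_add \<Rightarrow> 'v"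
  shows "topspace (zariski_topology s X) = X"
proof
  have "openin (zariski_topology s X) {f \<in> X. (\<lambda>f. 1 :: 'k) f \<noteq> 0}"
    by (rule openin_zariski_basic[OF poly_functions.const])
  from openin_subset[OF this] show "X \<subseteq> topspace (zariski_topology s X)" by simp
  show "topspace (zariski_topology s X) \<subseteq> X"
    unfolding zariski_topology_def topology_generated_by_topspace by (rule Union_least) auto
qed

text \<open>The generating sets are given as a subbasis; they form a basis because two nonvanishing
  loci meet in the nonvanishing locus of the product.\<close>

lemma zariski_basis:
  fixes s :: "'k::field \<Rightarrow> 'v::ab_group_add \<Rightarrow> 'v"
  assumes "openin (zariski_topology s X) E" "f \<in> E"
  shows "\<exists>p\<in>poly_functions s. p f \<noteq> 0 \<and> {g \<in> X. p g \<noteq> 0} \<subseteq> E"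
proof -
  have "generate_topology_on {{f \<in> X. p f \<noteq> 0} | p. p \<in> poly_functions s} E"
    using assms(1) unfolding zariski_topology_def openin_topology_generated_by_iff .
  then show ?thesis using assms(2)
  proof (induction E)
    case Empty
    then show ?case by simp
  next
    case (Int A B)
    then obtain p q where "p \<in> poly_functions s" "p f \<noteq> 0" "{g \<in> X. p g \<noteq> 0} \<subseteq> A"
      "q \<in> poly_functions s" "q f \<noteq> 0" "{g \<in> X. q g \<noteq> 0} \<subseteq> B" by auto
    then show ?case by (intro bexI[of _ "\<lambda>f. p f * q f"] poly_functions.mult) auto
  next
    case (UN K)
    then obtain A where A: "A \<in> K" "f \<in> A" by blast
    with UN.IH[OF A] show ?case by blast
  next
    case (Basis A)
    then obtain p where "p \<in> poly_functions s" "A = {g \<in> X. p g \<noteq> 0}" by blast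
    with Basis.prems show ?case by (intro bexI[of _ p]) auto
  qed
qed

text \<open>A polynomial curve is connected because any two nonempty open subsets of the line meet.\<close>

lemma connected_component_curve:
  fixes s :: "'k::alg_closed_field \<Rightarrow> 'v::ab_group_add \<Rightarrow> 'v" and \<gamma> :: "'k \<Rightarrow> 'v \<Rightarrow> 'v"
  assumes poly: "\<And>l v. l \<in> dual_space s \<Longrightarrow> \<exists>P. \<forall>t. l (\<gamma> t v) = poly P t"
    and c: "c \<noteq> 0" "\<And>t. poly c t \<noteq> 0 \<Longrightarrow> \<gamma> t \<in> X"
    and ends: "poly c a \<noteq> 0" "poly c b \<noteq> 0"
  shows "connected_component_of (zariski_topology s X) (\<gamma> a) (\<gamma> b)"
proof -
  let ?T = "zariski_topology s X" and ?S = "\<gamma> ` {t. poly c t \<noteq> 0}"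
  have pf: "\<exists>P. \<forall>t. p (\<gamma> t) = poly P t" if "p \<in> poly_functions s" for p
    using that
  proof induction
    case (const x)
    show ?case by (rule exI[of _ "[:x:]"]) simp
  next
    case (coeff l v)
    then show ?case by (rule poly)
  next
    case (add p q)
    then obtain P Q where "\<forall>t. p (\<gamma> t) = poly P t" "\<forall>t. q (\<gamma> t) = poly Q t" by blast
    then show ?case by (intro exI[of _ "P + Q"]) simp
  next
    case (mult p q)
    then obtain P Q where "\<forall>t. p (\<gamma> t) = poly P t" "\<forall>t. q (\<gamma> t) = poly Q t" by blast
    then show ?case by (intro exI[of _ "P * Q"]) simp
  qed
  \<comment> \<open>A basic open set meeting the curve pulls back to the nonvanishing locus of a
    nonzero polynomial, so an open set that meets the curve misses only finitely many admissible
    parameters.\<close>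
  have nbhd: "\<exists>P. P \<noteq> 0 \<and> (\<forall>t. poly P t \<noteq> 0 \<longrightarrow> poly c t \<noteq> 0 \<longrightarrow> \<gamma> t \<in> E)"
    if E: "openin ?T E" and ne: "E \<inter> ?S \<noteq> {}" for E
  proof -
    obtain t0 where t0: "poly c t0 \<noteq> 0" "\<gamma> t0 \<in> E" using ne by blast
    obtain p where p: "p \<in> poly_functions s" "p (\<gamma> t0) \<noteq> 0" "{g \<in> X. p g \<noteq> 0} \<subseteq> E"
      using zariski_basis[OF E t0(2)] by blast
    obtain P where P: "\<And>t. p (\<gamma> t) = poly P t" using pf[OF p(1)] by blast
    have "P \<noteq> 0" using p(2) P by auto
    moreover have "\<gamma> t \<in> E" if "poly P t \<noteq> 0" "poly c t \<noteq> 0" for t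
      using p(3) c(2)[OF that(2)] that(1) P by auto
    ultimately show ?thesis by blast
  qed
  have "connectedin ?T ?S"
    unfolding connectedin
  proof (intro conjI notI)
    show "?S \<subseteq> topspace ?T" using c(2) by (auto simp: topspace_zariski)
    assume "\<exists>E1 E2. openin ?T E1 \<and> openin ?T E2 \<and> ?S \<subseteq> E1 \<union> E2 \<and> E1 \<inter> E2 \<inter> ?S = {} \<and>
      E1 \<inter> ?S \<noteq> {} \<and> E2 \<inter> ?S \<noteq> {}"
    then obtain E1 E2 where E: "openin ?T E1" "openin ?T E2" "E1 \<inter> E2 \<inter> ?S = {}"
      "E1 \<inter> ?S \<noteq> {}" "E2 \<inter> ?S \<noteq> {}" by blast
    obtain P where P: "P \<noteq> 0" "\<And>t. poly P t \<noteq> 0 \<Longrightarrow> poly c t \<noteq> 0 \<Longrightarrow> \<gamma> t \<in> E1"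
      using nbhd[OF E(1,4)] by blast
    obtain Q where Q: "Q \<noteq> 0" "\<And>t. poly Q t \<noteq> 0 \<Longrightarrow> poly c t \<noteq> 0 \<Longrightarrow> \<gamma> t \<in> E2"
      using nbhd[OF E(2,5)] by blast
    have "finite {t. poly (P * Q * c) t = 0}" using P(1) Q(1) c(1) by (intro poly_roots_finite) simp
    then obtain t where "poly (P * Q * c) t \<noteq> 0"
      using infinite_UNIV_alg_closed by (metis (mono_tags, lifting) UNIV_eq_I mem_Collect_eq)
    then have t: "poly P t \<noteq> 0" "poly Q t \<noteq> 0" "poly c t \<noteq> 0" by auto
    then have "\<gamma> t \<in> E1 \<inter> E2 \<inter> ?S" using P(2) Q(2) by blast
    with E(3) show False by blast
  qed
  then show ?thesis unfolding connected_component_of_def using ends by blast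
qed

section \<open>The identity component in orthonormal coordinates\<close>

locale orthonormal_coordinates = coordinates s \<kappa>
  for s :: "'k::alg_closed_field \<Rightarrow> 'v::ab_group_add \<Rightarrow> 'v" and \<kappa> :: "'k^4 \<Rightarrow> 'v" +
  fixes D :: "'v \<Rightarrow> 'v \<Rightarrow> 'k"
  assumes form: "D (\<kappa> x) (\<kappa> y) = scalar_product x y"
begin

definition end_of :: "'k^4^4 \<Rightarrow> 'v \<Rightarrow> 'v" where "end_of M v = \<kappa> (M *v coord v)"

lemma linear_end_of: "Vector_Spaces.linear s s (end_of M)"
  using vs by (simp add: linear_char end_of_def coord_linear \<kappa>_linear matrix_vector_right_distrib matrix_vector_scale)

lemma end_of_mtx: "Vector_Spaces.linear s s f \<Longrightarrow> end_of (mtx f) = f"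
  by (simp add: fun_eq_iff end_of_def flip: mtx_\<kappa>)

lemma end_of_1: "end_of (mat 1) = id"
  by (simp add: fun_eq_iff end_of_def)

lemma form_similitude:
  fixes M :: "'k^4^4"
  assumes "\<And>x y. scalar_product (M *v x) (M *v y) = c * scalar_product x y"
  shows "transpose M ** M = mat c"
proof -
  have "(transpose M ** M) $ i $ j = mat c $ i $ j" for i j
  proof -
    have "(transpose M ** M) $ i $ j = scalar_product (M *v axis i 1) (M *v axis j 1)"
      by (simp add: scalar_product_def matrix_vector_mult_def axis_def transpose_def matrix_mult_nth
          if_distrib[of "(*) _"] cong: if_cong)
    also have "\<dots> = c * scalar_product (axis i 1) (axis j 1)" by (rule assms)
    also have "\<dots> = mat c $ i $ j" by (simp only: scalar_product_axis(1)) (simp add: axis_def mat_def)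
    finally show ?thesis .
  qed
  then show ?thesis by (simp add: vec_eq_iff)
qed

lemma transpose_mult_commute:
  fixes M :: "'k^4^4"
  assumes "transpose M ** M = mat c" "c \<noteq> 0"
  shows "M ** transpose M = mat c"
proof -
  have "smat (1 / c) (transpose M) ** M = mat 1"
    using assms by (simp add: vec_eq_iff mat_def)
  then have "M ** smat (1 / c) (transpose M) = mat 1" by (simp only: matrix_left_right_inverse)
  then have "smat c (smat (1 / c) (M ** transpose M)) = smat c (mat 1)" by (simp only: smat_simps)
  then show ?thesis using assms(2) by (simp only: mat_eq_smat[of c] smat_simps) simp
qed

lemma mtx_similitude:
  assumes lin: "Vector_Spaces.linear s s f" and c: "c \<noteq> 0" "\<And>v w. D (f v) (f w) = c * D v w"
  shows "mtx f ** transpose (mtx f) = mat c"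
proof -
  have "scalar_product (mtx f *v x) (mtx f *v y) = c * scalar_product x y" for x y
    using c(2)[of "\<kappa> x" "\<kappa> y"] by (simp only: mtx_\<kappa>[OF lin] form)
  then show ?thesis by (intro transpose_mult_commute form_similitude c)
qed

lemma GO_iff:
  "f \<in> GO s D \<longleftrightarrow> Vector_Spaces.linear s s f \<and> (\<exists>c. c \<noteq> 0 \<and> mtx f ** transpose (mtx f) = mat c)"
proof
  assume f: "f \<in> GO s D"
  then obtain c where lin: "Vector_Spaces.linear s s f" and c: "c \<noteq> 0" "\<And>v w. D (f v) (f w) = c * D v w"
    by (auto simp: GO_def)
  with mtx_similitude
  show "Vector_Spaces.linear s s f \<and> (\<exists>c. c \<noteq> 0 \<and> mtx f ** transpose (mtx f) = mat c)" by blast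
next
  assume *: "Vector_Spaces.linear s s f \<and> (\<exists>c. c \<noteq> 0 \<and> mtx f ** transpose (mtx f) = mat c)"
  then obtain c where lin: "Vector_Spaces.linear s s f" and c: "c \<noteq> 0" "mtx f ** transpose (mtx f) = mat c" by blast
  define N where "N = smat (1 / c) (transpose (mtx f))"
  have N: "mtx f ** N = mat 1" using c by (simp add: N_def) (simp add: vec_eq_iff mat_def)
  then have N': "N ** mtx f = mat 1" by (simp only: matrix_left_right_inverse)
  have tM: "transpose (mtx f) ** mtx f = mat c"
    using transpose_mult_commute[of "transpose (mtx f)" c] c by simp
  have "bij f"
  proof (rule o_bij)
    show "end_of N \<circ> f = id" "f \<circ> end_of N = id"
      using N N' by (simp_all add: fun_eq_iff end_of_def mtx[OF lin] mtx_\<kappa>[OF lin] matrix_vector_mul_assoc)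
  qed
  moreover have "D (f v) (f w) = c * D v w" for v w
  proof -
    have "D (f (\<kappa> x)) (f (\<kappa> y)) = c * D (\<kappa> x) (\<kappa> y)" for x y
    proof -
      have "mat c *v x = c *s x" by (simp only: mat_eq_smat[of c] smat_simps matrix_vector_mul_lid)
      then show ?thesis
        by (simp only: mtx_\<kappa>[OF lin] form scalar_product_mult tM scalar_product_simps)
    qed
    from this[of "coord v" "coord w"] show ?thesis by simp
  qed
  ultimately show "f \<in> GO s D" using lin c(1) by (auto simp: GO_def)
qed

lemma mtx_end_of: "mtx (end_of M) = M"
proof (rule matrix_eqI)
  fix x
  have "\<kappa> (mtx (end_of M) *v x) = \<kappa> (M *v x)"
    by (simp add: end_of_def flip: mtx_\<kappa>[OF linear_end_of])
  then show "mtx (end_of M) *v x = M *v x" by (metis coord_inverse(1))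
qed

lemma GSO_if_det:
  assumes lin: "Vector_Spaces.linear s s f" and c: "mtx f ** transpose (mtx f) = mat c" "c \<noteq> 0" "det (mtx f) = c\<^sup>2"
  shows "f \<in> GSO s D"
proof -
  have "joined (mtx f) (mat 1)" by (rule proper_similitude_joined[OF two c])
  then obtain \<Gamma> d where \<Gamma>: "\<Gamma> ** transpose \<Gamma> = mat d" "poly d 0 \<noteq> 0" "poly d 1 \<noteq> 0"
    "(\<chi> i j. poly (\<Gamma>$i$j) 0) = mtx f" "(\<chi> i j. poly (\<Gamma>$i$j) 1) = mat 1"
    unfolding joined_def by auto
  define \<gamma> where "\<gamma> t = end_of (\<chi> i j. poly (\<Gamma>$i$j) t)" for t
  \<comment> \<open>The curve from \<open>joined\<close> starts at \<open>mtx f\<close> and ends at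
    the identity, so it is traversed from parameter 1 to parameter 0.\<close>
  have "connected_component_of (zariski_topology s (GO s D)) (\<gamma> 1) (\<gamma> 0)"
  proof (rule connected_component_curve)
    fix l v assume "l \<in> dual_space s"
    then have l: "l (\<kappa> x) = (\<Sum>i\<in>UNIV. x $ i * l (basis i))" for x
      using functional_expand[of l "\<kappa> x"] by (simp add: dual_space_def linear_times)
    show "\<exists>P. \<forall>t. l (\<gamma> t v) = poly P t"
      by (rule exI[of _ "\<Sum>i\<in>UNIV. (\<Sum>j\<in>UNIV. \<Gamma>$i$j * [:coord v $ j:]) * [:l (basis i):]"])
        (simp add: \<gamma>_def end_of_def l matrix_vector_mult_def poly_sum mult.commute)
  next
    show "d \<noteq> 0" using \<Gamma>(2) by auto
    fix t assume t: "poly d t \<noteq> 0"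
    have "transpose (\<chi> i j. poly (\<Gamma>$i$j) t) = (\<chi> i j. poly (transpose \<Gamma>$i$j) t)"
      by (simp add: vec_eq_iff transpose_def)
    then have "(\<chi> i j. poly (\<Gamma>$i$j) t) ** transpose (\<chi> i j. poly (\<Gamma>$i$j) t) = mat (poly d t)"
      by (simp flip: poly_matrix_mult add: \<Gamma>(1)) (simp add: vec_eq_iff mat_def)
    then show "\<gamma> t \<in> GO s D"
      unfolding GO_iff \<gamma>_def mtx_end_of using linear_end_of t by blast
  qed (use \<Gamma> in simp_all)
  then show ?thesis
    by (simp add: GSO_def \<gamma>_def \<Gamma> end_of_1 end_of_mtx[OF lin])
qed

lemma poly_functions_mtx: "(\<lambda>f. mtx f $ i $ j) \<in> poly_functions s"
  unfolding mtx_def vec_lambda_beta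
  by (rule poly_functions.coeff[of "\<lambda>v. coord v $ i"]) (simp add: dual_space_def linear_times coord_linear)

lemma poly_functions_det: "(\<lambda>f. det (mtx f)) \<in> poly_functions s"
  unfolding det_def
  by (intro poly_functions_sum poly_functions.mult[OF poly_functions.const] poly_functions_prod poly_functions_mtx)

lemma poly_functions_multiplier: "(\<lambda>f. (mtx f ** transpose (mtx f)) $ i $ j) \<in> poly_functions s"
  unfolding matrix_mult_nth transpose_def vec_lambda_beta
  by (intro poly_functions_sum poly_functions.mult poly_functions_mtx)

text \<open>On similitudes the determinant is plus or minus the square of the multiplier. Each
  alternative is the nonvanishing locus of a polynomial function, hence open, so a connected set
  through the identity stays with the plus sign.\<close>

lemma det_if_GSO:
  assumes "f \<in> GSO s D"
  shows "Vector_Spaces.linear s s f \<and> (\<exists>c. mtx f ** transpose (mtx f) = mat c \<and> det (mtx f) = c\<^sup>2)"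
proof -
  let ?T = "zariski_topology s (GO s D)"
  \<comment> \<open>A single diagonal entry exhibits the multiplier as a polynomial function of
    \<open>f\<close>.\<close>
  define m where "m f = (mtx f ** transpose (mtx f)) $ 1 $ 1" for f
  have m_poly: "m \<in> poly_functions s" unfolding m_def by (rule poly_functions_multiplier)
  have m: "mtx f ** transpose (mtx f) = mat (m f)" "m f \<noteq> 0" "det (mtx f) = (m f)\<^sup>2 \<or> det (mtx f) = - (m f)\<^sup>2"
    if "f \<in> GO s D" for f
  proof -
    obtain c where c: "c \<noteq> 0" "mtx f ** transpose (mtx f) = mat c" using \<open>f \<in> GO s D\<close> GO_iff by blast
    have mc: "m f = c" unfolding m_def c(2) by (simp add: mat_def)
    then show "mtx f ** transpose (mtx f) = mat (m f)" "m f \<noteq> 0" using c by simp_all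
    have "det (mtx f) * det (mtx f) = det (mat c :: 'k^4^4)" unfolding c(2)[symmetric] by (simp add: det_mul)
    also have "\<dots> = c\<^sup>2 * c\<^sup>2" by (simp add: det_4 mat_def power2_eq_square mult.assoc)
    finally show "det (mtx f) = (m f)\<^sup>2 \<or> det (mtx f) = - (m f)\<^sup>2"
      unfolding mc by (metis square_eq_iff)
  qed
  obtain S where S: "connectedin ?T S" "id \<in> S" "f \<in> S"
    using assms unfolding GSO_def connected_component_of_def by blast
  have S_sub: "S \<subseteq> GO s D" using connectedin_subset_topspace[OF S(1)] by (simp only: topspace_zariski)
  \<comment> \<open>Each alternative for the determinant is described by excluding the other; the
    two values differ because 2 and \<open>m f\<close> are nonzero.\<close>
  define E1 E2 where "E1 = {f \<in> GO s D. det (mtx f) + m f * m f \<noteq> 0}"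
    and "E2 = {f \<in> GO s D. det (mtx f) + (- 1) * (m f * m f) \<noteq> 0}"
  have open1: "openin ?T E1" unfolding E1_def
    by (rule openin_zariski_basic) (intro poly_functions.add poly_functions.mult m_poly poly_functions_det)
  have open2: "openin ?T E2" unfolding E2_def
    by (rule openin_zariski_basic)
      (intro poly_functions.add poly_functions.mult poly_functions.const m_poly poly_functions_det)
  have E: "f \<in> E1 \<longleftrightarrow> det (mtx f) = (m f)\<^sup>2" "f \<in> E2 \<longleftrightarrow> det (mtx f) \<noteq> (m f)\<^sup>2" if "f \<in> GO s D" for f
  proof -
    have "(m f)\<^sup>2 + (m f)\<^sup>2 = 2 * (m f)\<^sup>2" by simp
    then have "(m f)\<^sup>2 + (m f)\<^sup>2 \<noteq> 0" using two m(2)[OF that] by simp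
    then show "f \<in> E1 \<longleftrightarrow> det (mtx f) = (m f)\<^sup>2" "f \<in> E2 \<longleftrightarrow> det (mtx f) \<noteq> (m f)\<^sup>2"
      using m(3)[OF that] that by (auto simp: E1_def E2_def power2_eq_square)
  qed
  have mtx_id: "mtx id = mat 1" using mtx_end_of[of "mat 1"] by (simp only: end_of_1)
  have "det (mtx id) = (m id)\<^sup>2" by (simp add: m_def mtx_id) (simp add: mat_def)
  then have "id \<in> E1" using S(2) S_sub E(1) by blast
  have "E2 \<inter> S = {}"
  proof (rule ccontr)
    assume "E2 \<inter> S \<noteq> {}"
    moreover have "E1 \<inter> S \<noteq> {}" using \<open>id \<in> E1\<close> S(2) by blast
    moreover have "S \<subseteq> E1 \<union> E2" using S_sub E by blast
    moreover have "E1 \<inter> E2 \<inter> S = {}" using S_sub E by blast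
    ultimately show False using S(1) open1 open2 unfolding connectedin by blast
  qed
  then have "det (mtx f) = (m f)\<^sup>2" using S(3) S_sub E(2) by blast
  moreover have "f \<in> GO s D" using S(3) S_sub by blast
  ultimately show ?thesis using m(1) GO_iff by blast
qed

end

text \<open>A change of coordinates conjugates matrices by \<open>P\<close>. This transports the
  determinant condition from given coordinates to ones adapted to a form.\<close>

lemma det_mtx_unique:
  assumes "coordinates s \<kappa>" "coordinates s \<kappa>'" and f: "Vector_Spaces.linear s s f"
  shows "det (coordinates.mtx \<kappa>' f) = det (coordinates.mtx \<kappa> f)"
proof -
  interpret A: coordinates s \<kappa> by fact
  interpret B: coordinates s \<kappa>' by fact
  define P where "P = A.mtx (\<lambda>v. \<kappa>' (A.coord v))"
  have "Vector_Spaces.linear s s (\<lambda>v. \<kappa>' (A.coord v))"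
    using A.vs by (simp add: linear_char A.coord_linear B.\<kappa>_linear)
  then have P: "P *v x = A.coord (\<kappa>' x)" for x
    using A.mtx[of "\<lambda>v. \<kappa>' (A.coord v)" "\<kappa> x"] by (simp add: P_def)
  have "det P \<noteq> 0"
  proof
    assume "det P = 0"
    then obtain x where x: "x \<noteq> 0" "P *v x = 0" by (rule det_eq_0_kernel)
    then have "\<kappa> (A.coord (\<kappa>' x)) = \<kappa> 0" by (simp only: P)
    then have "B.coord (\<kappa>' x) = B.coord 0" by (simp only: A.coord_inverse A.\<kappa>_0)
    then show False using x(1) by (simp only: B.coord_inverse B.coord_0)
  qed
  moreover have "P ** B.mtx f = A.mtx f ** P"
  proof (rule A.matrix_eqI)
    fix x
    have "(P ** B.mtx f) *v x = A.coord (f (\<kappa>' x))"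
      by (simp only: P B.mtx_\<kappa>[OF f] matrix_vector_mul_assoc[symmetric])
    also have "\<dots> = (A.mtx f ** P) *v x"
      by (simp only: P A.mtx[OF f] matrix_vector_mul_assoc[symmetric])
    finally show "(P ** B.mtx f) *v x = (A.mtx f ** P) *v x" .
  qed
  then have "det P * det (B.mtx f) = det (A.mtx f) * det P" by (simp only: det_mul[symmetric])
  ultimately show ?thesis by (simp add: mult.commute)
qed

section \<open>The theorem\<close>

text \<open>\<open>C\<close> is a form on the dual of V; the form on V is its inverse
  \<open>C'\<close>, with the same multiplier. Coordinates orthonormal for it reduce the claim to
  \<open>GSO_if_det\<close>, since neither multiplier nor determinant depends on
  coordinates.\<close>

lemma proper_orthogonal_typeI:
  fixes s :: "'k::alg_closed_field \<Rightarrow> 'v::ab_group_add \<Rightarrow> 'v"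
  assumes R: "coord_rep s \<kappa> G \<sigma>" and dim: "vector_space.dim s (UNIV :: 'v set) = 4"
    and C: "transpose C = C" "det C \<noteq> 0"
    and sim: "\<And>g. g \<in> carrier G \<Longrightarrow> \<exists>c. coord_rep.mat_rep \<kappa> \<sigma> g ** C ** transpose (coord_rep.mat_rep \<kappa> \<sigma> g) = smat c C
      \<and> det (coord_rep.mat_rep \<kappa> \<sigma> g) = c\<^sup>2"
  shows "proper_orthogonal_type G s \<sigma>"
proof -
  interpret R: coord_rep s \<kappa> G \<sigma> by fact
  obtain C' where C': "C ** C' = mat 1" "C' ** C = mat 1"
    using C(2) invertible_det_nz invertible_def by metis
  have tC': "transpose C' = C'"
  proof -
    have "transpose C' ** C = mat 1" using arg_cong[OF C'(1), of transpose] by (simp add: matrix_transpose_mul C(1) transpose_mat)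
    then have "(transpose C' ** C) ** C' = C'" by simp
    then show ?thesis by (simp add: C' flip: matrix_mul_assoc)
  qed
  have adj: "scalar_product x (M *v z) = scalar_product (transpose M *v x) z" for M :: "'k^4^4" and x z
    by (simp add: scalar_product_def matrix_vector_mult_def transpose_def sum_4 algebra_simps
        del: transpose_matrix_vector)
  have comm: "scalar_product x z = scalar_product z x" for x z :: "'k^4"
    by (simp add: scalar_product_def mult.commute)
  define D where "D v w = scalar_product (R.coord v) (C' *v R.coord w)" for v w
  have D: "bilinear_form s D"
    by (simp add: bilinear_form_def R.linear_times D_def R.coord_linear scalar_product_simps
        matrix_vector_right_distrib matrix_vector_scale)
  have D_sym: "symmetric_form D"
    unfolding symmetric_form_def D_def using adj[of _ C'] tC' comm by metis
  have D_nd: "nondegenerate_form D"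
    unfolding nondegenerate_form_def
  proof (intro allI impI)
    fix v assume "\<forall>w. D v w = 0"
    then have "scalar_product (R.coord v) (C' *v (C *v axis i 1)) = 0" for i
      unfolding D_def by (metis R.coord_inverse(1))
    then have "R.coord v $ i = 0" for i by (simp add: matrix_vector_mul_assoc C' scalar_product_axis)
    then have "R.coord v = 0" by (simp add: vec_eq_iff)
    then have "\<kappa> (R.coord v) = \<kappa> 0" by (simp only:)
    then show "v = 0" by (simp only: R.coord_inverse R.\<kappa>_0)
  qed
  obtain \<kappa>' :: "'k^4 \<Rightarrow> 'v" where \<kappa>': "Vector_Spaces.linear (*s) s \<kappa>'" "bij \<kappa>'" "\<And>x y. D (\<kappa>' x) (\<kappa>' y) = scalar_product x y"
    using symmetric_form_coordinates[OF R.two R.vs dim D D_sym D_nd] by blast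
  interpret O: orthonormal_coordinates s \<kappa>' D
    by (intro orthonormal_coordinates.intro orthonormal_coordinates_axioms.intro coordinates.intro
        R.vs R.two \<kappa>')
  have "\<sigma> g \<in> GSO s D" if g: "g \<in> carrier G" for g
  proof -
    let ?M = "R.mat_rep g"
    obtain c where c: "?M ** C ** transpose ?M = smat c C" "det ?M = c\<^sup>2" using sim[OF g] by blast
    have "c \<noteq> 0" using c(2) R.det_nz[of ?M] g by auto
    \<comment> \<open>Cancelling \<open>?M\<close> and \<open>C\<close> in the similitude relation
      for \<open>C\<close> yields the one for the inverse form, with \<open>?M\<close> and its
      transpose exchanged.\<close>
    have "smat c C ** (C' ** ?M) = (?M ** C ** transpose ?M) ** (C' ** ?M)" by (simp only: c(1))
    then have "smat c ?M = ?M ** (C ** (transpose ?M ** C' ** ?M))"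
      by (simp add: matrix_mul_assoc C')
    then have "?M ** mat c = ?M ** (C ** (transpose ?M ** C' ** ?M))" by simp
    then have "mat c = C ** (transpose ?M ** C' ** ?M)"
      using matrix_cancel(1)[OF R.det_nz[of ?M]] g by blast
    then have "C' ** mat c = C' ** (C ** (transpose ?M ** C' ** ?M))" by (simp only:)
    then have MM: "transpose ?M ** C' ** ?M = smat c C'" by (simp add: matrix_mul_assoc C')
    have sim': "D (\<sigma> g v) (\<sigma> g w) = c * D v w" for v w
    proof -
      have "D (\<sigma> g v) (\<sigma> g w) = scalar_product (?M *v R.coord v) (C' *v (?M *v R.coord w))"
        by (simp only: D_def R.mtx[OF R.linear_\<sigma>[OF g]] R.mat_rep_def)
      also have "\<dots> = scalar_product (R.coord v) (transpose ?M *v (C' *v (?M *v R.coord w)))"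
        by (simp only: adj transpose_transpose)
      also have "\<dots> = c * D v w"
        by (simp only: matrix_vector_mul_assoc matrix_mul_assoc MM smat_simps scalar_product_simps D_def)
      finally show ?thesis .
    qed
    show ?thesis
    proof (rule O.GSO_if_det[OF R.linear_\<sigma>[OF g]])
      show "O.mtx (\<sigma> g) ** transpose (O.mtx (\<sigma> g)) = mat c"
        by (rule O.mtx_similitude[OF R.linear_\<sigma>[OF g] \<open>c \<noteq> 0\<close> sim'])
      show "det (O.mtx (\<sigma> g)) = c\<^sup>2"
        using det_mtx_unique[OF R.coordinates_axioms O.coordinates_axioms R.linear_\<sigma>[OF g]] c(2)
        by (simp add: R.mat_rep_def)
    qed fact
  qed
  moreover have "orthogonal_type G s \<sigma>"
    by (rule R.orthogonal_typeI[OF C]) (use sim in blast)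
  ultimately show ?thesis
    unfolding proper_orthogonal_type_def using D D_sym D_nd by blast
qed

theorem theorem6p5:
  fixes G :: "('g, 'm) monoid_scheme"
    and scale :: "'k::alg_closed_field \<Rightarrow> 'v::ab_group_add \<Rightarrow> 'v"
    and \<sigma> :: "'g \<Rightarrow> 'v \<Rightarrow> 'v"
  assumes "CHAR('k) \<noteq> 2"
    and "group G"
    and "vector_space scale"
    and "vector_space.dim scale (UNIV :: 'v set) = 4"
    and "group_rep G scale UNIV \<sigma>"
    and "irreducible_rep G scale UNIV \<sigma>"
  shows "reducible_rep G fun_scale (exterior_square scale) (tensor_square_rep \<sigma>) \<longleftrightarrow>
    symplectic_type G scale \<sigma> \<or> quadratic_self_twist G scale \<sigma> \<or> proper_orthogonal_type G scale \<sigma>"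
proof -
  note two = two_neq_0[OF assms(1)]
  obtain \<kappa> :: "'k^4 \<Rightarrow> 'v" where \<kappa>: "Vector_Spaces.linear (*s) scale \<kappa>" "bij \<kappa>"
    using coordinates_exist[OF assms(3,4)] by blast
  have R: "coord_rep scale \<kappa> G \<sigma>"
    by (intro coord_rep.intro coord_rep_axioms.intro coordinates.intro assms \<kappa> two)
  interpret R: coord_rep scale \<kappa> G \<sigma> by (rule R)
  show ?thesis
  proof
    assume "reducible_rep G fun_scale (exterior_square scale) (tensor_square_rep \<sigma>)"
    then obtain U where U: "R.stable U" "U \<noteq> {0}" "U \<noteq> {A. skew A}"
      by (auto simp only: R.reducible_iff_stable)
    from U show "symplectic_type G scale \<sigma> \<or> quadratic_self_twist G scale \<sigma> \<or> proper_orthogonal_type G scale \<sigma>"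
    proof (cases rule: R.stable_cases)
      case (symplectic \<omega>)
      then show ?thesis using R.symplectic_typeI[of \<omega>] by blast
    next
      case (self_twist J)
      then show ?thesis using R.quadratic_self_twistI[of J] by blast
    next
      case (orthogonal C)
      then have "proper_orthogonal_type G scale \<sigma>"
        by (intro proper_orthogonal_typeI[OF R assms(4)]) blast+
      then show ?thesis by blast
    qed
  next
    assume "symplectic_type G scale \<sigma> \<or> quadratic_self_twist G scale \<sigma> \<or> proper_orthogonal_type G scale \<sigma>"
    then show "reducible_rep G fun_scale (exterior_square scale) (tensor_square_rep \<sigma>)"
    proof (elim disjE)
      assume "symplectic_type G scale \<sigma>"
      then have "\<exists>\<omega>. skew \<omega> \<and> \<omega> \<noteq> 0 \<and>
          (\<forall>M\<in>R.mat_rep ` carrier G. \<exists>c. M ** \<omega> ** transpose M = smat c \<omega>)"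
        by (rule R.symplectic_typeE) blast
      then show ?thesis unfolding R.reducible_iff_stable using R.stable_line by blast
    next
      assume "quadratic_self_twist G scale \<sigma>"
      then have "\<exists>J. det J \<noteq> 0 \<and> (\<forall>M\<in>R.mat_rep ` carrier G. J ** M = M ** J \<or> J ** M = - (M ** J)) \<and>
          (\<exists>M\<in>R.mat_rep ` carrier G. J ** M \<noteq> M ** J)"
        by (rule R.quadratic_self_twistE) blast
      then show ?thesis unfolding R.reducible_iff_stable using R.stable_self_twist by blast
    next
      assume "proper_orthogonal_type G scale \<sigma>"
      then obtain D where D: "bilinear_form scale D" "symmetric_form D" "nondegenerate_form D"
        "\<sigma> ` carrier G \<subseteq> GSO scale D"
        unfolding proper_orthogonal_type_def by blast
      \<comment> \<open>Coordinates are chosen anew, orthonormal for \<open>D\<close>: there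
        membership in \<open>GSO\<close> gives the determinant condition under which the self-dual
        matrices are stable.\<close>
      obtain \<kappa>' :: "'k^4 \<Rightarrow> 'v" where \<kappa>': "Vector_Spaces.linear (*s) scale \<kappa>'" "bij \<kappa>'" "\<And>x y. D (\<kappa>' x) (\<kappa>' y) = scalar_product x y"
        using symmetric_form_coordinates[OF two assms(3,4) D(1-3)] by blast
      interpret O: orthonormal_coordinates scale \<kappa>' D
        by (intro orthonormal_coordinates.intro orthonormal_coordinates_axioms.intro coordinates.intro
            assms two \<kappa>')
      interpret S: coord_rep scale \<kappa>' G \<sigma>
        by (intro coord_rep.intro coord_rep_axioms.intro O.coordinates_axioms assms)
      have "\<exists>c. M ** transpose M = mat c \<and> det M = c\<^sup>2" if "M \<in> S.mat_rep ` carrier G" for M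
        using that D(4) O.det_if_GSO by (auto simp: S.mat_rep_def)
      then show ?thesis unfolding S.reducible_iff_stable by (rule S.stable_selfdual)
    qed
  qed
qed

end
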